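(* Let $E/F$ be a finite-dimensional purely inseparable field extension of exponent one in characteristic $p>0$, and let $\delta$ be a derivation on $E$ with $F=\{a\in E : \delta(a)=0\}$. Let $D$ be an associative central division algebra over $F$ such that $D_E=D\otimes_F E$ is a division algebra, and extend $\delta$ to a derivation $\delta$ of $D_E$ with $\delta|_D=0$. Suppose $g(t)=t^p-t\in F[t]$ is the minimum polynomial of $\delta$ (on $E$), let $d\in E$, and let $f(t)=t^p-t-d\in E[t;\delta]$. Then $$(E,\delta,d)\otimes_F D\cong D_E[t;\delta]/D_E[t;\delta]f(t),$$ and the following are equivalent: (a) $(E,\delta,d)\otimes_F D$ is a (not necessarily associative) division algebra over $F$ of dimension $p^2[D:F]$; (b) $d\neq V_p(z)-z$ for all $z\in D_E$; (c) $d\neq t^p-(t-z)^p-z$ (in $D_E[t;\delta]$) for all $z\in D_E$. Moreover, ${\rm Aut}_F((E,\delta,d)\otimes_F D)$ has a cyclic subgroup of order $p$ generated by $G=G_{id,-1}$; in particular $G|_D=id_D$.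
   Context: For a division ring $B$ with derivation $\delta$, $B[t;\delta]$ is the differential polynomial ring: polynomials $\sum a_it^i$ with left coefficients $a_i\in B$, termwise addition, and multiplication determined by $ta=at+\delta(a)$ for $a\in B$. It has right division: for all $h,f$ with $f\neq 0$ there are unique $q,r$ with $h=qf+r$ and $\deg r<\deg f$; write $r=h \bmod_r f$. For monic $f\in B[t;\delta]$ of degree $m\ge 2$, the Petit algebra $S_f=B[t;\delta]/B[t;\delta]f$ is $\{h\in B[t;\delta] : \deg h<m\}$ with multiplication $h\circ k = hk \bmod_r f$; it is a unital, not necessarily associative algebra over the field of elements of the center of $B$ killed by $\delta$. Here $(E,\delta,d)$ denotes $S_f=E[t;\delta]/E[t;\delta]f(t)$ with $f(t)=t^p-t-d$, an algebra over $F$. Central division algebras are finite-dimensional. A nonassociative algebra $A\neq0$ is a division algebra if for each $a\neq 0$ left and right multiplication by $a$ are bijective. For $b\in D_E$, $V_p(b)\in D_E$ is defined by $(t-b)^p=t^p-V_p(b)$ in $D_E[t;\delta]$. $G_{id,-1}$ denotes the map $\sum a_it^i\mapsto\sum a_i(t-1)^i$, with $a_i\in D_E$, on $D_E[t;\delta]/D_E[t;\delta]f(t)\cong (E,\delta,d)\otimes_F D$. *)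

theory Defs
  imports
    "HOL-Algebra.UnivPoly"
    "HOL-Algebra.QuotRing"
    "HOL-Algebra.Subrings"
    "HOL-Algebra.Bij"
    "HOL-Algebra.Elementary_Groups"
    "Jordan_Normal_Form.Missing_VectorSpace"
begin

section \<open>Fields, derivations, minimum polynomials\<close>

definition has_characteristic :: "('a, 'm) ring_scheme \<Rightarrow> nat \<Rightarrow> bool" where
  "has_characteristic R p \<longleftrightarrow> (\<forall>n::nat. [n] \<cdot>\<^bsub>R\<^esub> \<one>\<^bsub>R\<^esub> = \<zero>\<^bsub>R\<^esub> \<longleftrightarrow> p dvd n)"

definition purely_inseparable :: "('a, 'm) ring_scheme \<Rightarrow> 'a set \<Rightarrow> nat \<Rightarrow> bool" where
  "purely_inseparable E F p \<longleftrightarrow> (\<forall>x\<in>carrier E. \<exists>n::nat. x [^]\<^bsub>E\<^esub> (p ^ n) \<in> F)"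

definition has_exponent :: "('a, 'm) ring_scheme \<Rightarrow> 'a set \<Rightarrow> nat \<Rightarrow> nat \<Rightarrow> bool" where
  "has_exponent E F p e \<longleftrightarrow>
     (\<forall>x\<in>carrier E. x [^]\<^bsub>E\<^esub> (p ^ e) \<in> F) \<and>
     (\<forall>e'<e. \<not> (\<forall>x\<in>carrier E. x [^]\<^bsub>E\<^esub> (p ^ e') \<in> F))"

definition derivation :: "('a, 'm) ring_scheme \<Rightarrow> ('a \<Rightarrow> 'a) \<Rightarrow> bool" where
  "derivation R \<delta> \<longleftrightarrow>
     \<delta> \<in> carrier R \<rightarrow> carrier R \<and>
     (\<forall>x\<in>carrier R. \<forall>y\<in>carrier R.
        \<delta> (x \<oplus>\<^bsub>R\<^esub> y) = \<delta> x \<oplus>\<^bsub>R\<^esub> \<delta> y \<and>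
        \<delta> (x \<otimes>\<^bsub>R\<^esub> y) = (x \<otimes>\<^bsub>R\<^esub> \<delta> y) \<oplus>\<^bsub>R\<^esub> (\<delta> x \<otimes>\<^bsub>R\<^esub> y))"

definition eval_at_map ::
  "('k, 'm) ring_scheme \<Rightarrow> ('k, 'v, 'n) module_scheme \<Rightarrow> ('v \<Rightarrow> 'v) \<Rightarrow> (nat \<Rightarrow> 'k) \<Rightarrow> 'v \<Rightarrow> 'v" where
  "eval_at_map K V T g x =
     (\<Oplus>\<^bsub>V\<^esub>i\<in>{..deg K g}. up_ring.coeff (UP K) g i \<odot>\<^bsub>V\<^esub> (T ^^ i) x)"

definition is_minimum_polynomial ::
  "('k, 'm) ring_scheme \<Rightarrow> ('k, 'v, 'n) module_scheme \<Rightarrow> ('v \<Rightarrow> 'v) \<Rightarrow> (nat \<Rightarrow> 'k) \<Rightarrow> bool" where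
  "is_minimum_polynomial K V T g \<longleftrightarrow>
     g \<in> carrier (UP K) \<and> up_ring.coeff (UP K) g (deg K g) = \<one>\<^bsub>K\<^esub> \<and>
     (\<forall>x\<in>carrier V. eval_at_map K V T g x = \<zero>\<^bsub>V\<^esub>) \<and>
     (\<forall>h\<in>carrier (UP K). h \<noteq> \<zero>\<^bsub>UP K\<^esub> \<and> (\<forall>x\<in>carrier V. eval_at_map K V T h x = \<zero>\<^bsub>V\<^esub>)
        \<longrightarrow> deg K g \<le> deg K h)"


section \<open>Nonassociative algebras\<close>

text \<open>A module record over \<open>K\<close> carries the data of a unital nonassociative \<open>K\<close>-algebra;
  the predicate below does not ask for associativity.\<close>

definition nonassoc_algebra :: "('k, 'm) ring_scheme \<Rightarrow> ('k, 'a, 'n) module_scheme \<Rightarrow> bool" where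
  "nonassoc_algebra K A \<longleftrightarrow>
     vectorspace K A \<and>
     (\<forall>x\<in>carrier A. \<forall>y\<in>carrier A. x \<otimes>\<^bsub>A\<^esub> y \<in> carrier A) \<and>
     (\<forall>x\<in>carrier A. \<forall>y\<in>carrier A. \<forall>z\<in>carrier A.
        (x \<oplus>\<^bsub>A\<^esub> y) \<otimes>\<^bsub>A\<^esub> z = (x \<otimes>\<^bsub>A\<^esub> z) \<oplus>\<^bsub>A\<^esub> (y \<otimes>\<^bsub>A\<^esub> z) \<and>
        z \<otimes>\<^bsub>A\<^esub> (x \<oplus>\<^bsub>A\<^esub> y) = (z \<otimes>\<^bsub>A\<^esub> x) \<oplus>\<^bsub>A\<^esub> (z \<otimes>\<^bsub>A\<^esub> y)) \<and>
     (\<forall>c\<in>carrier K. \<forall>x\<in>carrier A. \<forall>y\<in>carrier A.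
        (c \<odot>\<^bsub>A\<^esub> x) \<otimes>\<^bsub>A\<^esub> y = c \<odot>\<^bsub>A\<^esub> (x \<otimes>\<^bsub>A\<^esub> y) \<and>
        x \<otimes>\<^bsub>A\<^esub> (c \<odot>\<^bsub>A\<^esub> y) = c \<odot>\<^bsub>A\<^esub> (x \<otimes>\<^bsub>A\<^esub> y))"

definition division_algebra :: "('k, 'm) ring_scheme \<Rightarrow> ('k, 'a, 'n) module_scheme \<Rightarrow> bool" where
  "division_algebra K A \<longleftrightarrow>
     nonassoc_algebra K A \<and> carrier A \<noteq> {\<zero>\<^bsub>A\<^esub>} \<and>
     (\<forall>a\<in>carrier A. a \<noteq> \<zero>\<^bsub>A\<^esub> \<longrightarrow>
        bij_betw (\<lambda>x. a \<otimes>\<^bsub>A\<^esub> x) (carrier A) (carrier A) \<and>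
        bij_betw (\<lambda>x. x \<otimes>\<^bsub>A\<^esub> a) (carrier A) (carrier A))"

definition center :: "('a, 'm) ring_scheme \<Rightarrow> 'a set" where
  "center R = {z \<in> carrier R. \<forall>x\<in>carrier R. z \<otimes>\<^bsub>R\<^esub> x = x \<otimes>\<^bsub>R\<^esub> z}"

definition central_division_algebra ::
  "('k, 'm) ring_scheme \<Rightarrow> ('k, 'a, 'n) module_scheme \<Rightarrow> bool" where
  "central_division_algebra K D \<longleftrightarrow>
     ring D \<and> division_algebra K D \<and> vectorspace.fin_dim K D \<and>
     center D = (\<lambda>c. c \<odot>\<^bsub>D\<^esub> \<one>\<^bsub>D\<^esub>) ` carrier K"

text \<open>\<open>ring_iso\<close> and \<open>ring_hom\<close> only refer to the operations, so they apply to nonassociative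
  multiplications as well.\<close>

definition algebra_iso ::
  "('k, 'm) ring_scheme \<Rightarrow> ('k, 'a, 'n) module_scheme \<Rightarrow> ('k, 'b, 'o) module_scheme \<Rightarrow> ('a \<Rightarrow> 'b) set"
  where
  "algebra_iso K A B =
     {h \<in> ring_iso A B. \<forall>c\<in>carrier K. \<forall>x\<in>carrier A. h (c \<odot>\<^bsub>A\<^esub> x) = c \<odot>\<^bsub>B\<^esub> h x}"

definition algebra_Aut ::
  "('k, 'm) ring_scheme \<Rightarrow> ('k, 'a, 'n) module_scheme \<Rightarrow> ('a \<Rightarrow> 'a) monoid" where
  "algebra_Aut K A =
     BijGroup (carrier A) \<lparr>carrier := algebra_iso K A A \<inter> Bij (carrier A)\<rparr>"

definition self_algebra :: "'a ring \<Rightarrow> ('a, 'a) module" where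
  "self_algebra E =
     \<lparr>carrier = carrier E, mult = mult E, one = one E, zero = zero E, add = add E, smult = mult E\<rparr>"


section \<open>Tensor products of algebras\<close>

text \<open>The free \<open>K\<close>-module on the set \<open>carrier A \<times> carrier B\<close> (finitely supported functions), with
  the multiplication that extends \<open>(a, b) (a', b') = (a a', b b')\<close> bilinearly.\<close>

definition free_algebra ::
  "('k, 'm) ring_scheme \<Rightarrow> ('k, 'a, 'n) module_scheme \<Rightarrow> ('k, 'b, 'o) module_scheme
     \<Rightarrow> ('k, 'a \<times> 'b \<Rightarrow> 'k) module" where
  "free_algebra K A B =
     \<lparr>carrier = {u. u \<in> UNIV \<rightarrow> carrier K \<and> finite {z. u z \<noteq> \<zero>\<^bsub>K\<^esub>} \<and>
                   {z. u z \<noteq> \<zero>\<^bsub>K\<^esub>} \<subseteq> carrier A \<times> carrier B},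
      mult = (\<lambda>u v z. \<Oplus>\<^bsub>K\<^esub>w \<in> {(x, y). u x \<noteq> \<zero>\<^bsub>K\<^esub> \<and> v y \<noteq> \<zero>\<^bsub>K\<^esub> \<and>
                              (fst x \<otimes>\<^bsub>A\<^esub> fst y, snd x \<otimes>\<^bsub>B\<^esub> snd y) = z}.
                        u (fst w) \<otimes>\<^bsub>K\<^esub> v (snd w)),
      one = (\<lambda>z. if z = (\<one>\<^bsub>A\<^esub>, \<one>\<^bsub>B\<^esub>) then \<one>\<^bsub>K\<^esub> else \<zero>\<^bsub>K\<^esub>),
      zero = (\<lambda>z. \<zero>\<^bsub>K\<^esub>),
      add = (\<lambda>u v z. u z \<oplus>\<^bsub>K\<^esub> v z),
      smult = (\<lambda>c u z. c \<otimes>\<^bsub>K\<^esub> u z)\<rparr>"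

definition free_gen :: "('k, 'm) ring_scheme \<Rightarrow> 'a \<Rightarrow> 'b \<Rightarrow> 'a \<times> 'b \<Rightarrow> 'k" where
  "free_gen K a b = (\<lambda>z. if z = (a, b) then \<one>\<^bsub>K\<^esub> else \<zero>\<^bsub>K\<^esub>)"

definition tensor_relators ::
  "('k, 'm) ring_scheme \<Rightarrow> ('k, 'a, 'n) module_scheme \<Rightarrow> ('k, 'b, 'o) module_scheme
     \<Rightarrow> ('a \<times> 'b \<Rightarrow> 'k) set" where
  "tensor_relators K A B =
     (let M = free_algebra K A B; g = free_gen K in
        {g (a \<oplus>\<^bsub>A\<^esub> a') b \<ominus>\<^bsub>M\<^esub> (g a b \<oplus>\<^bsub>M\<^esub> g a' b) | a a' b.
           a \<in> carrier A \<and> a' \<in> carrier A \<and> b \<in> carrier B} \<union>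
        {g a (b \<oplus>\<^bsub>B\<^esub> b') \<ominus>\<^bsub>M\<^esub> (g a b \<oplus>\<^bsub>M\<^esub> g a b') | a b b'.
           a \<in> carrier A \<and> b \<in> carrier B \<and> b' \<in> carrier B} \<union>
        {g (c \<odot>\<^bsub>A\<^esub> a) b \<ominus>\<^bsub>M\<^esub> (c \<odot>\<^bsub>M\<^esub> g a b) | a b c.
           a \<in> carrier A \<and> b \<in> carrier B \<and> c \<in> carrier K} \<union>
        {g a (c \<odot>\<^bsub>B\<^esub> b) \<ominus>\<^bsub>M\<^esub> (c \<odot>\<^bsub>M\<^esub> g a b) | a b c.
           a \<in> carrier A \<and> b \<in> carrier B \<and> c \<in> carrier K})"

definition tensor_kernel ::
  "('k, 'm) ring_scheme \<Rightarrow> ('k, 'a, 'n) module_scheme \<Rightarrow> ('k, 'b, 'o) module_scheme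
     \<Rightarrow> ('a \<times> 'b \<Rightarrow> 'k) set" where
  "tensor_kernel K A B =
     LinearCombinations.module.span K (free_algebra K A B) (tensor_relators K A B)"

definition tensor_algebra ::
  "('k, 'm) ring_scheme \<Rightarrow> ('k, 'a, 'n) module_scheme \<Rightarrow> ('k, 'b, 'o) module_scheme
     \<Rightarrow> ('k, ('a \<times> 'b \<Rightarrow> 'k) set) module" where
  "tensor_algebra K A B =
     (let M = free_algebra K A B; N = tensor_kernel K A B; Q = M Quot N in
        \<lparr>carrier = carrier Q, mult = mult Q, one = one Q, zero = zero Q, add = add Q,
         smult = (\<lambda>c U. \<Union>u\<in>U. N +>\<^bsub>M\<^esub> (c \<odot>\<^bsub>M\<^esub> u))\<rparr>)"

definition pure_tensor ::
  "('k, 'm) ring_scheme \<Rightarrow> ('k, 'a, 'n) module_scheme \<Rightarrow> ('k, 'b, 'o) module_scheme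
     \<Rightarrow> 'a \<Rightarrow> 'b \<Rightarrow> ('a \<times> 'b \<Rightarrow> 'k) set" where
  "pure_tensor K A B a b = tensor_kernel K A B +>\<^bsub>free_algebra K A B\<^esub> free_gen K a b"


section \<open>Differential polynomials and Petit algebras\<close>

text \<open>Elements are coefficient sequences, the coefficients standing on the left.  The rule
  \<open>t a = a t + \<delta>(a)\<close> turns left multiplication by \<open>t\<close> into the following map on coefficients.\<close>

definition t_times :: "('b, 'm) ring_scheme \<Rightarrow> ('b \<Rightarrow> 'b) \<Rightarrow> (nat \<Rightarrow> 'b) \<Rightarrow> nat \<Rightarrow> 'b" where
  "t_times B \<delta> q = (\<lambda>n. (if n = 0 then \<zero>\<^bsub>B\<^esub> else q (n - 1)) \<oplus>\<^bsub>B\<^esub> \<delta> (q n))"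

definition diff_poly_ring :: "('b, 'm) ring_scheme \<Rightarrow> ('b \<Rightarrow> 'b) \<Rightarrow> (nat \<Rightarrow> 'b) ring" where
  "diff_poly_ring B \<delta> =
     \<lparr>carrier = up B,
      mult = (\<lambda>h q n. \<Oplus>\<^bsub>B\<^esub>i \<in> {i. h i \<noteq> \<zero>\<^bsub>B\<^esub>}. h i \<otimes>\<^bsub>B\<^esub> (t_times B \<delta> ^^ i) q n),
      one = (\<lambda>n. if n = 0 then \<one>\<^bsub>B\<^esub> else \<zero>\<^bsub>B\<^esub>),
      zero = (\<lambda>n. \<zero>\<^bsub>B\<^esub>),
      add = (\<lambda>h q n. h n \<oplus>\<^bsub>B\<^esub> q n)\<rparr>"

abbreviation monomial :: "('b, 'm) ring_scheme \<Rightarrow> 'b \<Rightarrow> nat \<Rightarrow> nat \<Rightarrow> 'b" where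
  "monomial B a n \<equiv> up_ring.monom (UP B) a n"

abbreviation const_poly :: "('b, 'm) ring_scheme \<Rightarrow> 'b \<Rightarrow> nat \<Rightarrow> 'b" where
  "const_poly B a \<equiv> monomial B a 0"

abbreviation t_var :: "('b, 'm) ring_scheme \<Rightarrow> nat \<Rightarrow> 'b" where
  "t_var B \<equiv> monomial B \<one>\<^bsub>B\<^esub> 1"

text \<open>Since \<open>deg\<close> is \<open>0\<close> at the zero polynomial, the case \<open>r = 0\<close> is listed separately.\<close>

definition right_mod ::
  "('b, 'm) ring_scheme \<Rightarrow> ('b \<Rightarrow> 'b) \<Rightarrow> (nat \<Rightarrow> 'b) \<Rightarrow> (nat \<Rightarrow> 'b) \<Rightarrow> nat \<Rightarrow> 'b" where
  "right_mod B \<delta> h f =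
     (let R = diff_poly_ring B \<delta> in
      THE r. r \<in> carrier R \<and> (r = \<zero>\<^bsub>R\<^esub> \<or> deg B r < deg B f) \<and>
             (\<exists>q\<in>carrier R. h = (q \<otimes>\<^bsub>R\<^esub> f) \<oplus>\<^bsub>R\<^esub> r))"

text \<open>The scalar action on \<open>B[t;\<delta>]/B[t;\<delta>]f\<close> is the coefficientwise action of the base field of
  the algebra \<open>B\<close>.\<close>

definition petit_algebra ::
  "('k, 'b, 'm) module_scheme \<Rightarrow> ('b \<Rightarrow> 'b) \<Rightarrow> (nat \<Rightarrow> 'b) \<Rightarrow> ('k, nat \<Rightarrow> 'b) module" where
  "petit_algebra B \<delta> f =
     (let R = diff_poly_ring B \<delta> in
        \<lparr>carrier = {h \<in> carrier R. deg B h < deg B f},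
         mult = (\<lambda>h k. right_mod B \<delta> (h \<otimes>\<^bsub>R\<^esub> k) f),
         one = one R, zero = zero R, add = add R,
         smult = (\<lambda>c h n. c \<odot>\<^bsub>B\<^esub> h n)\<rparr>)"

text \<open>\<open>t^p - t - d\<close>\<close>

definition AS_poly ::
  "('b, 'm) ring_scheme \<Rightarrow> ('b \<Rightarrow> 'b) \<Rightarrow> nat \<Rightarrow> 'b \<Rightarrow> nat \<Rightarrow> 'b" where
  "AS_poly B \<delta> p d =
     (let R = diff_poly_ring B \<delta> in
        t_var B [^]\<^bsub>R\<^esub> p \<ominus>\<^bsub>R\<^esub> t_var B \<ominus>\<^bsub>R\<^esub> const_poly B d)"

text \<open>\<open>V_p(b)\<close>, defined by \<open>(t - b)^p = t^p - V_p(b)\<close>\<close>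

definition V_pow :: "('b, 'm) ring_scheme \<Rightarrow> ('b \<Rightarrow> 'b) \<Rightarrow> nat \<Rightarrow> 'b \<Rightarrow> 'b" where
  "V_pow B \<delta> p b =
     (let R = diff_poly_ring B \<delta> in
      THE v. v \<in> carrier B \<and>
        (t_var B \<ominus>\<^bsub>R\<^esub> const_poly B b) [^]\<^bsub>R\<^esub> p = t_var B [^]\<^bsub>R\<^esub> p \<ominus>\<^bsub>R\<^esub> const_poly B v)"

text \<open>\<open>G_{id,-1}\<close>, the map \<open>\<Sum> a_i t^i \<mapsto> \<Sum> a_i (t - 1)^i\<close>; it does not raise degrees, so no
  reduction modulo \<open>f\<close> is needed on the Petit algebra.\<close>

definition G_id_minus_one ::
  "('b, 'm) ring_scheme \<Rightarrow> ('b \<Rightarrow> 'b) \<Rightarrow> (nat \<Rightarrow> 'b) \<Rightarrow> nat \<Rightarrow> 'b" where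
  "G_id_minus_one B \<delta> h =
     (let R = diff_poly_ring B \<delta> in
      \<Oplus>\<^bsub>R\<^esub>i \<in> {i. h i \<noteq> \<zero>\<^bsub>B\<^esub>}. const_poly B (h i) \<otimes>\<^bsub>R\<^esub> (t_var B \<ominus>\<^bsub>R\<^esub> \<one>\<^bsub>R\<^esub>) [^]\<^bsub>R\<^esub> i)"

end

theory Submission
  imports Defs "HOL-Computational_Algebra.Polynomial" "HOL-Number_Theory.Residues"
begin

text \<open>
  Put \<open>B = D\<^sub>E\<close> and \<open>R = B[t;\<delta>]\<close>. The coefficient of \<open>t\<^sup>i\<close> in
  \<open>(t - b)\<^sup>n\<close> is \<open>n choose i\<close> times an element of \<open>B\<close>, so in characteristic
  \<open>p\<close> the element \<open>V\<^sub>p(b)\<close> exists, and \<open>t - z\<close> is a right factor of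
  \<open>f = t\<^sup>p - t - d\<close> iff \<open>d = V\<^sub>p(z) - z\<close>. The substitution
  \<open>G: t \<mapsto> t - 1\<close> is an automorphism of \<open>R\<close> of order \<open>p\<close> that fixes \<open>f\<close>,
  hence it acts on \<open>R/Rf\<close>.

  If \<open>f\<close> has a proper right factor, let \<open>q\<close> be one of least degree \<open>r > 0\<close>. The
  intersection of the left ideals \<open>R G\<^sup>i(q)\<close> is generated by a monic \<open>G\<close>-invariant
  \<open>A\<close> whose degree is a multiple of \<open>r\<close>. A monic polynomial of degree \<open>n\<close> with
  \<open>0 < n < p\<close> is never \<open>G\<close>-invariant, since \<open>G\<close> changes its coefficient of
  \<open>t\<^bsup>n-1\<^esup>\<close> by \<open>n \<noteq> 0\<close>. So \<open>A\<close> has degree \<open>p\<close>, \<open>r\<close> divides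
  \<open>p\<close>, and \<open>r = 1\<close>: a reducible \<open>f\<close> has a linear right factor. Zero divisors of the
  finite-dimensional algebra \<open>R/Rf\<close> correspond to proper right factors of \<open>f\<close>.

  The isomorphism sends \<open>h \<otimes> x\<close> to the polynomial with coefficients \<open>x \<otimes> h\<^sub>i\<close>;
  its inverse is assembled coefficient by coefficient from the universal property. Finally
  \<open>[E:F] = p\<close>: the operator \<open>\<delta>\<close> is annihilated by
  \<open>X\<^sup>p - X = X (X - 1) \<dots> (X - p + 1)\<close>, it has an eigenvector \<open>e\<close> with eigenvalue
  \<open>1\<close>, and the powers of \<open>e\<close> span the eigenspaces.
\<close>

hide_const (open) Multiset.mult Polynomial.smult Polynomial.order

section \<open>Differential polynomial rings\<close>

text \<open>In the commutative theory \<open>t -> t - 1\<close> permutes the roots of an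
  Artin-Schreier polynomial transitively, so all its irreducible factors have the same degree. Over
  a noncommutative \<open>B\<close> a product of right factors is in general not a right factor.
  Products are therefore replaced by least common left multiples, and factors by the left ideals
  they generate. One identity controls all degrees: if \<open>g\<close> is the greatest common right
  divisor of \<open>A\<close> and \<open>C\<close>, and \<open>h A\<close> their least common left
  multiple, then deg h + deg g = deg C. When \<open>C\<close> is a right factor of \<open>f\<close>
  of least positive degree, deg g can only be 0 or deg C. The same identity settles zero divisors:
  \<open>h k\<close> in \<open>R f\<close> with \<open>h\<close> nonzero of degree below
  \<open>p\<close> forces \<open>k\<close> and \<open>f\<close> to have a nonconstant common right
  divisor. As \<open>R f\<close> is only a left ideal, products in the quotient are remainders, and
  every map between such quotients is checked on an equation \<open>h k = q f + r\<close>. The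
  dimension is a product of three numbers: \<open>p\<close> powers of \<open>t\<close>, [E:F] and
  [D:F]. Hence [E:F] = p has to be extracted from the minimum polynomial of \<delta>.\<close>

lemma (in abelian_group) swap_sides:
  assumes "a \<in> carrier G" "b \<in> carrier G" "c \<in> carrier G" "d \<in> carrier G" "a \<oplus> b = c \<oplus> d"
  shows "a \<ominus> c = d \<ominus> b"
proof -
  have "a = (a \<oplus> b) \<oplus> \<ominus> b" using assms(1,2) by (simp add: a_assoc r_neg)
  also have "\<dots> = (c \<oplus> d) \<oplus> \<ominus> b" using assms(5) by simp
  finally have "a = (c \<oplus> d) \<oplus> \<ominus> b" .
  then have "a \<ominus> c = (d \<ominus> b) \<oplus> c \<oplus> \<ominus> c" using assms by (simp add: minus_eq a_ac)
  also have "\<dots> = d \<ominus> b" using assms by (subst a_assoc) (auto simp: r_neg)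
  finally show ?thesis .
qed

lemma (in abelian_group) add_minus_cancel:
  "x \<in> carrier G \<Longrightarrow> y \<in> carrier G \<Longrightarrow> (x \<oplus> y) \<ominus> x = y"
  by (simp add: minus_eq a_comm[of x y] a_assoc r_neg)

text \<open>The coefficients form an arbitrary ring: the ring structure, the degree bounds and
  division by monic polynomials need no inverses. The locale is used for both \<open>E\<close> and
  \<open>D \<otimes> E\<close>.\<close>

locale diff_ring = ring B for B (structure) +
  fixes \<delta>
  assumes der: "derivation B \<delta>"
begin

lemma der_closed [simp, intro]: "x \<in> carrier B \<Longrightarrow> \<delta> x \<in> carrier B"
  using der by (auto simp: derivation_def)

lemma der_add: "\<lbrakk>x \<in> carrier B; y \<in> carrier B\<rbrakk> \<Longrightarrow> \<delta> (x \<oplus> y) = \<delta> x \<oplus> \<delta> y"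
  using der by (auto simp: derivation_def)

lemma der_mult: "\<lbrakk>x \<in> carrier B; y \<in> carrier B\<rbrakk> \<Longrightarrow> \<delta> (x \<otimes> y) = x \<otimes> \<delta> y \<oplus> \<delta> x \<otimes> y"
  using der by (auto simp: derivation_def)

lemma der_zero [simp]: "\<delta> \<zero> = \<zero>"
proof -
  have "\<delta> \<zero> \<oplus> \<delta> \<zero> = \<delta> \<zero>" using der_add[of \<zero> \<zero>] by simp
  then show ?thesis by (metis add.r_cancel_one' der_closed zero_closed)
qed

lemma der_one [simp]: "\<delta> \<one> = \<zero>"
proof -
  have "\<delta> \<one> \<oplus> \<delta> \<one> = \<delta> \<one>" using der_mult[of \<one> \<one>] by simp
  then show ?thesis by (metis add.r_cancel_one' der_closed one_closed)
qed

section \<open>The ring of differential polynomials\<close>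

abbreviation R where "R \<equiv> diff_poly_ring B \<delta>"
abbreviation R_mult (infixl "\<star>" 70) where "h \<star> q \<equiv> h \<otimes>\<^bsub>R\<^esub> q"
abbreviation \<tau> where "\<tau> \<equiv> t_times B \<delta>"

text \<open>The library monomial is specified only for coefficients in the carrier;
  \<open>mon\<close> is total, so unfolding it needs no side condition.\<close>

definition mon :: "'a \<Rightarrow> nat \<Rightarrow> nat \<Rightarrow> 'a" where
  "mon a n = (\<lambda>i. if i = n then a else \<zero>)"

lemma monomial_eq: "a \<in> carrier B \<Longrightarrow> monomial B a n = mon a n"
  by (simp add: UP_def mon_def)

lemma R_simps: "carrier R = up B" "\<zero>\<^bsub>R\<^esub> = (\<lambda>n. \<zero>)" "\<one>\<^bsub>R\<^esub> = mon \<one> 0"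
  "h \<oplus>\<^bsub>R\<^esub> q = (\<lambda>n. h n \<oplus> q n)"
  by (auto simp: diff_poly_ring_def mon_def)

lemma up_iff: "h \<in> up B \<longleftrightarrow> (\<forall>i. h i \<in> carrier B) \<and> (\<exists>n. \<forall>i\<ge>n. h i = \<zero>)"
proof -
  have "(\<exists>n. bound \<zero> n h) \<longleftrightarrow> (\<exists>n. \<forall>i\<ge>n. h i = \<zero>)"
    unfolding bound_def by (metis Suc_le_eq less_imp_le)
  then show ?thesis by (auto simp: up_def Pi_iff)
qed

lemma up_closed [simp]: "h \<in> up B \<Longrightarrow> h i \<in> carrier B"
  by (simp add: up_iff)

lemma upI: "(\<And>i. h i \<in> carrier B) \<Longrightarrow> (\<And>i. i \<ge> n \<Longrightarrow> h i = \<zero>) \<Longrightarrow> h \<in> up B"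
  by (auto simp: up_iff)

lemma upE: "h \<in> up B \<Longrightarrow> (\<And>n. (\<And>i. i \<ge> n \<Longrightarrow> h i = \<zero>) \<Longrightarrow> thesis) \<Longrightarrow> thesis"
  by (auto simp: up_iff)

lemma up_finite: "h \<in> up B \<Longrightarrow> finite {i. h i \<noteq> \<zero>}"
  unfolding up_iff by (metis (mono_tags, lifting) finite_nat_set_iff_bounded mem_Collect_eq not_le)

lemma mon_up [simp]: "a \<in> carrier B \<Longrightarrow> mon a n \<in> up B"
  unfolding up_iff mon_def by (intro conjI allI exI[of _ "Suc n"]) auto

lemma zero_up [simp]: "(\<lambda>n. \<zero>) \<in> up B"
  by (auto simp: up_iff)

lemma add_up [simp]:
  assumes "h \<in> up B" "q \<in> up B" shows "(\<lambda>n. h n \<oplus> q n) \<in> up B"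
proof -
  obtain m n where "\<And>i. i \<ge> m \<Longrightarrow> h i = \<zero>" "\<And>i. i \<ge> n \<Longrightarrow> q i = \<zero>"
    using assms by (metis upE)
  then show ?thesis using assms by (intro upI[where n="max m n"]) auto
qed

lemma smult_up [simp]:
  assumes "a \<in> carrier B" "q \<in> up B" shows "(\<lambda>n. a \<otimes> q n) \<in> up B"
proof -
  obtain n where "\<And>i. i \<ge> n \<Longrightarrow> q i = \<zero>" using assms by (metis upE)
  then show ?thesis using assms by (intro upI[where n=n]) auto
qed

lemma minus_up [simp]:
  assumes "q \<in> up B" shows "(\<lambda>n. \<ominus> q n) \<in> up B"
proof -
  obtain n where "\<And>i. i \<ge> n \<Longrightarrow> q i = \<zero>" using assms by (metis upE)
  then show ?thesis using assms by (intro upI[where n=n]) auto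
qed

text \<open>Multiplication and substitution are additive, so identities need checking on monomials
  only, and rearrangements of double sums are avoided. The induction strips the leading term of a
  polynomial bounded by \<open>n\<close>.\<close>

lemma up_induct [consumes 1, case_names add mon]:
  assumes h: "h \<in> up B"
    and add: "\<And>h q. h \<in> up B \<Longrightarrow> q \<in> up B \<Longrightarrow> Q h \<Longrightarrow> Q q \<Longrightarrow> Q (\<lambda>n. h n \<oplus> q n)"
    and mon: "\<And>a i. a \<in> carrier B \<Longrightarrow> Q (mon a i)"
  shows "Q h"
proof -
  have "\<forall>h. h \<in> up B \<and> (\<forall>i\<ge>n. h i = \<zero>) \<longrightarrow> Q h" for n
  proof (induction n)
    case 0
    have "(\<lambda>n. \<zero>) = mon \<zero> 0" by (auto simp: mon_def)
    then have "Q (\<lambda>n. \<zero>)" using mon by simp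
    moreover have "h = (\<lambda>n. \<zero>)" if "\<forall>i\<ge>0. h i = \<zero>" for h :: "nat \<Rightarrow> 'a" using that by auto
    ultimately show ?case by metis
  next
    case (Suc n)
    show ?case
    proof (intro allI impI)
      fix h assume h: "h \<in> up B \<and> (\<forall>i\<ge>Suc n. h i = \<zero>)"
      define g where "g = (\<lambda>i. if i < n then h i else \<zero>)"
      have g: "g \<in> up B" "\<forall>i\<ge>n. g i = \<zero>" using h by (auto simp: g_def up_iff)
      have "h = (\<lambda>i. g i \<oplus> mon (h n) n i)"
      proof
        fix i show "h i = g i \<oplus> mon (h n) n i"
          using h by (cases "i < n"; cases "i = n") (auto simp: g_def mon_def)
      qed
      then show "Q h" using add[of g "mon (h n) n"] mon[of "h n" n] g h Suc by auto
    qed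
  qed
  then show ?thesis using h unfolding up_iff by blast
qed

lemma \<tau>_up [simp]: "q \<in> up B \<Longrightarrow> \<tau> q \<in> up B"
proof -
  assume q: "q \<in> up B"
  then obtain n where n: "\<forall>i\<ge>n. q i = \<zero>" by (auto simp: up_iff)
  have "\<forall>i\<ge>Suc n. \<tau> q i = \<zero>" using n by (auto simp: t_times_def)
  then show ?thesis unfolding up_iff using q by (auto simp: t_times_def)
qed

lemma \<tau>_pow_up [simp]: "q \<in> up B \<Longrightarrow> (\<tau> ^^ i) q \<in> up B"
  by (induction i) auto

lemma \<tau>_add: "h \<in> up B \<Longrightarrow> q \<in> up B \<Longrightarrow> \<tau> (\<lambda>n. h n \<oplus> q n) = (\<lambda>n. \<tau> h n \<oplus> \<tau> q n)"
  by (auto simp: t_times_def der_add a_ac)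

lemma \<tau>_pow_add: "h \<in> up B \<Longrightarrow> q \<in> up B \<Longrightarrow>
   (\<tau> ^^ i) (\<lambda>n. h n \<oplus> q n) = (\<lambda>n. (\<tau> ^^ i) h n \<oplus> (\<tau> ^^ i) q n)"
  by (induction i) (auto simp: \<tau>_add)

lemma \<tau>_smult: "a \<in> carrier B \<Longrightarrow> q \<in> up B \<Longrightarrow>
    \<tau> (\<lambda>n. a \<otimes> q n) = (\<lambda>n. a \<otimes> \<tau> q n \<oplus> \<delta> a \<otimes> q n)"
  by (rule ext) (auto simp: t_times_def der_mult r_distr a_ac)

lemma \<tau>_mon: "a \<in> carrier B \<Longrightarrow> \<tau> (mon a i) = (\<lambda>n. mon a (Suc i) n \<oplus> mon (\<delta> a) i n)"
  by (rule ext) (auto simp: t_times_def mon_def)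

lemma \<tau>_pow_one: "(\<tau> ^^ i) (mon \<one> 0) = mon \<one> i"
proof (induction i)
  case (Suc i)
  then show ?case by (simp add: \<tau>_mon) (auto simp: mon_def)
qed simp

text \<open>The defining sum runs over the support of the left factor; enlarging it by zero terms
  lets two polynomials share one index set.\<close>

lemma mult_alt:
  assumes "h \<in> up B" "q \<in> up B" "finite X" "{i. h i \<noteq> \<zero>} \<subseteq> X"
  shows "(h \<star> q) n = (\<Oplus>i\<in>X. h i \<otimes> (\<tau> ^^ i) q n)"
proof -
  have "(\<Oplus>i\<in>{i. h i \<noteq> \<zero>}. h i \<otimes> (\<tau> ^^ i) q n) = (\<Oplus>i\<in>X. h i \<otimes> (\<tau> ^^ i) q n)"
    using assms by (intro add.finprod_mono_neutral_cong_left) auto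
  then show ?thesis by (simp add: diff_poly_ring_def)
qed

lemma mult_mon:
  assumes "a \<in> carrier B" "q \<in> up B"
  shows "mon a i \<star> q = (\<lambda>n. a \<otimes> (\<tau> ^^ i) q n)"
proof
  fix n
  have "(mon a i \<star> q) n = (\<Oplus>j\<in>{i}. mon a i j \<otimes> (\<tau> ^^ j) q n)"
    by (rule mult_alt) (simp_all add: assms, auto simp: mon_def split: if_splits)
  then show "(mon a i \<star> q) n = a \<otimes> (\<tau> ^^ i) q n" using assms by (simp add: mon_def)
qed

lemma mult_add_left:
  assumes "h \<in> up B" "h' \<in> up B" "q \<in> up B"
  shows "(\<lambda>n. h n \<oplus> h' n) \<star> q = (\<lambda>n. (h \<star> q) n \<oplus> (h' \<star> q) n)"
proof
  fix n
  let ?X = "{i. h i \<noteq> \<zero>} \<union> {i. h' i \<noteq> \<zero>}"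
  have X: "finite ?X" using assms up_finite by auto
  have "((\<lambda>n. h n \<oplus> h' n) \<star> q) n = (\<Oplus>i\<in>?X. (h i \<oplus> h' i) \<otimes> (\<tau> ^^ i) q n)"
    by (rule mult_alt) (use assms X in auto)
  also have "\<dots> = (\<Oplus>i\<in>?X. h i \<otimes> (\<tau> ^^ i) q n \<oplus> h' i \<otimes> (\<tau> ^^ i) q n)"
    using assms by (intro add.finprod_cong') (auto simp: l_distr)
  also have "\<dots> = (\<Oplus>i\<in>?X. h i \<otimes> (\<tau> ^^ i) q n) \<oplus> (\<Oplus>i\<in>?X. h' i \<otimes> (\<tau> ^^ i) q n)"
    using assms by (intro add.finprod_multf) auto
  also have "(\<Oplus>i\<in>?X. h i \<otimes> (\<tau> ^^ i) q n) = (h \<star> q) n"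
    by (rule mult_alt[symmetric]) (use assms X in auto)
  also have "(\<Oplus>i\<in>?X. h' i \<otimes> (\<tau> ^^ i) q n) = (h' \<star> q) n"
    by (rule mult_alt[symmetric]) (use assms X in auto)
  finally show "((\<lambda>n. h n \<oplus> h' n) \<star> q) n = (h \<star> q) n \<oplus> (h' \<star> q) n" .
qed

lemma mult_add_right:
  assumes "h \<in> up B" "q \<in> up B" "q' \<in> up B"
  shows "h \<star> (\<lambda>n. q n \<oplus> q' n) = (\<lambda>n. (h \<star> q) n \<oplus> (h \<star> q') n)"
proof
  fix n
  let ?X = "{i. h i \<noteq> \<zero>}"
  have X: "finite ?X" using assms up_finite by auto
  have "(h \<star> (\<lambda>n. q n \<oplus> q' n)) n = (\<Oplus>i\<in>?X. h i \<otimes> (\<tau> ^^ i) (\<lambda>n. q n \<oplus> q' n) n)"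
    by (rule mult_alt) (use assms X in auto)
  also have "\<dots> = (\<Oplus>i\<in>?X. h i \<otimes> (\<tau> ^^ i) q n \<oplus> h i \<otimes> (\<tau> ^^ i) q' n)"
    using assms by (intro add.finprod_cong') (auto simp: r_distr \<tau>_pow_add)
  also have "\<dots> = (\<Oplus>i\<in>?X. h i \<otimes> (\<tau> ^^ i) q n) \<oplus> (\<Oplus>i\<in>?X. h i \<otimes> (\<tau> ^^ i) q' n)"
    using assms by (intro add.finprod_multf) auto
  also have "(\<Oplus>i\<in>?X. h i \<otimes> (\<tau> ^^ i) q n) = (h \<star> q) n"
    by (rule mult_alt[symmetric]) (use assms X in auto)
  also have "(\<Oplus>i\<in>?X. h i \<otimes> (\<tau> ^^ i) q' n) = (h \<star> q') n"
    by (rule mult_alt[symmetric]) (use assms X in auto)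
  finally show "(h \<star> (\<lambda>n. q n \<oplus> q' n)) n = (h \<star> q) n \<oplus> (h \<star> q') n" .
qed

lemma mult_up [simp]: "h \<in> up B \<Longrightarrow> q \<in> up B \<Longrightarrow> h \<star> q \<in> up B"
  by (induction h rule: up_induct) (auto simp: mult_mon mult_add_left)

lemma smult_mult:
  "h \<in> up B \<Longrightarrow> q \<in> up B \<Longrightarrow> a \<in> carrier B \<Longrightarrow> (\<lambda>n. a \<otimes> h n) \<star> q = (\<lambda>n. a \<otimes> (h \<star> q) n)"
proof (induction h rule: up_induct)
  case (add h q)
  then show ?case by (simp add: r_distr mult_add_left)
next
  case (mon b i)
  have "(\<lambda>n. a \<otimes> mon b i n) = mon (a \<otimes> b) i" using mon by (auto simp: mon_def)
  then show ?case using mon by (auto simp: mult_mon m_assoc)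
qed

text \<open>Left multiplication by \<open>t\<close> commutes with right multiplication by
  \<open>q\<close>. Together with \<open>smult_mult\<close> this is all that associativity
  requires.\<close>

lemma \<tau>_mult: "h \<in> up B \<Longrightarrow> q \<in> up B \<Longrightarrow> \<tau> h \<star> q = \<tau> (h \<star> q)"
proof (induction h rule: up_induct)
  case (add h q)
  then show ?case by (simp add: \<tau>_add mult_add_left)
next
  case (mon a i)
  then show ?case by (simp add: \<tau>_mon mult_add_left mult_mon \<tau>_smult)
qed

lemma \<tau>_pow_mult: "h \<in> up B \<Longrightarrow> q \<in> up B \<Longrightarrow> (\<tau> ^^ i) h \<star> q = (\<tau> ^^ i) (h \<star> q)"
  by (induction i) (auto simp: \<tau>_mult)

text \<open>For \<open>h = a t^i\<close> both sides equal \<open>a\<close> times the i-th iterate of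
  \<open>\<tau>\<close> applied to \<open>q \<star> k\<close>.\<close>

lemma mult_assoc: "h \<in> up B \<Longrightarrow> q \<in> up B \<Longrightarrow> k \<in> up B \<Longrightarrow> (h \<star> q) \<star> k = h \<star> (q \<star> k)"
proof (induction h rule: up_induct)
  case (add h q)
  then show ?case by (simp add: mult_add_left)
next
  case (mon a i)
  then show ?case by (simp add: mult_mon smult_mult \<tau>_pow_mult)
qed

lemma one_mult: "q \<in> up B \<Longrightarrow> mon \<one> 0 \<star> q = q"
  by (simp add: mult_mon)

lemma mult_one: "q \<in> up B \<Longrightarrow> q \<star> mon \<one> 0 = q"
proof (induction q rule: up_induct)
  case (add h q)
  then show ?case by (simp add: mult_add_left)
next
  case (mon a i)
  then show ?case by (simp add: mult_mon \<tau>_pow_one) (auto simp: mon_def)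
qed

lemma ring_R: "ring R"
proof (rule ringI)
  show "abelian_group R"
  proof (rule abelian_groupI)
    fix x assume "x \<in> carrier R"
    then show "\<exists>y\<in>carrier R. y \<oplus>\<^bsub>R\<^esub> x = \<zero>\<^bsub>R\<^esub>"
      by (intro bexI[of _ "\<lambda>n. \<ominus> x n"]) (auto simp: R_simps l_neg)
  qed (auto simp: R_simps a_ac)
  show "monoid R"
    by (rule monoidI) (auto simp: R_simps mult_assoc one_mult mult_one)
qed (auto simp: R_simps mult_add_left mult_add_right)

sublocale R: ring R by (rule ring_R)

lemma R_uminus: "h \<in> up B \<Longrightarrow> \<ominus>\<^bsub>R\<^esub> h = (\<lambda>n. \<ominus> h n)"
  by (rule R.minus_equality) (auto simp: R_simps l_neg)

lemma R_minus: "h \<in> up B \<Longrightarrow> q \<in> up B \<Longrightarrow> h \<ominus>\<^bsub>R\<^esub> q = (\<lambda>n. h n \<ominus> q n)"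
  by (simp add: a_minus_def R_uminus R_simps)

lemma t_mult: "q \<in> up B \<Longrightarrow> mon \<one> (Suc 0) \<star> q = \<tau> q"
  by (simp add: mult_mon)

lemma t_pow: "mon \<one> (Suc 0) [^]\<^bsub>R\<^esub> i = mon \<one> i"
proof (induction i)
  case (Suc i)
  then have "mon \<one> (Suc 0) [^]\<^bsub>R\<^esub> Suc i = mon \<one> i \<star> mon \<one> (Suc 0)" by simp
  also have "\<dots> = (\<tau> ^^ i) ((\<tau> ^^ Suc 0) (mon \<one> 0))" by (subst \<tau>_pow_one) (simp add: mult_mon)
  also have "\<dots> = (\<tau> ^^ Suc i) (mon \<one> 0)"
    by (simp add: funpow_swap1)
  finally show ?case by (simp only: \<tau>_pow_one)
qed (simp add: R_simps)

lemma const_mult: "a \<in> carrier B \<Longrightarrow> q \<in> up B \<Longrightarrow> mon a 0 \<star> q = (\<lambda>n. a \<otimes> q n)"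
  by (simp add: mult_mon)

lemma mon_factor: "a \<in> carrier B \<Longrightarrow> mon a i = mon a 0 \<star> mon \<one> (Suc 0) [^]\<^bsub>R\<^esub> i"
  by (subst t_pow, subst const_mult) (simp_all, auto simp: mon_def)

section \<open>Substitution for the variable\<close>

definition subst_t :: "(nat \<Rightarrow> 'a) \<Rightarrow> (nat \<Rightarrow> 'a) \<Rightarrow> nat \<Rightarrow> 'a" where
  "subst_t s h = (\<Oplus>\<^bsub>R\<^esub>i\<in>{i. h i \<noteq> \<zero>}. mon (h i) 0 \<star> s [^]\<^bsub>R\<^esub> i)"

lemma pow_up [simp]: "s \<in> up B \<Longrightarrow> s [^]\<^bsub>R\<^esub> (i::nat) \<in> up B"
  using R.nat_pow_closed[of s i] by (simp add: R_simps)

lemma mon_zero [simp]: "mon \<zero> i = (\<lambda>n. \<zero>)"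
  by (auto simp: mon_def)

lemma mon_add: "\<lbrakk>a \<in> carrier B; b \<in> carrier B\<rbrakk> \<Longrightarrow> mon (a \<oplus> b) i = (\<lambda>n. mon a i n \<oplus> mon b i n)"
  by (auto simp: mon_def)

lemma zero_mult [simp]: "q \<in> up B \<Longrightarrow> (\<lambda>n. \<zero>) \<star> q = (\<lambda>n. \<zero>)"
  using R.l_null[of q] by (simp add: R_simps)

lemma subst_t_alt:
  assumes "h \<in> up B" "s \<in> up B" "finite X" "{i. h i \<noteq> \<zero>} \<subseteq> X"
  shows "subst_t s h = (\<Oplus>\<^bsub>R\<^esub>i\<in>X. mon (h i) 0 \<star> s [^]\<^bsub>R\<^esub> i)"
  unfolding subst_t_def
  using assms by (intro R.add.finprod_mono_neutral_cong_left) (auto simp: R_simps)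

lemma subst_t_up [simp]: "h \<in> up B \<Longrightarrow> s \<in> up B \<Longrightarrow> subst_t s h \<in> up B"
  unfolding subst_t_def using R.finsum_closed[of _ "{i. h i \<noteq> \<zero>}"] by (auto simp: R_simps Pi_def)

lemma subst_t_add:
  assumes "h \<in> up B" "q \<in> up B" "s \<in> up B"
  shows "subst_t s (\<lambda>n. h n \<oplus> q n) = (\<lambda>n. subst_t s h n \<oplus> subst_t s q n)"
proof -
  let ?X = "{i. h i \<noteq> \<zero>} \<union> {i. q i \<noteq> \<zero>}"
  have X: "finite ?X" using assms up_finite by auto
  have "subst_t s (\<lambda>n. h n \<oplus> q n) = (\<Oplus>\<^bsub>R\<^esub>i\<in>?X. mon (h i \<oplus> q i) 0 \<star> s [^]\<^bsub>R\<^esub> i)"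
    by (rule subst_t_alt) (use assms X in auto)
  also have "\<dots> = (\<Oplus>\<^bsub>R\<^esub>i\<in>?X. mon (h i) 0 \<star> s [^]\<^bsub>R\<^esub> i \<oplus>\<^bsub>R\<^esub> mon (q i) 0 \<star> s [^]\<^bsub>R\<^esub> i)"
    using assms by (intro R.add.finprod_cong') (auto simp: mon_add mult_add_left R_simps)
  also have "\<dots> = (\<Oplus>\<^bsub>R\<^esub>i\<in>?X. mon (h i) 0 \<star> s [^]\<^bsub>R\<^esub> i) \<oplus>\<^bsub>R\<^esub> (\<Oplus>\<^bsub>R\<^esub>i\<in>?X. mon (q i) 0 \<star> s [^]\<^bsub>R\<^esub> i)"
    using assms by (intro R.add.finprod_multf) (auto simp: R_simps)
  also have "(\<Oplus>\<^bsub>R\<^esub>i\<in>?X. mon (h i) 0 \<star> s [^]\<^bsub>R\<^esub> i) = subst_t s h"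
    by (rule subst_t_alt[symmetric]) (use assms X in auto)
  also have "(\<Oplus>\<^bsub>R\<^esub>i\<in>?X. mon (q i) 0 \<star> s [^]\<^bsub>R\<^esub> i) = subst_t s q"
    by (rule subst_t_alt[symmetric]) (use assms X in auto)
  finally show ?thesis by (simp add: R_simps)
qed

lemma subst_t_mon:
  assumes "a \<in> carrier B" "s \<in> up B"
  shows "subst_t s (mon a i) = mon a 0 \<star> s [^]\<^bsub>R\<^esub> i"
proof -
  have "subst_t s (mon a i) = (\<Oplus>\<^bsub>R\<^esub>j\<in>{i}. mon (mon a i j) 0 \<star> s [^]\<^bsub>R\<^esub> j)"
    by (rule subst_t_alt) (simp_all add: assms, auto simp: mon_def split: if_splits)
  also have "\<dots> = mon (mon a i i) 0 \<star> s [^]\<^bsub>R\<^esub> i"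
    using assms by (simp add: R_simps)
  finally show ?thesis by (simp add: mon_def[of a i])
qed

text \<open>The elements that may be substituted for \<open>t\<close>.\<close>

definition var_like :: "(nat \<Rightarrow> 'a) \<Rightarrow> bool" where
  "var_like s \<longleftrightarrow> s \<in> up B \<and>
     (\<forall>a\<in>carrier B. s \<star> mon a 0 = mon a 0 \<star> s \<oplus>\<^bsub>R\<^esub> mon (\<delta> a) 0)"

lemma var_like_up [simp]: "var_like s \<Longrightarrow> s \<in> up B"
  by (simp add: var_like_def)

lemma subst_t_smult: "h \<in> up B \<Longrightarrow> a \<in> carrier B \<Longrightarrow> s \<in> up B \<Longrightarrow>
   subst_t s (\<lambda>n. a \<otimes> h n) = mon a 0 \<star> subst_t s h"
proof (induction h rule: up_induct)
  case (add h q)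
  then show ?case by (simp add: r_distr subst_t_add mult_add_right)
next
  case (mon b i)
  have "(\<lambda>n. a \<otimes> mon b i n) = mon (a \<otimes> b) i" using mon by (auto simp: mon_def)
  moreover have "mon (a \<otimes> b) 0 = mon a 0 \<star> mon b 0" using mon by (subst const_mult) (auto, auto simp: mon_def)
  ultimately show ?case using mon by (simp add: subst_t_mon mult_assoc)
qed

text \<open>Here the rule of \<open>var_like\<close> enters: it lets \<open>s\<close> pass a
  coefficient exactly as \<open>t\<close> does. Multiplicativity of the substitution follows from
  this case, since every monomial is a coefficient times a power of \<open>t\<close>.\<close>

lemma subst_t_\<tau>: "h \<in> up B \<Longrightarrow> var_like s \<Longrightarrow> subst_t s (\<tau> h) = s \<star> subst_t s h"
proof (induction h rule: up_induct)
  case (add h q)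
  then show ?case by (simp add: \<tau>_add subst_t_add mult_add_right)
next
  case (mon a i)
  have s: "s \<in> carrier R" "s \<in> up B" using mon by (auto simp: R_simps)
  have "s \<star> subst_t s (mon a i) = (s \<star> mon a 0) \<star> s [^]\<^bsub>R\<^esub> i"
    using mon by (simp add: subst_t_mon mult_assoc)
  also have "s \<star> mon a 0 = mon a 0 \<star> s \<oplus>\<^bsub>R\<^esub> mon (\<delta> a) 0"
    using mon by (simp add: var_like_def)
  also have "\<dots> \<star> s [^]\<^bsub>R\<^esub> i = mon a 0 \<star> (s \<star> s [^]\<^bsub>R\<^esub> i) \<oplus>\<^bsub>R\<^esub> mon (\<delta> a) 0 \<star> s [^]\<^bsub>R\<^esub> i"
    using mon by (simp add: R_simps mult_add_left mult_assoc)
  also have "s \<star> s [^]\<^bsub>R\<^esub> i = s [^]\<^bsub>R\<^esub> Suc i" using s R.nat_pow_Suc2 by simp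
  finally show ?case using mon by (simp add: \<tau>_mon subst_t_add subst_t_mon R_simps)
qed

lemma subst_t_\<tau>_pow: "h \<in> up B \<Longrightarrow> var_like s \<Longrightarrow> subst_t s ((\<tau> ^^ i) h) = s [^]\<^bsub>R\<^esub> i \<star> subst_t s h"
proof (induction i)
  case (Suc i)
  have s: "s \<in> carrier R" "s \<in> up B" using Suc by (auto simp: R_simps)
  have "s [^]\<^bsub>R\<^esub> Suc i = s \<star> s [^]\<^bsub>R\<^esub> i" using s R.nat_pow_Suc2 by simp
  then show ?case using Suc by (simp add: subst_t_\<tau> mult_assoc del: R.nat_pow_Suc)
qed (simp add: R_simps one_mult)

lemma subst_t_mult: "h \<in> up B \<Longrightarrow> q \<in> up B \<Longrightarrow> var_like s \<Longrightarrow> subst_t s (h \<star> q) = subst_t s h \<star> subst_t s q"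
proof (induction h rule: up_induct)
  case (add h q)
  then show ?case by (simp add: subst_t_add mult_add_left)
next
  case (mon a i)
  then have "subst_t s (mon a i \<star> q) = mon a 0 \<star> (s [^]\<^bsub>R\<^esub> i \<star> subst_t s q)"
    by (simp only: mult_mon subst_t_smult subst_t_\<tau>_pow \<tau>_pow_up var_like_up)
  then show ?case using mon by (simp add: subst_t_mon mult_assoc)
qed

lemma subst_t_const: "a \<in> carrier B \<Longrightarrow> s \<in> up B \<Longrightarrow> subst_t s (mon a 0) = mon a 0"
  using mult_one by (simp add: subst_t_mon R_simps)

lemma subst_t_pow: "h \<in> up B \<Longrightarrow> var_like s \<Longrightarrow> subst_t s (h [^]\<^bsub>R\<^esub> (i::nat)) = subst_t s h [^]\<^bsub>R\<^esub> i"
  by (induction i) (auto simp: R_simps subst_t_mult subst_t_const)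

lemma subst_t_var: "s \<in> up B \<Longrightarrow> subst_t s (mon \<one> (Suc 0)) = s"
  using R.nat_pow_eone[of s] by (simp add: subst_t_mon one_mult R_simps)

lemma subst_t_subst_t: "h \<in> up B \<Longrightarrow> r \<in> up B \<Longrightarrow> var_like s \<Longrightarrow> subst_t s (subst_t r h) = subst_t (subst_t s r) h"
proof (induction h rule: up_induct)
  case (add h q)
  then show ?case by (simp add: subst_t_add)
next
  case (mon a i)
  then have "subst_t s (subst_t r (mon a i)) = subst_t s (mon a 0) \<star> subst_t s r [^]\<^bsub>R\<^esub> i"
    by (simp only: subst_t_mon[of a r] subst_t_mult subst_t_pow mon_up pow_up)
  then show ?case using mon subst_t_const[of a s] subst_t_mon[of a "subst_t s r" i] by simp
qed

lemma subst_t_t: "h \<in> up B \<Longrightarrow> subst_t (mon \<one> (Suc 0)) h = h"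
proof (induction h rule: up_induct)
  case (add h q)
  then show ?case by (simp add: subst_t_add)
next
  case (mon a i)
  then show ?case by (simp add: subst_t_mon mon_factor[symmetric] del: One_nat_def)
qed

lemma subst_t_minus:
  assumes "h \<in> up B" "q \<in> up B" "s \<in> up B"
  shows "subst_t s (h \<ominus>\<^bsub>R\<^esub> q) = subst_t s h \<ominus>\<^bsub>R\<^esub> subst_t s q"
proof -
  have hq: "h \<ominus>\<^bsub>R\<^esub> q \<in> up B" using R.minus_closed[of h q] assms by (simp add: R_simps)
  have "h = (h \<ominus>\<^bsub>R\<^esub> q) \<oplus>\<^bsub>R\<^esub> q"
    using assms by (auto simp: R_minus R_simps minus_eq a_assoc l_neg)
  then have "subst_t s h = subst_t s (h \<ominus>\<^bsub>R\<^esub> q) \<oplus>\<^bsub>R\<^esub> subst_t s q" using subst_t_add[OF hq assms(2,3)] by (simp add: R_simps)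
  moreover have "subst_t s h \<in> carrier R" "subst_t s q \<in> carrier R" "subst_t s (h \<ominus>\<^bsub>R\<^esub> q) \<in> carrier R"
    using assms hq by (simp_all add: R_simps)
  ultimately show ?thesis
    by (simp only: R.minus_eq R.a_assoc R.r_neg R.r_zero R.a_inv_closed)
qed

text \<open>A strict degree bound. It separates the zero polynomial (bound 0) from nonzero constants
  (bound 1), whereas \<open>deg\<close> is 0 for both.\<close>

definition deg_below :: "nat \<Rightarrow> (nat \<Rightarrow> 'a) \<Rightarrow> bool" where
  "deg_below n h \<longleftrightarrow> h \<in> up B \<and> (\<forall>i\<ge>n. h i = \<zero>)"

lemma deg_below_up [simp]: "deg_below n h \<Longrightarrow> h \<in> up B" and deg_below_zero: "deg_below n h \<Longrightarrow> i \<ge> n \<Longrightarrow> h i = \<zero>"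
  by (auto simp: deg_below_def)

lemma deg_below_0: "deg_below 0 h \<longleftrightarrow> h = (\<lambda>n. \<zero>)"
  by (auto simp: deg_below_def)

lemma deg_below_mono: "deg_below n h \<Longrightarrow> n \<le> m \<Longrightarrow> deg_below m h"
  by (auto simp: deg_below_def)

lemma deg_below_add: "deg_below n h \<Longrightarrow> deg_below n q \<Longrightarrow> deg_below n (\<lambda>i. h i \<oplus> q i)"
  by (auto simp: deg_below_def)

lemma deg_below_smult: "deg_below n h \<Longrightarrow> a \<in> carrier B \<Longrightarrow> deg_below n (\<lambda>i. a \<otimes> h i)"
  by (auto simp: deg_below_def)

lemma deg_below_uminus: "deg_below n h \<Longrightarrow> deg_below n (\<lambda>i. \<ominus> h i)"
  by (auto simp: deg_below_def)

lemma deg_below_mon: "a \<in> carrier B \<Longrightarrow> i < n \<Longrightarrow> deg_below n (mon a i)"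
  unfolding deg_below_def by (intro conjI mon_up allI impI) (simp_all add: mon_def)

lemma deg_below_exists: "h \<in> up B \<Longrightarrow> \<exists>n. deg_below n h"
  unfolding deg_below_def by (simp add: up_iff)

lemma deg_below_split:
  assumes "deg_below (Suc n) h"
  shows "\<exists>g. deg_below n g \<and> h = (\<lambda>i. g i \<oplus> mon (h n) n i) \<and> (\<forall>i<n. g i = h i)"
proof -
  define g where "g = (\<lambda>i. if i < n then h i else \<zero>)"
  have h: "h \<in> up B" "\<And>i. i \<ge> Suc n \<Longrightarrow> h i = \<zero>" using assms by (auto simp: deg_below_def)
  have "g \<in> up B" by (rule upI[where n=n]) (simp_all add: g_def h)
  then have "deg_below n g" unfolding deg_below_def by (simp add: g_def)
  moreover have "h i = g i \<oplus> mon (h n) n i" for i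
    using h by (cases "i < n"; cases "i = n") (auto simp: g_def mon_def)
  ultimately show ?thesis by (intro exI[of _ g]) (auto simp: g_def[THEN fun_cong] simp del: up_closed)
qed

lemma deg_below_\<tau>: "deg_below n h \<Longrightarrow> deg_below (Suc n) (\<tau> h)"
  by (auto simp: deg_below_def) (auto simp: t_times_def)

lemma deg_below_\<tau>_pow: "deg_below n h \<Longrightarrow> deg_below (n + i) ((\<tau> ^^ i) h)"
  by (induction i) (auto intro: deg_below_\<tau>)

lemma lead_\<tau>_pow: "deg_below (Suc n) h \<Longrightarrow> (\<tau> ^^ i) h (n + i) = h n"
proof (induction i)
  case (Suc i)
  have "deg_below (Suc n + i) ((\<tau> ^^ i) h)" using Suc deg_below_\<tau>_pow by blast
  then have "(\<tau> ^^ i) h (n + Suc i) = \<zero>" by (auto simp: deg_below_def)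
  then have "\<tau> ((\<tau> ^^ i) h) (Suc (n + i)) = (\<tau> ^^ i) h (n + i)" using Suc by (simp add: t_times_def[of B \<delta> "_ h"])
  then show ?case using Suc by simp
qed simp

text \<open>The bounds are deliberately asymmetric: \<open>f\<close> has degree at most
  \<open>m\<close>, while \<open>q\<close> lies strictly below \<open>n\<close>. With
  \<open>n = 0\<close> this covers \<open>q = 0\<close> and starts the induction.\<close>

lemma deg_below_mult: "deg_below (Suc m) f \<Longrightarrow> deg_below n q \<Longrightarrow> deg_below (n + m) (q \<star> f)"
proof (induction n arbitrary: q)
  case 0
  then have "q = (\<lambda>n. \<zero>)" by (simp add: deg_below_0)
  then show ?case using 0 by (auto simp: deg_below_def)
next
  case (Suc n)
  obtain g where g: "deg_below n g" "q = (\<lambda>i. g i \<oplus> mon (q n) n i)" using deg_below_split Suc by blast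
  have q: "q n \<in> carrier B" using Suc by simp
  have "q \<star> f = (\<lambda>i. (g \<star> f) i \<oplus> (mon (q n) n \<star> f) i)"
    by (subst g(2), rule mult_add_left) (use Suc g q in auto)
  moreover have "deg_below (Suc n + m) (mon (q n) n \<star> f)"
    using deg_below_\<tau>_pow[OF Suc.prems(1), of n] q Suc.prems by (simp add: mult_mon deg_below_smult add.commute)
  moreover have "deg_below (Suc n + m) (g \<star> f)"
    using Suc.IH[OF Suc.prems(1) g(1)] by (rule deg_below_mono) simp
  ultimately show ?case using deg_below_add by simp
qed

text \<open>Moving \<open>t\<close> past a coefficient changes lower terms only, so leading
  coefficients multiply without a twist.\<close>

lemma lead_mult:
  assumes "deg_below (Suc m) f" "deg_below (Suc n) q"
  shows "(q \<star> f) (n + m) = q n \<otimes> f m"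
proof -
  obtain g where g: "deg_below n g" "q = (\<lambda>i. g i \<oplus> mon (q n) n i)" using deg_below_split assms by blast
  have q: "q n \<in> carrier B" using assms by simp
  have "q \<star> f = (\<lambda>i. (g \<star> f) i \<oplus> (mon (q n) n \<star> f) i)"
    by (subst g(2), rule mult_add_left) (use assms g q in auto)
  moreover have "deg_below (n + m) (g \<star> f)" using deg_below_mult assms g by blast
  moreover have "(mon (q n) n \<star> f) (n + m) = q n \<otimes> f m"
    using lead_\<tau>_pow[OF assms(1), of n] q assms by (simp add: mult_mon add.commute)
  moreover have "(g \<star> f) (n + m) = \<zero>" using calculation(2) by (rule deg_below_zero) simp
  ultimately show ?thesis using assms q by simp
qed

lemma up_lead:
  assumes "h \<in> up B" "h \<noteq> (\<lambda>n. \<zero>)"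
  shows "\<exists>n. deg_below (Suc n) h \<and> h n \<noteq> \<zero>"
proof -
  define n where "n = (LEAST n. deg_below n h)"
  have n: "deg_below n h" unfolding n_def using deg_below_exists[OF assms(1)] LeastI_ex[of "\<lambda>n. deg_below n h"] by blast
  with assms have "n \<noteq> 0" by (auto simp: deg_below_0)
  then obtain k where k: "n = Suc k" by (cases n) auto
  have "\<not> deg_below k h" using not_less_Least[of k "\<lambda>n. deg_below n h"] k n_def by simp
  then have "h k \<noteq> \<zero>" using n k by (auto simp: deg_below_def) (metis Suc_leI nless_le)
  with n k show ?thesis by auto
qed

section \<open>Right division by monic polynomials\<close>

lemma division_exists:
  assumes f: "deg_below (Suc m) f" "f m = \<one>"
  shows "h \<in> up B \<Longrightarrow> \<exists>q r. q \<in> up B \<and> deg_below m r \<and> h = (\<lambda>n. (q \<star> f) n \<oplus> r n)"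
proof -
  have "deg_below n h \<Longrightarrow> \<exists>q r. q \<in> up B \<and> deg_below m r \<and> h = (\<lambda>n. (q \<star> f) n \<oplus> r n)" for n h
  proof (induction n arbitrary: h)
    case 0
    then have "deg_below m h" by (rule deg_below_mono) simp
    moreover have "h = (\<lambda>n. ((\<lambda>n. \<zero>) \<star> f) n \<oplus> h n)" using 0 f by simp
    ultimately show ?case using zero_up by blast
  next
    case (Suc n)
    show ?case
    proof (cases "Suc n \<le> m")
      case True
      then have "deg_below m h" using Suc deg_below_mono by blast
      moreover have "h = (\<lambda>n. ((\<lambda>n. \<zero>) \<star> f) n \<oplus> h n)" using Suc f by simp
      ultimately show ?thesis using zero_up by blast
    next
      case False
      define k where "k = n - m"
      have nk: "n = k + m" using False k_def by simp
      \<comment> \<open>The monomial whose product with the monic \<open>f\<close> has the same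
        leading term as \<open>h\<close>; subtracting it lowers the bound on the degree by
        one.\<close>
      define c where "c = mon (h n) k"
      have hn: "h n \<in> carrier B" using Suc by simp
      have c: "c \<in> up B" "deg_below (Suc k) c" "c k = h n" using hn by (auto simp: c_def deg_below_mon) (simp add: mon_def)
      have cf: "deg_below (Suc n) (c \<star> f)" "(c \<star> f) n = h n"
        using deg_below_mult[OF f(1) c(2)] lead_mult[OF f(1) c(2)] c f hn nk by auto
      define h' where "h' = (\<lambda>i. h i \<ominus> (c \<star> f) i)"
      have "deg_below (Suc n) h'" unfolding h'_def minus_eq using Suc.prems cf(1) by (intro deg_below_add deg_below_uminus)
      moreover have "h' n = \<zero>" using cf hn by (simp add: h'_def r_neg minus_eq)
      ultimately have "deg_below n h'" by (auto simp: deg_below_def) (metis Suc_leI nless_le)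
      then obtain q r where qr: "q \<in> up B" "deg_below m r" "h' = (\<lambda>n. (q \<star> f) n \<oplus> r n)" using Suc.IH by blast
      have "h = (\<lambda>i. ((\<lambda>i. c i \<oplus> q i) \<star> f) i \<oplus> r i)"
      proof
        fix i
        have fu: "f \<in> up B" "h \<in> up B" using f Suc by auto
        have "h i = (c \<star> f) i \<oplus> h' i" unfolding h'_def minus_eq
          using fu c by (simp add: a_lcomm r_neg)
        then show "h i = ((\<lambda>i. c i \<oplus> q i) \<star> f) i \<oplus> r i"
          using fu c qr by (simp add: mult_add_left a_assoc)
      qed
      then show ?thesis using c qr add_up by blast
    qed
  qed
  then show "h \<in> up B \<Longrightarrow> ?thesis" using deg_below_exists by blast
qed

text \<open>Uniqueness of quotients: since \<open>f\<close> is monic, \<open>q \<star> f\<close>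
  inherits the leading coefficient of a nonzero \<open>q\<close>, in degree at least
  \<open>m\<close>.\<close>

lemma division_zero:
  assumes f: "deg_below (Suc m) f" "f m = \<one>" and q: "q \<in> up B" and r: "deg_below m (q \<star> f)"
  shows "q = (\<lambda>n. \<zero>)"
proof (rule ccontr)
  assume "q \<noteq> (\<lambda>n. \<zero>)"
  then obtain n where n: "deg_below (Suc n) q" "q n \<noteq> \<zero>" using up_lead q by blast
  have "(q \<star> f) (n + m) = q n" using lead_mult[OF f(1) n(1)] f q by simp
  moreover have "(q \<star> f) (n + m) = \<zero>" using r by (auto simp: deg_below_def)
  ultimately show False using n by simp
qed

lemma deg_le_iff: "h \<in> up B \<Longrightarrow> deg B h \<le> n \<longleftrightarrow> deg_below (Suc n) h"
proof -
  assume h: "h \<in> up B"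
  interpret U: UP_ring B "UP B" by unfold_locales simp
  have c: "h \<in> carrier (UP B)" "\<And>i. up_ring.coeff (UP B) h i = h i" using h by (auto simp: UP_def)
  show ?thesis
  proof
    assume "deg B h \<le> n"
    then show "deg_below (Suc n) h" using U.deg_aboveD[OF _ c(1)] c h by (auto simp: deg_below_def)
  next
    assume "deg_below (Suc n) h"
    then show "deg B h \<le> n" by (intro U.deg_aboveI) (auto simp: deg_below_def c)
  qed
qed

lemma deg_less_iff: "h \<in> up B \<Longrightarrow> n > 0 \<Longrightarrow> deg B h < n \<longleftrightarrow> deg_below n h"
  using deg_le_iff[of h "n - 1"] by (cases n) auto

lemma deg_eq:
  assumes "deg_below (Suc n) h" "h n \<noteq> \<zero>" shows "deg B h = n"
proof -
  have "deg B h \<le> n" using assms deg_le_iff by simp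
  moreover have "\<not> deg B h < n"
  proof
    assume "deg B h < n"
    then have "deg_below n h" using deg_less_iff[of h n] assms by simp
    then show False using assms by (auto simp: deg_below_def)
  qed
  ultimately show ?thesis by simp
qed

text \<open>Any explicit division identifies the described remainder, so afterwards remainders are
  computed by exhibiting a quotient. Subtracting two divisions leaves a multiple of \<open>f\<close>
  of degree below \<open>m\<close>, to which \<open>division_zero\<close> applies.\<close>

lemma right_mod_eq:
  assumes f: "deg_below (Suc m) f" "f m = \<one>" "m > 0" and "\<one> \<noteq> \<zero>"
    and h: "q \<in> up B" "deg_below m r" "h = (\<lambda>n. (q \<star> f) n \<oplus> r n)"
  shows "right_mod B \<delta> h f = r"
proof -
  have degf: "deg B f = m" using f assms(4) by (intro deg_eq) auto
  have small: "s = (\<lambda>n. \<zero>) \<or> deg B s < deg B f \<longleftrightarrow> deg_below m s" if "s \<in> up B" for s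
    using deg_less_iff[OF that f(3)] degf by (auto simp: deg_below_def)
  show ?thesis unfolding right_mod_def Let_def
  proof (rule the_equality)
    show "r \<in> carrier R \<and> (r = \<zero>\<^bsub>R\<^esub> \<or> deg B r < deg B f) \<and> (\<exists>q\<in>carrier R. h = q \<star> f \<oplus>\<^bsub>R\<^esub> r)"
      using h small[of r] by (auto simp: R_simps)
  next
    fix s assume s: "s \<in> carrier R \<and> (s = \<zero>\<^bsub>R\<^esub> \<or> deg B s < deg B f) \<and> (\<exists>q\<in>carrier R. h = q \<star> f \<oplus>\<^bsub>R\<^esub> s)"
    then obtain q' where q': "q' \<in> up B" "h = q' \<star> f \<oplus>\<^bsub>R\<^esub> s" by (auto simp: R_simps)
    have sb: "deg_below m s" "s \<in> up B" using s small by (auto simp: R_simps)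
    have c: "q \<in> carrier R" "q' \<in> carrier R" "f \<in> carrier R" "r \<in> carrier R" "s \<in> carrier R"
      using h q' sb f by (auto simp: R_simps)
    have e: "q \<star> f \<oplus>\<^bsub>R\<^esub> r = q' \<star> f \<oplus>\<^bsub>R\<^esub> s" using q' h by (simp add: R_simps)
    have "(q \<ominus>\<^bsub>R\<^esub> q') \<star> f = q \<star> f \<ominus>\<^bsub>R\<^esub> q' \<star> f"
      using c by (simp add: R.minus_eq R.l_distr R.l_minus)
    also have "\<dots> = s \<ominus>\<^bsub>R\<^esub> r" using c e by (intro R.swap_sides) auto
    also have "\<dots> = (\<lambda>n. s n \<oplus> \<ominus> r n)" using sb h by (simp add: R_minus minus_eq)
    finally have e2: "(q \<ominus>\<^bsub>R\<^esub> q') \<star> f = (\<lambda>n. s n \<oplus> \<ominus> r n)" .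
    moreover have "deg_below m (\<lambda>n. s n \<oplus> \<ominus> r n)" using sb h by (intro deg_below_add deg_below_uminus)
    ultimately have "q \<ominus>\<^bsub>R\<^esub> q' = (\<lambda>n. \<zero>)"
      using division_zero[OF f(1,2)] R.minus_closed[OF c(1,2)] by (simp add: R_simps)
    then have "(\<lambda>n. s n \<oplus> \<ominus> r n) = (\<lambda>n. \<zero>)" using e2 f by simp
    then have "s n \<ominus> r n = \<zero>" for n unfolding minus_eq by (rule fun_cong)
    then show "s = r" using sb h(2) by (intro ext) (metis r_right_minus_eq up_closed deg_below_up)
  qed
qed

text \<open>\<open>pow_const b n\<close> is the constant coefficient of \<open>(t - b)\<^sup>n\<close>.\<close>

primrec pow_const :: "'a \<Rightarrow> nat \<Rightarrow> 'a" where
  "pow_const b 0 = \<one>"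
| "pow_const b (Suc n) = \<delta> (pow_const b n) \<ominus> b \<otimes> pow_const b n"

definition t_minus :: "'a \<Rightarrow> nat \<Rightarrow> 'a" where
  "t_minus b = mon \<one> (Suc 0) \<ominus>\<^bsub>R\<^esub> mon b 0"

lemma pow_const_closed [simp]: "b \<in> carrier B \<Longrightarrow> pow_const b n \<in> carrier B"
  by (induction n) auto

lemma t_minus_eq: "b \<in> carrier B \<Longrightarrow> t_minus b = (\<lambda>n. mon \<one> (Suc 0) n \<ominus> mon b 0 n)"
  by (simp add: t_minus_def R_minus)

lemma t_minus_up [simp]: "b \<in> carrier B \<Longrightarrow> t_minus b \<in> up B"
  unfolding t_minus_def using R.minus_closed[of "mon \<one> (Suc 0)" "mon b 0"] by (simp add: R_simps)

lemma t_minus_mult: "b \<in> carrier B \<Longrightarrow> q \<in> up B \<Longrightarrow> t_minus b \<star> q = (\<lambda>n. \<tau> q n \<ominus> b \<otimes> q n)"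
proof -
  assume a: "b \<in> carrier B" "q \<in> up B"
  have "t_minus b \<star> q = mon \<one> (Suc 0) \<star> q \<ominus>\<^bsub>R\<^esub> mon b 0 \<star> q"
  proof -
    have "mon \<one> (Suc 0) \<in> carrier R" "mon b 0 \<in> carrier R" "q \<in> carrier R" using a by (auto simp: R_simps(1))
    then show ?thesis by (simp add: t_minus_def R.minus_eq R.l_distr R.l_minus)
  qed
  then show ?thesis using a by (simp add: t_mult const_mult R_minus del: One_nat_def)
qed

lemma der_add_pow: "x \<in> carrier B \<Longrightarrow> \<delta> ([(k::nat)] \<cdot> x) = [k] \<cdot> \<delta> x"
  by (induction k) (auto simp: der_add)

lemma minus_add_pow:
  "x \<in> carrier B \<Longrightarrow> y \<in> carrier B \<Longrightarrow> [(k::nat)] \<cdot> x \<ominus> [k] \<cdot> y = [k] \<cdot> (x \<ominus> y)"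
  by (simp add: minus_eq add.nat_pow_distrib add.nat_pow_inv)

text \<open>Pascal's rule holds although \<open>b\<close> need not commute with \<open>t\<close>:
  each new factor is attached on the left, so the coefficient at \<open>i\<close> receives the old
  one at \<open>i - 1\<close> plus \<open>\<delta> c - b c\<close>, and the latter is the recursion
  of \<open>pow_const\<close>.\<close>

lemma t_minus_pow_coeff:
  "b \<in> carrier B \<Longrightarrow> (t_minus b [^]\<^bsub>R\<^esub> n) i = [(n choose i)] \<cdot> pow_const b (n - i)"
proof (induction n arbitrary: i)
  case 0
  then show ?case by (cases i) (auto simp: R_simps mon_def)
next
  case (Suc n)
  have "t_minus b [^]\<^bsub>R\<^esub> Suc n = t_minus b \<star> t_minus b [^]\<^bsub>R\<^esub> n"
    using Suc by (intro R.nat_pow_Suc2) (simp add: R_simps(1))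
  also have "\<dots> = (\<lambda>i. \<tau> (t_minus b [^]\<^bsub>R\<^esub> n) i \<ominus> b \<otimes> (t_minus b [^]\<^bsub>R\<^esub> n) i)"
    using Suc by (subst t_minus_mult) auto
  finally have "(t_minus b [^]\<^bsub>R\<^esub> Suc n) i = \<tau> (t_minus b [^]\<^bsub>R\<^esub> n) i \<ominus> b \<otimes> (t_minus b [^]\<^bsub>R\<^esub> n) i"
    by (rule fun_cong)
  also have "\<dots> = (if i = 0 then \<zero> else [(n choose (i-1))] \<cdot> pow_const b (n - (i-1))) \<oplus> ([(n choose i)] \<cdot> \<delta> (pow_const b (n-i)))
      \<ominus> [(n choose i)] \<cdot> (b \<otimes> pow_const b (n - i))"
    using Suc by (simp add: t_times_def[of B \<delta> "_ [^]\<^bsub>R\<^esub> _"] der_add_pow add_pow_rdistr)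
  also have "\<dots> = (if i = 0 then \<zero> else [(n choose (i-1))] \<cdot> pow_const b (n - (i-1))) \<oplus> [(n choose i)] \<cdot> pow_const b (Suc (n-i))"
    using Suc by (simp add: minus_eq a_assoc minus_add_pow[unfolded minus_eq])
  also have "\<dots> = [(Suc n choose i)] \<cdot> pow_const b (Suc n - i)"
  proof (cases i)
    case 0
    then show ?thesis using Suc by simp
  next
    case (Suc j)
    show ?thesis
    \<comment> \<open>For \<open>j < n\<close> the truncated difference behaves and Pascal's rule
      applies. From \<open>j = n\<close> on, \<open>n choose i\<close> is 0, so the wrong index of
      \<open>pow_const\<close> does no harm.\<close>
    proof (cases "j < n")
      case True
      then have "Suc (n - i) = n - j" using Suc by simp
      then show ?thesis using Suc Suc.prems by (simp add: add.nat_pow_mult del: pow_const.simps)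
    next
      case False
      then show ?thesis using Suc Suc.prems by (simp add: binomial_eq_0)
    qed
  qed
  finally show ?case .
qed

lemma t_minus_pow_deg_below: "b \<in> carrier B \<Longrightarrow> deg_below (Suc n) (t_minus b [^]\<^bsub>R\<^esub> n)"
  unfolding deg_below_def by (simp add: t_minus_pow_coeff binomial_eq_0)

lemma var_like_t_minus:
  assumes b: "b \<in> carrier B" "\<delta> b = \<zero>" "\<And>a. a \<in> carrier B \<Longrightarrow> a \<otimes> b = b \<otimes> a"
  shows "var_like (t_minus b)"
  unfolding var_like_def
proof (intro conjI ballI)
  fix a assume a: "a \<in> carrier B"
  have "t_minus b \<star> mon a 0 = (\<lambda>n. (mon a (Suc 0) n \<oplus> mon (\<delta> a) 0 n) \<ominus> b \<otimes> mon a 0 n)"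
    using a b by (simp add: t_minus_mult \<tau>_mon)
  moreover have "mon a 0 \<star> t_minus b = (\<lambda>n. a \<otimes> (mon \<one> (Suc 0) n \<ominus> mon b 0 n))"
    using a b by (subst const_mult) (simp_all, simp add: t_minus_eq)
  ultimately show "t_minus b \<star> mon a 0 = mon a 0 \<star> t_minus b \<oplus>\<^bsub>R\<^esub> mon (\<delta> a) 0"
    using a b by (auto simp: R_simps fun_eq_iff, auto simp: mon_def minus_eq r_minus a_comm)
qed (use b in auto)

lemma deg_below_subst_t_t_minus:
  assumes b: "b \<in> carrier B"
  shows "deg_below n h \<Longrightarrow> deg_below n (subst_t (t_minus b) h)"
proof (induction n arbitrary: h)
  case 0
  then have "h = mon \<zero> 0" by (simp add: deg_below_0)
  then show ?case using b subst_t_const[of \<zero> "t_minus b"] by (simp add: deg_below_0)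
next
  case (Suc n)
  obtain g where g: "deg_below n g" "h = (\<lambda>i. g i \<oplus> mon (h n) n i)" using deg_below_split Suc by blast
  have hn: "h n \<in> carrier B" using Suc by simp
  have "subst_t (t_minus b) h = (\<lambda>i. subst_t (t_minus b) g i \<oplus> subst_t (t_minus b) (mon (h n) n) i)"
    by (subst g(2), rule subst_t_add) (use g hn b in auto)
  moreover have "deg_below (Suc n) (subst_t (t_minus b) g)" using Suc.IH[OF g(1)] by (rule deg_below_mono) simp
  moreover have "deg_below (Suc n) (subst_t (t_minus b) (mon (h n) n))"
    using hn b t_minus_pow_deg_below[of b n] by (simp add: subst_t_mon const_mult deg_below_smult)
  ultimately show ?case using deg_below_add by simp
qed

lemma lead_subst_t_t_minus:
  assumes b: "b \<in> carrier B" and h: "deg_below (Suc n) h"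
  shows "subst_t (t_minus b) h n = h n"
proof -
  obtain g where g: "deg_below n g" "h = (\<lambda>i. g i \<oplus> mon (h n) n i)" using deg_below_split h by blast
  have hn: "h n \<in> carrier B" using h by simp
  have "subst_t (t_minus b) h = (\<lambda>i. subst_t (t_minus b) g i \<oplus> subst_t (t_minus b) (mon (h n) n) i)"
    by (subst g(2), rule subst_t_add) (use g hn b in auto)
  moreover have "subst_t (t_minus b) g n = \<zero>" using deg_below_subst_t_t_minus[OF b g(1)] by (rule deg_below_zero) simp
  moreover have "subst_t (t_minus b) (mon (h n) n) n = h n"
    using hn b by (simp add: subst_t_mon const_mult t_minus_pow_coeff)
  ultimately show ?thesis using hn by simp
qed

text \<open>Only the top monomial contributes a correction: in \<open>(t - b)^(n+1)\<close> the
  coefficient of \<open>t^n\<close> is \<open>n + 1\<close> times \<open>- b\<close>, while the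
  lower part keeps its leading coefficient.\<close>

lemma sublead_subst_t_t_minus:
  assumes b: "b \<in> carrier B" and h: "deg_below (Suc (Suc n)) h"
  shows "subst_t (t_minus b) h n = h n \<oplus> h (Suc n) \<otimes> [Suc n] \<cdot> (\<ominus> b)"
proof -
  obtain g where g: "deg_below (Suc n) g" "h = (\<lambda>i. g i \<oplus> mon (h (Suc n)) (Suc n) i)" "g n = h n"
    using deg_below_split[OF h] by blast
  have hn: "h (Suc n) \<in> carrier B" using h by simp
  have "subst_t (t_minus b) h = (\<lambda>i. subst_t (t_minus b) g i \<oplus> subst_t (t_minus b) (mon (h (Suc n)) (Suc n)) i)"
    by (subst g(2), rule subst_t_add) (use g hn b in auto)
  moreover have "subst_t (t_minus b) g n = h n" using lead_subst_t_t_minus[OF b g(1)] g(3) by simp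
  moreover have "subst_t (t_minus b) (mon (h (Suc n)) (Suc n)) n = h (Suc n) \<otimes> [Suc n] \<cdot> (\<ominus> b)"
    using hn b t_minus_pow_coeff[OF b, of "Suc n" n]
    by (simp add: subst_t_mon const_mult minus_eq del: R.nat_pow_Suc add.nat_pow_Suc)
  ultimately show ?thesis by simp
qed

lemma G_id_minus_one_eq:
  assumes h: "h \<in> up B" shows "G_id_minus_one B \<delta> h = subst_t (t_minus \<one>) h"
proof -
  have "monomial B (h i) 0 = mon (h i) 0" for i using h monomial_eq by simp
  moreover have "t_var B = mon \<one> (Suc 0)" using monomial_eq by simp
  ultimately show ?thesis by (simp add: G_id_minus_one_def subst_t_def R_simps(3) t_minus_def Let_def)
qed

lemma AS_poly_eq:
  assumes "d \<in> carrier B"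
  shows "AS_poly B \<delta> p d = mon \<one> p \<ominus>\<^bsub>R\<^esub> mon \<one> (Suc 0) \<ominus>\<^bsub>R\<^esub> mon d 0"
  using assms monomial_eq t_pow by (simp add: AS_poly_def Let_def)

lemma AS_poly_coeff:
  assumes "d \<in> carrier B"
  shows "AS_poly B \<delta> p d n = (mon \<one> p n \<ominus> mon \<one> (Suc 0) n) \<ominus> mon d 0 n"
proof -
  have "mon \<one> p \<ominus>\<^bsub>R\<^esub> mon \<one> (Suc 0) \<in> up B" using R.minus_closed[of "mon \<one> p" "mon \<one> (Suc 0)"] by (simp add: R_simps)
  then show ?thesis using assms by (simp add: AS_poly_eq) (simp add: R_minus)
qed

lemma AS_poly_monic:
  assumes "d \<in> carrier B" "p \<ge> 2"
  shows "deg_below (Suc p) (AS_poly B \<delta> p d)" "AS_poly B \<delta> p d p = \<one>"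
proof -
  have c: "AS_poly B \<delta> p d n \<in> carrier B" for n
    unfolding AS_poly_coeff[OF assms(1)] mon_def using assms(1) by simp
  have z: "AS_poly B \<delta> p d n = \<zero>" if "n \<ge> Suc p" for n
    unfolding AS_poly_coeff[OF assms(1)] mon_def using that assms(2) by (simp add: minus_eq)
  show "deg_below (Suc p) (AS_poly B \<delta> p d)" unfolding deg_below_def using upI[OF c z] z by simp
  show "AS_poly B \<delta> p d p = \<one>"
    unfolding AS_poly_coeff[OF assms(1)] mon_def using assms(2) by (simp add: minus_eq)
qed

end

section \<open>Characteristic p and the translation by one\<close>

locale diff_ring_p = diff_ring +
  fixes p :: nat
  assumes prime_p: "Factorial_Ring.prime p" and char_p: "x \<in> carrier B \<Longrightarrow> [p] \<cdot> x = \<zero>"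
    and nontriv: "\<one> \<noteq> \<zero>"
begin

lemma p_ge_2: "p \<ge> 2" using prime_p prime_ge_2_nat by blast

lemma mult_p: "p dvd k \<Longrightarrow> x \<in> carrier B \<Longrightarrow> [k] \<cdot> x = \<zero>"
proof -
  assume a: "p dvd k" "x \<in> carrier B"
  then obtain m where "k = p * m" by auto
  then have "[k] \<cdot> x = [m] \<cdot> ([p] \<cdot> x)" using a by (simp add: add.nat_pow_pow)
  then show ?thesis using a char_p by simp
qed

text \<open>By Bezout \<open>k\<close> has an inverse \<open>u\<close> modulo \<open>p\<close>, and
  multiplying by \<open>u\<close> recovers \<open>x\<close> from its k-fold multiple.\<close>

lemma mult_p_nonzero: "0 < k \<Longrightarrow> k < p \<Longrightarrow> x \<in> carrier B \<Longrightarrow> x \<noteq> \<zero> \<Longrightarrow> [k] \<cdot> x \<noteq> \<zero>"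
proof
  assume a: "0 < k" "k < p" "x \<in> carrier B" "x \<noteq> \<zero>" "[k] \<cdot> x = \<zero>"
  have "\<not> p dvd k" using a by (auto dest: dvd_imp_le)
  then have "gcd k p = 1" using prime_p by (metis coprime_iff_gcd_eq_1 prime_imp_coprime gcd.commute)
  moreover obtain u v where "k * u = p * v + gcd k p" using bezout_nat[of k p] a by auto
  ultimately have "k * u = p * v + 1" by simp
  then have "[(k * u)] \<cdot> x = [(p * v)] \<cdot> x \<oplus> x" using a by (simp add: add.nat_pow_mult[symmetric])
  moreover have "[(p * v)] \<cdot> x = \<zero>" using a by (intro mult_p) auto
  moreover have "[(k * u)] \<cdot> x = [u] \<cdot> ([k] \<cdot> x)" using add.nat_pow_pow[OF a(3), of u k] by (simp add: mult.commute)
  ultimately show False using a by simp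
qed

lemma t_minus_pow_p:
  assumes "b \<in> carrier B"
  shows "t_minus b [^]\<^bsub>R\<^esub> p = mon \<one> p \<ominus>\<^bsub>R\<^esub> mon (\<ominus> pow_const b p) 0"
proof
  fix i
  have "(t_minus b [^]\<^bsub>R\<^esub> p) i = [(p choose i)] \<cdot> pow_const b (p - i)" using assms by (rule t_minus_pow_coeff)
  also have "\<dots> = mon \<one> p i \<ominus> mon (\<ominus> pow_const b p) 0 i"
  proof -
    consider "i = 0" | "0 < i" "i < p" | "i = p" "0 < i" | "i > p" using p_ge_2 by linarith
    then show ?thesis
    proof cases
      case 2
      then have "p dvd p choose i" using prime_p by (intro dvd_choose_prime) auto
      then show ?thesis using assms 2 by (simp add: mult_p, simp add: mon_def minus_eq)
    qed (use assms p_ge_2 in \<open>auto simp: mon_def minus_eq binomial_eq_0\<close>)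
  qed
  finally show "(t_minus b [^]\<^bsub>R\<^esub> p) i = (mon \<one> p \<ominus>\<^bsub>R\<^esub> mon (\<ominus> pow_const b p) 0) i"
    using assms by (simp add: R_minus)
qed

text \<open>\<open>V_p(b)\<close> is minus the constant coefficient of \<open>(t - b)^p\<close>.
  Comparing coefficients at 0 gives the uniqueness required by the definite description; there
  \<open>t^p\<close> contributes nothing because \<open>p > 0\<close>.\<close>

lemma V_pow_eq:
  assumes b: "b \<in> carrier B" shows "V_pow B \<delta> p b = \<ominus> pow_const b p"
  unfolding V_pow_def Let_def
proof (rule the_equality)
  have e: "t_var B = mon \<one> (Suc 0)" "monomial B b 0 = mon b 0" using monomial_eq b by auto
  note e = e t_minus_def[symmetric]
  show "\<ominus> pow_const b p \<in> carrier B \<and> (t_var B \<ominus>\<^bsub>R\<^esub> monomial B b 0) [^]\<^bsub>R\<^esub> p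
      = t_var B [^]\<^bsub>R\<^esub> p \<ominus>\<^bsub>R\<^esub> monomial B (\<ominus> pow_const b p) 0"
    unfolding e using b t_minus_pow_p t_pow monomial_eq by simp
  fix v assume v: "v \<in> carrier B \<and> (t_var B \<ominus>\<^bsub>R\<^esub> monomial B b 0) [^]\<^bsub>R\<^esub> p
      = t_var B [^]\<^bsub>R\<^esub> p \<ominus>\<^bsub>R\<^esub> monomial B v 0"
  then have "monomial B v 0 = mon v 0" using monomial_eq by blast
  with v have "mon \<one> p \<ominus>\<^bsub>R\<^esub> mon (\<ominus> pow_const b p) 0 = mon \<one> p \<ominus>\<^bsub>R\<^esub> mon v 0"
    unfolding e t_minus_pow_p[OF b] t_pow by simp
  then have "(mon \<one> p \<ominus>\<^bsub>R\<^esub> mon (\<ominus> pow_const b p) 0) 0 = (mon \<one> p \<ominus>\<^bsub>R\<^esub> mon v 0) 0" by (rule fun_cong)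
  then have "mon \<one> p 0 \<ominus> mon (\<ominus> pow_const b p) 0 0 = mon \<one> p 0 \<ominus> mon v 0 0"
    using v b by (simp add: R_minus)
  then show "v = \<ominus> pow_const b p" using v b p_ge_2 by (simp add: mon_def minus_eq)
qed

lemma one_add_pow_central:
  assumes "a \<in> carrier B" shows "a \<otimes> [(k::nat)] \<cdot> \<one> = [k] \<cdot> \<one> \<otimes> a"
  using assms by (simp add: add_pow_ldistr add_pow_rdistr)

lemma var_like_t_minus_k: "var_like (t_minus ([(k::nat)] \<cdot> \<one>))"
  by (rule var_like_t_minus) (auto simp: der_add_pow one_add_pow_central)

lemma var_like_t_minus_1: "var_like (t_minus \<one>)"
  using var_like_t_minus_k[of 1] by simp

abbreviation G where "G \<equiv> subst_t (t_minus \<one>)"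

lemma G_up [simp]: "h \<in> up B \<Longrightarrow> G h \<in> up B"
  by simp

text \<open>\<open>G\<close> fixes constants and therefore sends \<open>t - k\<close> to
  \<open>t - 1 - k\<close>; iterating \<open>G\<close> amounts to one substitution.\<close>

lemma G_pow: "h \<in> up B \<Longrightarrow> (G ^^ k) h = subst_t (t_minus ([k] \<cdot> \<one>)) h"
proof (induction k)
  case 0
  have "t_minus \<zero> = mon \<one> (Suc 0)" by (simp add: t_minus_eq, simp add: minus_eq)
  then show ?case using 0 subst_t_t by simp
next
  case (Suc k)
  have "(G ^^ Suc k) h = subst_t (G (t_minus ([k] \<cdot> \<one>))) h" using Suc var_like_t_minus_1 by (simp add: subst_t_subst_t)
  also have "G (t_minus ([k] \<cdot> \<one>)) = t_minus \<one> \<ominus>\<^bsub>R\<^esub> mon ([k] \<cdot> \<one>) 0"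
    unfolding t_minus_def[of "[k] \<cdot> \<one>"] by (simp only: subst_t_minus mon_up one_closed add.nat_pow_closed t_minus_up subst_t_var subst_t_const)
  also have "\<dots> = t_minus ([Suc k] \<cdot> \<one>)"
  proof -
    have "t_minus \<one> \<ominus>\<^bsub>R\<^esub> mon ([k] \<cdot> \<one>) 0 = (\<lambda>n. (mon \<one> (Suc 0) n \<ominus> mon \<one> 0 n) \<ominus> mon ([k] \<cdot> \<one>) 0 n)"
      by (subst R_minus) (simp_all, simp add: t_minus_eq)
    also have "\<dots> = (\<lambda>n. mon \<one> (Suc 0) n \<ominus> mon ([Suc k] \<cdot> \<one>) 0 n)"
      by (rule ext) (simp add: mon_def minus_eq minus_add a_ac)
    also have "\<dots> = t_minus ([Suc k] \<cdot> \<one>)" by (subst t_minus_eq) auto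
    finally show ?thesis .
  qed
  finally show ?case .
qed

lemma G_pow_p: "h \<in> up B \<Longrightarrow> (G ^^ p) h = h"
proof -
  assume h: "h \<in> up B"
  have "t_minus \<zero> = mon \<one> (Suc 0)" by (simp add: t_minus_eq, simp add: minus_eq)
  then show ?thesis using h subst_t_t by (simp add: G_pow char_p)
qed

text \<open>The case \<open>k = 1\<close> shows later that \<open>G\<close> is not the
  identity.\<close>

lemma G_pow_t: "(G ^^ k) (mon \<one> (Suc 0)) 0 = \<ominus> ([k] \<cdot> \<one>)"
proof -
  have "(G ^^ k) (mon \<one> (Suc 0)) = t_minus ([k] \<cdot> \<one>)" by (simp only: G_pow mon_up one_closed subst_t_var t_minus_up add.nat_pow_closed)
  then show ?thesis by (simp add: t_minus_eq, simp add: mon_def minus_eq)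
qed

text \<open>The constant coefficient of \<open>(t - 1)^n\<close> is \<open>(-1)^n\<close>. For odd
  \<open>p\<close> this is the claim, and for \<open>p = 2\<close> the elements 1 and -1
  coincide.\<close>

lemma pow_const_one_p: "pow_const \<one> p = \<ominus> \<one>"
proof -
  have c: "pow_const \<one> n = (if even n then \<one> else \<ominus> \<one>)" for n
  proof (induction n)
    case (Suc n)
    have "\<delta> (\<ominus> \<one>) = \<zero>" using der_add[of \<one> "\<ominus> \<one>"] by (simp add: r_neg)
    then show ?case using Suc by (auto simp: minus_eq)
  qed simp
  show ?thesis
  proof (cases "even p")
    case True
    then have "p = 2" using prime_p primes_dvd_imp_eq[of 2 p] by simp
    then have "\<one> \<oplus> \<one> = \<zero>" using char_p[of \<one>] by (simp add: numeral_2_eq_2)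
    then have "\<ominus> \<one> = \<one>" by (rule minus_equality) auto
    then show ?thesis using c[of p] by simp
  qed (use c[of p] in simp)
qed

text \<open>\<open>t^p\<close> becomes \<open>t^p - 1\<close> and \<open>t\<close> becomes
  \<open>t - 1\<close>, so the two units cancel in the difference.\<close>

lemma G_AS_poly:
  assumes d: "d \<in> carrier B"
  shows "G (AS_poly B \<delta> p d) = AS_poly B \<delta> p d"
proof -
  have u: "mon \<one> p \<ominus>\<^bsub>R\<^esub> mon \<one> (Suc 0) \<in> up B" using R.minus_closed[of "mon \<one> p" "mon \<one> (Suc 0)"] by (simp add: R_simps)
  have "G (mon \<one> p) = mon \<one> p \<ominus>\<^bsub>R\<^esub> mon \<one> 0"
    using t_minus_pow_p[of \<one>] pow_up[of "t_minus \<one>" p] by (simp add: subst_t_mon one_mult pow_const_one_p minus_minus)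
  then have "G (AS_poly B \<delta> p d) = mon \<one> p \<ominus>\<^bsub>R\<^esub> mon \<one> 0 \<ominus>\<^bsub>R\<^esub> t_minus \<one> \<ominus>\<^bsub>R\<^esub> mon d 0"
    unfolding AS_poly_eq[OF d] using u d
    by (simp only: subst_t_minus mon_up one_closed t_minus_up subst_t_var subst_t_const)
  also have "mon \<one> p \<ominus>\<^bsub>R\<^esub> mon \<one> 0 \<ominus>\<^bsub>R\<^esub> t_minus \<one> = mon \<one> p \<ominus>\<^bsub>R\<^esub> mon \<one> (Suc 0)"
  proof -
    have c: "mon \<one> p \<in> carrier R" "mon \<one> 0 \<in> carrier R" "mon \<one> (Suc 0) \<in> carrier R" by (auto simp: R_simps)
    have "mon \<one> p \<ominus>\<^bsub>R\<^esub> mon \<one> 0 \<ominus>\<^bsub>R\<^esub> t_minus \<one> = mon \<one> p \<oplus>\<^bsub>R\<^esub> (\<ominus>\<^bsub>R\<^esub> mon \<one> 0 \<oplus>\<^bsub>R\<^esub> (mon \<one> 0 \<oplus>\<^bsub>R\<^esub> \<ominus>\<^bsub>R\<^esub> mon \<one> (Suc 0)))"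
      unfolding t_minus_def using c
      by (simp only: R.minus_eq R.minus_add R.minus_minus R.a_assoc R.a_inv_closed R.a_closed R.a_comm[of "\<ominus>\<^bsub>R\<^esub> mon \<one> (Suc 0)" "mon \<one> 0"])
    also have "\<dots> = mon \<one> p \<ominus>\<^bsub>R\<^esub> mon \<one> (Suc 0)" using c by (simp only: R.minus_eq R.r_neg1 R.a_inv_closed)
    finally show ?thesis .
  qed
  finally show ?thesis by (simp add: AS_poly_eq[OF d])
qed

end

section \<open>Right factors of Artin-Schreier polynomials\<close>

text \<open>The principal left ideal of \<open>c\<close>; membership of \<open>x\<close> says that
  \<open>c\<close> is a right factor of \<open>x\<close>.\<close>

definition lmults :: "('a, 'm) ring_scheme \<Rightarrow> 'a \<Rightarrow> 'a set" where
  "lmults R c = {h \<otimes>\<^bsub>R\<^esub> c | h. h \<in> carrier R}"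

context ring
begin

lemma lmults_add: "c \<in> carrier R \<Longrightarrow> x \<in> lmults R c \<Longrightarrow> y \<in> lmults R c \<Longrightarrow> x \<oplus> y \<in> lmults R c"
  unfolding lmults_def by (auto simp: l_distr[symmetric])

lemma lmults_minus: "c \<in> carrier R \<Longrightarrow> x \<in> lmults R c \<Longrightarrow> y \<in> lmults R c \<Longrightarrow> x \<ominus> y \<in> lmults R c"
  unfolding lmults_def minus_eq by (auto simp: l_distr[symmetric] l_minus[symmetric])

lemma lmults_mult: "c \<in> carrier R \<Longrightarrow> x \<in> lmults R c \<Longrightarrow> h \<in> carrier R \<Longrightarrow> h \<otimes> x \<in> lmults R c"
  unfolding lmults_def by (auto simp: m_assoc[symmetric])

lemma lmults_trans: "c \<in> carrier R \<Longrightarrow> x \<in> lmults R y \<Longrightarrow> y \<in> lmults R c \<Longrightarrow> x \<in> lmults R c"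
  using lmults_mult unfolding lmults_def by blast

lemma lmults_self: "c \<in> carrier R \<Longrightarrow> c \<in> lmults R c"
  unfolding lmults_def by (force intro: exI[of _ \<one>])

lemma lmultsI: "h \<in> carrier R \<Longrightarrow> h \<otimes> c \<in> lmults R c"
  unfolding lmults_def by blast

lemma lmultsE: "x \<in> lmults R c \<Longrightarrow> (\<And>h. h \<in> carrier R \<Longrightarrow> x = h \<otimes> c \<Longrightarrow> thesis) \<Longrightarrow> thesis"
  unfolding lmults_def by blast

lemma lmults_closed: "c \<in> carrier R \<Longrightarrow> x \<in> lmults R c \<Longrightarrow> x \<in> carrier R"
  unfolding lmults_def by auto

lemma lmults_zero: "c \<in> carrier R \<Longrightarrow> \<zero> \<in> lmults R c"
  unfolding lmults_def by (force intro: exI[of _ \<zero>])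

end

context diff_ring_p
begin

lemma t_minus_deg_below: "z \<in> carrier B \<Longrightarrow> deg_below 2 (t_minus z)" and t_minus_lead: "z \<in> carrier B \<Longrightarrow> t_minus z (Suc 0) = \<one>"
proof -
  assume z: "z \<in> carrier B"
  show "deg_below 2 (t_minus z)" unfolding deg_below_def using z by (intro conjI) (simp, simp add: t_minus_eq, simp add: mon_def minus_eq)
  show "t_minus z (Suc 0) = \<one>" using z by (simp add: t_minus_eq, simp add: mon_def minus_eq)
qed

text \<open>Expanding around \<open>z\<close> plays the part of a remainder theorem: modulo the left
  ideal of \<open>t - z\<close> the polynomial is congruent to the constant
  \<open>V_p(z) - z - d\<close>.\<close>

lemma AS_poly_decompose:
  assumes d: "d \<in> carrier B" and z: "z \<in> carrier B"
  shows "AS_poly B \<delta> p d = (t_minus z [^]\<^bsub>R\<^esub> p \<ominus>\<^bsub>R\<^esub> t_minus z) \<oplus>\<^bsub>R\<^esub> mon (V_pow B \<delta> p z \<ominus> z \<ominus> d) 0"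
proof
  fix n
  let ?v = "\<ominus> pow_const z p"
  have v: "?v \<in> carrier B" using z by simp
  have u: "mon \<one> p \<ominus>\<^bsub>R\<^esub> mon ?v 0 \<in> up B" using R.minus_closed[of "mon \<one> p" "mon ?v 0"] v by (simp add: R_simps)
  have "(t_minus z [^]\<^bsub>R\<^esub> p \<ominus>\<^bsub>R\<^esub> t_minus z) = (\<lambda>n. (mon \<one> p n \<ominus> mon ?v 0 n) \<ominus> (mon \<one> (Suc 0) n \<ominus> mon z 0 n))"
    using z v u by (subst R_minus) (simp_all add: t_minus_pow_p, simp_all add: R_minus t_minus_eq)
  then have "((t_minus z [^]\<^bsub>R\<^esub> p \<ominus>\<^bsub>R\<^esub> t_minus z) \<oplus>\<^bsub>R\<^esub> mon (?v \<ominus> z \<ominus> d) 0) n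
     = ((mon \<one> p n \<ominus> mon ?v 0 n) \<ominus> (mon \<one> (Suc 0) n \<ominus> mon z 0 n)) \<oplus> mon (?v \<ominus> z \<ominus> d) 0 n"
    by (simp add: R_simps)
  also have "\<dots> = (mon \<one> p n \<ominus> mon \<one> (Suc 0) n) \<ominus> mon d 0 n"
  proof (cases "n = 0")
    case True
    have "(\<zero> \<ominus> v) \<ominus> (\<zero> \<ominus> z) \<oplus> (v \<ominus> z \<ominus> d) = \<zero> \<ominus> \<zero> \<ominus> d" if "v \<in> carrier B" for v
    proof -
      have "(\<zero> \<ominus> v) \<ominus> (\<zero> \<ominus> z) = \<ominus> (v \<ominus> z)"
        using that z by (simp add: minus_eq minus_add minus_minus)
      moreover have "\<ominus> (v \<ominus> z) \<oplus> (v \<ominus> z \<ominus> d) = \<ominus> d"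
        using that z d by (simp only: minus_eq[of _ d] r_neg1 minus_closed a_inv_closed)
      ultimately show ?thesis using d by (simp add: minus_eq)
    qed
    from this[OF v] show ?thesis using True p_ge_2 by (simp add: mon_def)
  next
    case False
    then show ?thesis using v z d by (simp add: mon_def minus_eq)
  qed
  also have "\<dots> = AS_poly B \<delta> p d n" using d by (simp add: AS_poly_coeff)
  finally show "AS_poly B \<delta> p d n = ((t_minus z [^]\<^bsub>R\<^esub> p \<ominus>\<^bsub>R\<^esub> t_minus z) \<oplus>\<^bsub>R\<^esub> mon (V_pow B \<delta> p z \<ominus> z \<ominus> d) 0) n"
    using z by (simp add: V_pow_eq)
qed

text \<open>The first two summands of \<open>AS_poly_decompose\<close> lie in the left ideal of
  \<open>t - z\<close>, and a constant lies there only if it is zero, by degrees.\<close>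

lemma linear_factor_iff:
  assumes d: "d \<in> carrier B" and z: "z \<in> carrier B"
  shows "AS_poly B \<delta> p d \<in> lmults R (t_minus z) \<longleftrightarrow> d = V_pow B \<delta> p z \<ominus> z"
proof -
  have V: "V_pow B \<delta> p z \<in> carrier B" using z by (simp add: V_pow_eq)
  let ?f = "AS_poly B \<delta> p d" and ?g = "t_minus z [^]\<^bsub>R\<^esub> p \<ominus>\<^bsub>R\<^esub> t_minus z" and ?c = "V_pow B \<delta> p z \<ominus> z \<ominus> d"
  have tc: "t_minus z \<in> carrier R" using z by (simp add: R_simps)
  have pow_const: "mon ?c 0 \<in> carrier R" using d z V by (simp add: R_simps)
  obtain k where k: "p = Suc k" using p_ge_2 by (cases p) auto
  have "t_minus z [^]\<^bsub>R\<^esub> p \<in> lmults R (t_minus z)" unfolding k using tc by (auto intro: R.lmultsI)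
  then have g: "?g \<in> lmults R (t_minus z)" using tc R.lmults_minus R.lmults_self by blast
  then have gc: "?g \<in> carrier R" using tc R.lmults_closed by blast
  have f: "?f = ?g \<oplus>\<^bsub>R\<^esub> mon ?c 0" by (rule AS_poly_decompose[OF d z])
  have "?f \<in> lmults R (t_minus z) \<longleftrightarrow> mon ?c 0 \<in> lmults R (t_minus z)"
  proof
    assume "?f \<in> lmults R (t_minus z)"
    then have "?f \<ominus>\<^bsub>R\<^esub> ?g \<in> lmults R (t_minus z)" using g tc R.lmults_minus by blast
    moreover have "?f \<ominus>\<^bsub>R\<^esub> ?g = mon ?c 0" unfolding f using gc pow_const by (rule R.add_minus_cancel)
    ultimately show "mon ?c 0 \<in> lmults R (t_minus z)" by simp
  qed (use f g tc R.lmults_add in auto)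
  also have "\<dots> \<longleftrightarrow> ?c = \<zero>"
  proof
    assume "mon ?c 0 \<in> lmults R (t_minus z)"
    then obtain q where q: "q \<in> up B" "mon ?c 0 = q \<star> t_minus z" using R.lmultsE by (auto simp: R_simps)
    have "deg_below (Suc (Suc 0)) (t_minus z)" using t_minus_deg_below[OF z] by (simp add: numeral_2_eq_2)
    moreover have "deg_below (Suc 0) (q \<star> t_minus z)" unfolding q(2)[symmetric] using V d z by (intro deg_below_mon) auto
    ultimately have "q = (\<lambda>n. \<zero>)" using division_zero[of "Suc 0" "t_minus z" q] t_minus_lead[OF z] q by blast
    then have "mon ?c 0 = (\<lambda>n. \<zero>)" using q z by simp
    then have "mon ?c 0 0 = \<zero>" by simp
    then show "?c = \<zero>" by (simp add: mon_def)
  next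
    assume "?c = \<zero>"
    then show "mon ?c 0 \<in> lmults R (t_minus z)" using R.lmults_zero[OF tc] by (simp add: R_simps)
  qed
  also have "\<dots> \<longleftrightarrow> d = V_pow B \<delta> p z \<ominus> z" using V d z by auto
  finally show ?thesis .
qed

end

section \<open>Coefficients in a division ring: degrees and common factors\<close>

locale diff_division_ring = diff_ring_p +
  assumes inverse_exists: "x \<in> carrier B \<Longrightarrow> x \<noteq> \<zero> \<Longrightarrow> \<exists>y\<in>carrier B. y \<otimes> x = \<one> \<and> x \<otimes> y = \<one>"
begin

abbreviation zr where "zr \<equiv> (\<lambda>n::nat. \<zero>)"
abbreviation dg where "dg \<equiv> deg B"

lemma B_integral: "x \<in> carrier B \<Longrightarrow> y \<in> carrier B \<Longrightarrow> x \<noteq> \<zero> \<Longrightarrow> y \<noteq> \<zero> \<Longrightarrow> x \<otimes> y \<noteq> \<zero>"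
proof
  assume a: "x \<in> carrier B" "y \<in> carrier B" "x \<noteq> \<zero>" "y \<noteq> \<zero>" "x \<otimes> y = \<zero>"
  obtain x' where x': "x' \<in> carrier B" "x' \<otimes> x = \<one>" using inverse_exists a by blast
  have "y = (x' \<otimes> x) \<otimes> y" using x' a by simp
  also have "\<dots> = \<zero>" using x' a by (subst m_assoc) auto
  finally show False using a by simp
qed

lemma dg_lead: "h \<in> up B \<Longrightarrow> h \<noteq> zr \<Longrightarrow> deg_below (Suc (dg h)) h \<and> h (dg h) \<noteq> \<zero>"
  using up_lead[of h] deg_eq by metis

lemma dg_mult:
  assumes "h \<in> up B" "q \<in> up B" "h \<noteq> zr" "q \<noteq> zr"
  shows "h \<star> q \<noteq> zr" "dg (h \<star> q) = dg h + dg q"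
proof -
  note h = dg_lead[OF assms(1,3)] and q = dg_lead[OF assms(2,4)]
  have l: "(h \<star> q) (dg h + dg q) = h (dg h) \<otimes> q (dg q)" using h q lead_mult by blast
  then have n: "(h \<star> q) (dg h + dg q) \<noteq> \<zero>" using B_integral h q assms by simp
  then show "h \<star> q \<noteq> zr" by metis
  have "deg_below (Suc (dg h) + dg q) (h \<star> q)" using h q deg_below_mult by blast
  then show "dg (h \<star> q) = dg h + dg q" using n deg_eq by simp
qed

lemma make_monic:
  assumes "h \<in> up B" "h \<noteq> zr"
  shows "\<exists>u\<in>carrier B. u \<noteq> \<zero> \<and> deg_below (Suc (dg h)) (mon u 0 \<star> h) \<and> (mon u 0 \<star> h) (dg h) = \<one>"
proof -
  note h = dg_lead[OF assms]
  then obtain u where u: "u \<in> carrier B" "u \<otimes> h (dg h) = \<one>" using inverse_exists assms(1) by (metis up_closed)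
  have "u \<noteq> \<zero>" using u assms(1) nontriv by auto
  then show ?thesis using u h assms by (intro bexI[of _ u]) (auto simp: const_mult intro: deg_below_smult)
qed

lemma mon_nonzero: "u \<noteq> \<zero> \<Longrightarrow> mon u i \<noteq> zr"
  by (auto simp: mon_def dest: fun_cong[of _ _ i])

lemma dg_const: "u \<in> carrier B \<Longrightarrow> u \<noteq> \<zero> \<Longrightarrow> dg (mon u 0) = 0"
  by (rule deg_eq) (simp_all add: deg_below_mon, simp add: mon_def)

text \<open>The divisor is made monic by a unit on the left, and the unit is then absorbed into the
  quotient.\<close>

lemma division:
  assumes "A \<in> up B" "C \<in> up B" "C \<noteq> zr"
  shows "\<exists>q\<in>up B. \<exists>r\<in>up B. A = q \<star> C \<oplus>\<^bsub>R\<^esub> r \<and> (r = zr \<or> dg r < dg C)"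
proof -
  obtain u where u: "u \<in> carrier B" "deg_below (Suc (dg C)) (mon u 0 \<star> C)" "(mon u 0 \<star> C) (dg C) = \<one>"
    using make_monic[OF assms(2,3)] by blast
  obtain q r where qr: "q \<in> up B" "deg_below (dg C) r" "A = (\<lambda>n. (q \<star> (mon u 0 \<star> C)) n \<oplus> r n)"
    using division_exists[OF u(2,3) assms(1)] by blast
  have "A = (q \<star> mon u 0) \<star> C \<oplus>\<^bsub>R\<^esub> r" using qr u assms by (simp add: R_simps mult_assoc)
  moreover have "r = zr \<or> dg r < dg C"
  proof (cases "dg C = 0")
    case True
    then show ?thesis using qr by (simp add: deg_below_0)
  next
    case False
    then show ?thesis using qr deg_less_iff[of r "dg C"] by simp
  qed
  moreover have "q \<star> mon u 0 \<in> up B" "r \<in> up B" using qr u by auto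
  ultimately show ?thesis by blast
qed

text \<open>\<open>g\<close> is a greatest common right divisor of \<open>A\<close> and \<open>C\<close>, and \<open>h A\<close> a least common
  left multiple; the degree identity is carried through the Euclidean algorithm, because the set of
  \<open>h\<close> with \<open>h A \<in> R C\<close> depends on \<open>A\<close> modulo \<open>C\<close> only.\<close>

lemma euclid:
  assumes "A \<in> up B" "C \<in> up B" "C \<noteq> zr"
  shows "\<exists>g\<in>up B. \<exists>h\<in>up B. g \<noteq> zr \<and> A \<in> lmults R g \<and> C \<in> lmults R g \<and> h \<noteq> zr \<and> h \<star> A \<in> lmults R C \<and>
     dg h + dg g = dg C \<and> (\<forall>h'\<in>up B. h' \<noteq> zr \<longrightarrow> h' \<star> A \<in> lmults R C \<longrightarrow> dg h \<le> dg h')"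
  using assms
proof (induction "dg C" arbitrary: A C rule: less_induct)
  case less
  note cR = R_simps(1)
  have C: "C \<in> carrier R" and A: "A \<in> carrier R" using less.prems by (simp_all add: cR)
  obtain Q A' where Q: "Q \<in> up B" "A' \<in> up B" "A = Q \<star> C \<oplus>\<^bsub>R\<^esub> A'" "A' = zr \<or> dg A' < dg C"
    using division[OF less.prems] by blast
  have QC: "Q \<in> carrier R" "A' \<in> carrier R" "Q \<star> C \<in> carrier R" using Q(1,2) less.prems(2) by (simp_all add: cR)
  show ?case
  proof (cases "A' = zr")
    case True
    then have "A' = \<zero>\<^bsub>R\<^esub>" by (simp add: R_simps(2))
    then have AC: "A = Q \<star> C" using Q(3) QC by (simp only: R.r_zero)
    have "A \<in> lmults R C" unfolding AC using QC by (intro R.lmultsI)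
    moreover have "\<one>\<^bsub>R\<^esub> \<star> A \<in> lmults R C" using calculation A by simp
    moreover have "\<one>\<^bsub>R\<^esub> \<in> up B" "\<one>\<^bsub>R\<^esub> \<noteq> zr" "dg \<one>\<^bsub>R\<^esub> = 0"
      using nontriv mon_nonzero dg_const by (auto simp: R_simps)
    ultimately show ?thesis using less.prems(2,3) R.lmults_self[OF C]
      by (intro bexI[of _ C] bexI[of _ "\<one>\<^bsub>R\<^esub>"]) simp_all
  next
    case False
    then have dA': "dg A' < dg C" using Q by blast
    \<comment> \<open>The induction hypothesis is applied to the pair \<open>C\<close>,
      \<open>A'\<close>, with the roles exchanged.\<close>
    from less.hyps[OF dA' less.prems(2) Q(2) False]
    obtain g h where g: "g \<in> up B" "g \<noteq> zr" "C \<in> lmults R g" "A' \<in> lmults R g"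
      and h: "h \<in> up B" "h \<noteq> zr" "h \<star> C \<in> lmults R A'" "dg h + dg g = dg A'"
      and min: "\<And>h'. h' \<in> up B \<Longrightarrow> h' \<noteq> zr \<Longrightarrow> h' \<star> C \<in> lmults R A' \<Longrightarrow> dg h \<le> dg h'"
      by blast
    have gc: "g \<in> carrier R" using g cR by simp
    \<comment> \<open>\<open>h C = w A'\<close> is the common left multiple from the hypothesis. Its
      other cofactor \<open>w\<close> is the new multiplier:
      \<open>w A = w Q C + w A' = (w Q + h) C\<close>.\<close>
    obtain w where w: "w \<in> up B" "h \<star> C = w \<star> A'" using h(3) R.lmultsE cR by metis
    have wc: "w \<in> carrier R" "h \<in> carrier R" using w(1) h(1) by (simp_all add: cR)
    have hC: "h \<star> C \<noteq> zr" "dg (h \<star> C) = dg h + dg C" using dg_mult[OF h(1) less.prems(2) h(2) less.prems(3)] by auto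
    have w0: "w \<noteq> zr" using hC(1) w(2) zero_mult[OF Q(2)] by auto
    have dw: "dg w + dg A' = dg h + dg C" using dg_mult(2)[OF w(1) Q(2) w0 False] hC w by simp
    have "A \<in> lmults R g" unfolding Q(3) using g gc QC by (intro R.lmults_add R.lmults_mult) auto
    moreover have "w \<star> A \<in> lmults R C"
    proof -
      have "w \<star> A = w \<star> (Q \<star> C) \<oplus>\<^bsub>R\<^esub> h \<star> C" unfolding Q(3) w(2) using wc QC by (simp add: R.r_distr)
      also have "\<dots> \<in> lmults R C" using C wc QC by (intro R.lmults_add R.lmults_mult R.lmults_self)
      finally show ?thesis .
    qed
    moreover have "dg w + dg g = dg C" using dw h(4) by simp
    \<comment> \<open>A competitor \<open>k\<close> also maps \<open>A'\<close> into
      \<open>R C\<close>, say \<open>k A' = v C\<close>. Then \<open>v\<close> competes with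
      \<open>h\<close> in the hypothesis, and \<open>dg h \<le> dg v\<close> translates back because
      both common multiples obey the degree formula.\<close>
    moreover have "dg w \<le> dg k" if k: "k \<in> up B" "k \<noteq> zr" "k \<star> A \<in> lmults R C" for k
    proof -
      have kc: "k \<in> carrier R" using k cR by simp
      have "k \<star> A' = k \<star> A \<ominus>\<^bsub>R\<^esub> k \<star> (Q \<star> C)"
        unfolding Q(3) using kc QC by (simp only: R.r_distr R.add_minus_cancel R.m_closed)
      also have "\<dots> \<in> lmults R C" using C k(3) R.lmults_mult[OF C R.lmultsI[OF QC(1)] kc] by (rule R.lmults_minus)
      finally obtain v where v: "v \<in> up B" "k \<star> A' = v \<star> C" using R.lmultsE cR by metis
      have kA: "k \<star> A' \<noteq> zr" "dg (k \<star> A') = dg k + dg A'" using dg_mult[OF k(1) Q(2) k(2) False] by auto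
      then have v0: "v \<noteq> zr" using v(2) zero_mult[OF less.prems(2)] by auto
      have "v \<star> C \<in> lmults R A'" using v(2)[symmetric] kc by (simp add: R.lmultsI)
      then have "dg h \<le> dg v" using min v v0 by blast
      moreover have "dg v + dg C = dg k + dg A'" using dg_mult(2)[OF v(1) less.prems(2) v0 less.prems(3)] kA v by simp
      ultimately show ?thesis using dw by simp
    qed
    ultimately show ?thesis using g w w0 by (intro bexI[of _ g] bexI[of _ w]) simp_all
  qed
qed

lemma lmults_dg:
  assumes "c \<in> up B" "x \<in> lmults R c" "x \<noteq> zr"
  shows "c \<noteq> zr" "dg c \<le> dg x"
proof -
  obtain h where h: "h \<in> up B" "x = h \<star> c" using assms R.lmultsE R_simps(1) by metis
  then show c: "c \<noteq> zr" using assms R.r_null[of h] by (auto simp: R_simps)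
  have "h \<noteq> zr" using h assms by auto
  then show "dg c \<le> dg x" using dg_mult(2)[OF h(1) assms(1) _ c] h by simp
qed

lemma lmults_same_dg:
  assumes "c \<in> up B" "x \<in> lmults R c" "x \<noteq> zr" "dg x = dg c"
  shows "\<exists>u\<in>carrier B. u \<noteq> \<zero> \<and> x = mon u 0 \<star> c"
proof -
  obtain h where h: "h \<in> up B" "x = h \<star> c" using assms R.lmultsE R_simps(1) by metis
  have c: "c \<noteq> zr" using lmults_dg assms by blast
  have h0: "h \<noteq> zr" using h assms by auto
  then have "dg h = 0" using dg_mult(2)[OF h(1) assms(1) h0 c] h assms by simp
  then have b: "deg_below (Suc 0) h" "h 0 \<noteq> \<zero>" using dg_lead[OF h(1) h0] by auto
  then have "h = mon (h 0) 0" by (auto simp: deg_below_def mon_def fun_eq_iff)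
  then show ?thesis using b h by (intro bexI[of _ "h 0"]) auto
qed

text \<open>A multiple of equal degree differs by an invertible constant, so both elements generate
  the same left ideal.\<close>

lemma lmults_same_dg_sym:
  assumes "c \<in> up B" "x \<in> lmults R c" "x \<noteq> zr" "dg x = dg c"
  shows "c \<in> lmults R x"
proof -
  obtain u where u: "u \<in> carrier B" "u \<noteq> \<zero>" "x = mon u 0 \<star> c" using lmults_same_dg assms by blast
  obtain v where v: "v \<in> carrier B" "v \<otimes> u = \<one>" using inverse_exists u by blast
  have "mon v 0 \<star> x = c" using u v assms by (simp add: const_mult m_assoc[symmetric])
  then show ?thesis using v R.lmultsI[of "mon v 0" x] by (simp add: R_simps)
qed

lemma G_nonzero:
  assumes "h \<in> up B" "h \<noteq> zr" shows "G h \<noteq> zr" "dg (G h) = dg h"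
proof -
  note h = dg_lead[OF assms]
  have b: "deg_below (Suc (dg h)) (G h)" using h deg_below_subst_t_t_minus by blast
  have l: "G h (dg h) = h (dg h)" using h lead_subst_t_t_minus by blast
  with h show "G h \<noteq> zr" by auto
  show "dg (G h) = dg h" using b l h deg_eq by simp
qed

lemma G_lmults:
  assumes "c \<in> up B" "x \<in> lmults R c" shows "G x \<in> lmults R (G c)"
proof -
  obtain h where h: "h \<in> up B" "x = h \<star> c" using assms R.lmultsE R_simps(1) by metis
  then have "G x = G h \<star> G c" using assms subst_t_mult var_like_t_minus_1 by blast
  then show ?thesis using R.lmultsI[of "G h" "G c"] h by (simp add: R_simps(1))
qed

lemma G_invariant_dg:
  assumes h: "deg_below (Suc n) h" "h n = \<one>" "G h = h" and n: "n < p" shows "n = 0"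
proof (rule ccontr)
  assume "n \<noteq> 0"
  then obtain k where k: "n = Suc k" by (cases n) auto
  have hc: "h k \<in> carrier B" using h by simp
  have "G h k = h k \<oplus> \<one> \<otimes> [n] \<cdot> (\<ominus> \<one>)" using sublead_subst_t_t_minus[of \<one> k h] h k by simp
  then have "h k = h k \<oplus> [n] \<cdot> (\<ominus> \<one>)" using h by simp
  then have "[n] \<cdot> (\<ominus> \<one>) = \<zero>" using hc by (metis add.l_cancel_one' add.nat_pow_closed a_inv_closed one_closed)
  moreover have "\<ominus> \<one> \<noteq> \<zero>" using nontriv by (metis minus_minus minus_zero one_closed)
  ultimately show False using mult_p_nonzero[of n "\<ominus> \<one>"] n k by simp
qed

text \<open>Intersecting the left ideals generated by the translates of an irreducible right factor
  \<open>q\<close> raises the degree by \<open>deg q\<close> or by nothing at each step. The intersection is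
  translation invariant, hence generated by an element of degree \<open>p\<close>, so \<open>deg q\<close> divides \<open>p\<close>.\<close>

lemma reducible_imp_linear_factor:
  assumes d: "d \<in> carrier B" and q0: "q0 \<in> up B" "AS_poly B \<delta> p d \<in> lmults R q0" "0 < dg q0" "dg q0 < p"
  shows "\<exists>z\<in>carrier B. AS_poly B \<delta> p d \<in> lmults R (t_minus z)"
proof -
  define f where "f = AS_poly B \<delta> p d"
  note cR = R_simps(1)
  have fb: "deg_below (Suc p) f" "f p = \<one>" unfolding f_def using AS_poly_monic[OF d p_ge_2] by auto
  have f0: "f \<noteq> zr" "dg f = p" "f \<in> up B" using fb nontriv deg_eq[OF fb(1)] by auto
  have Gf: "G f = f" unfolding f_def by (rule G_AS_poly[OF d])
  define is_factor where "is_factor q \<longleftrightarrow> q \<in> up B \<and> f \<in> lmults R q \<and> 0 < dg q" for q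
  have "is_factor q0" using q0 by (simp add: is_factor_def f_def)
  \<comment> \<open>A right factor of least positive degree. Any nonconstant right divisor of it
    again divides \<open>f\<close>, hence has the same degree; irreducibility is used only in this
    form.\<close>
  then obtain q where q: "is_factor q" and qmin: "\<And>q'. is_factor q' \<Longrightarrow> dg q \<le> dg q'"
    using exists_least_iff[of "\<lambda>n. \<exists>q. is_factor q \<and> dg q = n"] by (metis not_less)
  define r where "r = dg q"
  have r: "0 < r" "r < p" using q qmin[OF \<open>is_factor q0\<close>] q0 by (auto simp: r_def is_factor_def)
  define qs where "qs i = (G ^^ i) q" for i :: nat
  have qs: "qs i \<in> up B \<and> qs i \<noteq> zr \<and> dg (qs i) = r \<and> f \<in> lmults R (qs i)" for i
  proof (induction i)
    case 0
    then show ?case using q f0 lmults_dg(1)[of q f] by (auto simp: qs_def is_factor_def r_def)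
  next
    case (Suc i)
    then show ?case using G_nonzero[of "qs i"] G_lmults[of "qs i" f] Gf by (simp add: qs_def)
  qed
  have qs_p: "qs p = qs 0" unfolding qs_def using q G_pow_p by (simp add: is_factor_def)
  \<comment> \<open>All translates are right factors of \<open>f\<close>, since \<open>G\<close>
    fixes \<open>f\<close>; so \<open>f\<close> lies in \<open>J\<close>, and this bounds degrees by
    \<open>p\<close>.\<close>
  define J where "J = (\<Inter>i. lmults R (qs i))"
  have fJ: "f \<in> J" using qs by (auto simp: J_def)
  \<comment> \<open>Candidates for a generator of \<open>J\<close>, whose degree is required to be a
    multiple of \<open>r\<close> from the outset. One of maximal degree exists, starting from 1, and
    it turns out to lie in \<open>J\<close> itself.\<close>
  define good where "good A \<longleftrightarrow> A \<in> up B \<and> A \<noteq> zr \<and> J \<subseteq> lmults R A \<and> r dvd dg A" for A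
  have good_le: "dg A \<le> p" if "good A" for A
    using lmults_dg(2)[of A f] that fJ f0 by (auto simp: good_def)
  have "good \<one>\<^bsub>R\<^esub>"
  proof -
    have "x \<in> lmults R \<one>\<^bsub>R\<^esub>" if "x \<in> J" for x
    proof -
      have "x \<in> carrier R" using that R.lmults_closed[of "qs 0" x] qs by (auto simp: J_def cR)
      then show ?thesis using R.lmultsI[of x "\<one>\<^bsub>R\<^esub>"] by simp
    qed
    moreover have "\<one>\<^bsub>R\<^esub> \<in> up B" "\<one>\<^bsub>R\<^esub> \<noteq> zr" "dg \<one>\<^bsub>R\<^esub> = 0"
      using nontriv mon_nonzero dg_const by (auto simp: R_simps)
    ultimately show ?thesis by (auto simp: good_def)
  qed
  then have "\<exists>A. good A \<and> (\<forall>A'. good A' \<longrightarrow> dg A' \<le> dg A)"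
    using good_le by (intro ex_has_greatest_nat[where b="Suc p" and k="\<one>\<^bsub>R\<^esub>"]) (auto simp: less_Suc_eq_le)
  then obtain A where A: "good A" and Amax: "\<And>A'. good A' \<Longrightarrow> dg A' \<le> dg A" by (elim exE conjE) simp
  have Au: "A \<in> up B" "A \<noteq> zr" "J \<subseteq> lmults R A" "r dvd dg A" "A \<in> carrier R" using A by (auto simp: good_def cR)
  have AJ: "A \<in> lmults R (qs i)" for i
  proof -
    have qi: "qs i \<in> up B" "qs i \<noteq> zr" "dg (qs i) = r" "f \<in> lmults R (qs i)" "qs i \<in> carrier R" using qs[of i] by (auto simp: cR)
    obtain g h where g: "g \<in> up B" "g \<noteq> zr" "A \<in> lmults R g" "qs i \<in> lmults R g"
      and h: "h \<in> up B" "h \<noteq> zr" "h \<star> A \<in> lmults R (qs i)" "dg h + dg g = r"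
      and min: "\<And>h'. h' \<in> up B \<Longrightarrow> h' \<noteq> zr \<Longrightarrow> h' \<star> A \<in> lmults R (qs i) \<Longrightarrow> dg h \<le> dg h'"
      using euclid[OF Au(1) qi(1,2)] unfolding qi(3) by blast
    have gc: "g \<in> carrier R" "h \<in> carrier R" using g h by (simp_all add: cR)
    show ?thesis
    proof (cases "dg g = 0")
      case False
      \<comment> \<open>The common divisor \<open>g\<close> divides \<open>qs i\<close> and so
        \<open>f\<close>. Having positive degree it has degree \<open>r\<close>, generates the ideal
        of \<open>qs i\<close>, and therefore \<open>qs i\<close> is a right factor of
        \<open>A\<close>.\<close>
      have "f \<in> lmults R g" using gc(1) qi(4) g(4) by (rule R.lmults_trans)
      then have "is_factor g" using g False by (simp add: is_factor_def)
      then have "dg g = r" using qmin h(4) r_def by fastforce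
      then have "g \<in> lmults R (qs i)" using lmults_same_dg_sym[OF g(1) g(4)] qi by simp
      then show ?thesis using R.lmults_trans[OF qi(5) g(3)] by blast
    next
      case True
      then have dh: "dg h = r" using h by simp
      \<comment> \<open>In the coprime case the least common left multiple of \<open>A\<close> and
        \<open>qs i\<close> has degree larger by exactly \<open>r\<close>. It is again good, which
        contradicts maximality.\<close>
      let ?L = "h \<star> A"
      have L: "?L \<noteq> zr" "dg ?L = r + dg A" using dg_mult[OF h(1) Au(1) h(2) Au(2)] dh by auto
      have "x \<in> lmults R ?L" if x: "x \<in> J" for x
      proof -
        have "x \<in> lmults R A" using x Au by blast
        then obtain w where w: "w \<in> up B" "x = w \<star> A" using R.lmultsE cR by metis
        \<comment> \<open>Division of the cofactor \<open>w\<close> by \<open>h\<close>: the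
          remainder \<open>s\<close> still sends \<open>A\<close> into \<open>R (qs i)\<close>, so
          it vanishes by minimality of \<open>h\<close>.\<close>
        obtain u s where us: "u \<in> up B" "s \<in> up B" "w = u \<star> h \<oplus>\<^bsub>R\<^esub> s" "s = zr \<or> dg s < dg h"
          using division[OF w(1) h(1,2)] by blast
        have c: "u \<in> carrier R" "s \<in> carrier R" "w \<in> carrier R" using us w by (simp_all add: cR)
        have xe: "x = u \<star> ?L \<oplus>\<^bsub>R\<^esub> s \<star> A"
          unfolding w(2) us(3) using c gc Au(5) by (simp add: R.l_distr R.m_assoc)
        have "s \<star> A = x \<ominus>\<^bsub>R\<^esub> u \<star> ?L"
          unfolding xe using c gc Au(5) by (intro R.add_minus_cancel[symmetric]) auto
        also have "\<dots> \<in> lmults R (qs i)"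
          using x qi(5) R.lmults_mult[OF qi(5) h(3) c(1)] by (intro R.lmults_minus) (auto simp: J_def)
        finally have "s = zr" using min[OF us(2)] us(4) by fastforce
        then have "x = u \<star> ?L" using xe c gc Au by (simp add: R_simps(2)[symmetric])
        then show ?thesis using R.lmultsI[OF c(1)] by simp
      qed
      then have "good ?L" using L h Au by (auto simp: good_def)
      then have "dg ?L \<le> dg A" by (rule Amax)
      then show ?thesis using L r by simp
    qed
  qed
  \<comment> \<open>Otherwise the monic multiple \<open>M\<close> of \<open>A\<close> has degree
    below \<open>p\<close>. \<open>G M\<close> stays in \<open>J\<close>, since \<open>G\<close>
    permutes the ideals cyclically, hence is a constant multiple of \<open>A\<close>; being monic of
    the same degree it equals \<open>M\<close>. Then \<open>G_invariant_dg\<close> makes the degree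
    0, against \<open>r \<le> dg A\<close>.\<close>
  have dA: "dg A = p"
  proof (rule ccontr)
    assume "dg A \<noteq> p"
    then have lt: "dg A < p" using good_le[OF A] by simp
    obtain u where u: "u \<in> carrier B" "u \<noteq> \<zero>" "deg_below (Suc (dg A)) (mon u 0 \<star> A)" "(mon u 0 \<star> A) (dg A) = \<one>"
      using make_monic[OF Au(1,2)] by blast
    define M where "M = mon u 0 \<star> A"
    have uc: "mon u 0 \<in> carrier R" using u by (simp add: cR)
    have M: "M \<in> up B" "deg_below (Suc (dg A)) M" "M (dg A) = \<one>" "M \<noteq> zr" "dg M = dg A"
      using u Au nontriv deg_eq[OF u(3)] by (auto simp: M_def)
    have MJ: "M \<in> lmults R (qs i)" for i
      unfolding M_def using qs[of i] AJ[of i] uc by (intro R.lmults_mult) (auto simp: cR)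
    have "G M \<in> lmults R (qs i)" for i
    proof -
      have "G M \<in> lmults R (qs (Suc j))" for j
        using G_lmults[OF _ MJ[of j]] qs[of j] by (simp add: qs_def)
      \<comment> \<open>Every translate is the image of its predecessor; for \<open>i = 0\<close>
        the predecessor has index \<open>p - 1\<close>, because \<open>qs p = qs 0\<close>.\<close>
      moreover have "qs i = qs (Suc (if i = 0 then p - 1 else i - 1))"
        using qs_p p_ge_2 by (cases i) auto
      ultimately show ?thesis by simp
    qed
    then have "G M \<in> lmults R A" using Au by (auto simp: J_def)
    then obtain v where v: "v \<in> carrier B" "G M = mon v 0 \<star> A"
      using lmults_same_dg[OF Au(1)] G_nonzero[OF M(1,4)] M(5) by metis
    \<comment> \<open>Comparison of leading coefficients: \<open>u\<close> and \<open>v\<close> are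
      both left inverses of that of \<open>A\<close>.\<close>
    have "v = u"
    proof -
      have aA: "A (dg A) \<in> carrier B" "A (dg A) \<noteq> \<zero>" using Au dg_lead[OF Au(1,2)] by auto
      have "v \<otimes> A (dg A) = \<one>" using lead_subst_t_t_minus[OF one_closed M(2)] M(3) v Au by (simp add: const_mult)
      moreover have "u \<otimes> A (dg A) = \<one>" using M(3) u Au by (simp add: M_def const_mult)
      moreover obtain w where w: "w \<in> carrier B" "A (dg A) \<otimes> w = \<one>" using inverse_exists[OF aA] by blast
      ultimately show ?thesis using aA u v by (metis m_assoc r_one)
    qed
    then have "G M = M" using v by (simp add: M_def)
    then have "dg A = 0" using G_invariant_dg[OF M(2,3)] lt by blast
    moreover have "r \<le> dg A" using lmults_dg(2)[OF _ AJ[of 0] Au(2)] qs[of 0] by simp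
    ultimately show False using r by simp
  qed
  then have "r dvd p" using Au by simp
  then have r1: "r = 1" using r prime_p by (auto simp: prime_nat_iff)
  obtain u where u: "u \<in> carrier B" "u \<noteq> \<zero>" "deg_below (Suc r) (mon u 0 \<star> q)" "(mon u 0 \<star> q) r = \<one>"
    using make_monic[of q] qs[of 0] unfolding r_def qs_def by auto
  define M where "M = mon u 0 \<star> q"
  \<comment> \<open>For \<open>r = 1\<close> the monic multiple of \<open>q\<close> is
    \<open>t + M 0\<close>, which is \<open>t - z\<close> for this \<open>z\<close>.\<close>
  define z where "z = \<ominus> M 0"
  have q': "q \<in> up B" "f \<in> lmults R q" using q by (auto simp: is_factor_def)
  have M: "M \<in> up B" "deg_below (Suc (Suc 0)) M" "M (Suc 0) = \<one>" using u q' r1 by (auto simp: M_def)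
  have z: "z \<in> carrier B" using M by (simp add: z_def)
  have "M = t_minus z"
  proof
    fix n
    consider "n = 0" | "n = 1" | "n \<ge> Suc (Suc 0)" by linarith
    then show "M n = t_minus z n"
      using M z by cases (auto simp: t_minus_eq mon_def z_def minus_eq deg_below_def)
  qed
  moreover have "q \<in> lmults R M"
  proof (rule lmults_same_dg_sym)
    show "q \<in> up B" using q' by simp
    show "M \<in> lmults R q" unfolding M_def using u by (intro R.lmultsI) (simp add: cR)
    show "M \<noteq> zr" using M nontriv by auto
    show "dg M = dg q" using deg_eq[OF M(2)] M(3) nontriv r1 r_def by simp
  qed
  ultimately have "f \<in> lmults R (t_minus z)" using R.lmults_trans[OF _ q'(2), of M] M by (simp add: cR)
  then show ?thesis using z f_def by blast
qed

text \<open>If \<open>h k\<close> lies in \<open>R f\<close>, the least multiplier of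
  \<open>k\<close> into \<open>R f\<close> has degree at most deg h < p, so by \<open>euclid\<close>
  the common right divisor of \<open>k\<close> and \<open>f\<close> has positive degree, and degree
  below \<open>p\<close> as it divides \<open>k\<close>. Conversely, a factorization
  \<open>f = h (t - z)\<close> is itself a zero product.\<close>

lemma AS_poly_no_zero_divisors_iff:
  assumes d: "d \<in> carrier B"
  shows "(\<exists>h k. deg_below p h \<and> deg_below p k \<and> h \<noteq> zr \<and> k \<noteq> zr \<and> h \<star> k \<in> lmults R (AS_poly B \<delta> p d)) \<longleftrightarrow>
    (\<exists>z\<in>carrier B. d = V_pow B \<delta> p z \<ominus> z)"
proof
  let ?f = "AS_poly B \<delta> p d"
  have fb: "deg_below (Suc p) ?f" "?f p = \<one>" using AS_poly_monic[OF d p_ge_2] by auto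
  have f0: "?f \<noteq> zr" "dg ?f = p" "?f \<in> up B" using fb nontriv deg_eq[OF fb(1)] by auto
  {
    assume "\<exists>h k. deg_below p h \<and> deg_below p k \<and> h \<noteq> zr \<and> k \<noteq> zr \<and> h \<star> k \<in> lmults R ?f"
    then obtain h k where hk: "deg_below p h" "deg_below p k" "h \<noteq> zr" "k \<noteq> zr" "h \<star> k \<in> lmults R ?f" by blast
    have dhk: "dg h < p" "dg k < p" using hk deg_less_iff p_ge_2 by auto
    have ku: "k \<in> up B" using hk by simp
    obtain g e where g: "g \<in> up B" "k \<in> lmults R g" "?f \<in> lmults R g" "dg e + dg g = p"
      and min: "\<And>h'. h' \<in> up B \<Longrightarrow> h' \<noteq> zr \<Longrightarrow> h' \<star> k \<in> lmults R ?f \<Longrightarrow> dg e \<le> dg h'"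
      using euclid[OF ku f0(3,1)] unfolding f0(2) by blast
    have "dg e < p" using min[OF _ hk(3,5)] hk dhk by simp
    then have "0 < dg g" using g by simp
    moreover have "dg g < p" using lmults_dg(2)[OF g(1,2) hk(4)] dhk by simp
    ultimately show "\<exists>z\<in>carrier B. d = V_pow B \<delta> p z \<ominus> z"
      using reducible_imp_linear_factor[OF d g(1,3)] linear_factor_iff[OF d] by blast
  next
    assume "\<exists>z\<in>carrier B. d = V_pow B \<delta> p z \<ominus> z"
    then obtain z where z: "z \<in> carrier B" "?f \<in> lmults R (t_minus z)" using linear_factor_iff[OF d] by blast
    obtain h where h: "h \<in> up B" "?f = h \<star> t_minus z" using z R.lmultsE R_simps(1) by metis
    have t0: "t_minus z \<noteq> zr" using t_minus_lead[OF z(1)] nontriv by auto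
    have tb: "deg_below (Suc (Suc 0)) (t_minus z)" using t_minus_deg_below[OF z(1)] by (simp add: numeral_2_eq_2)
    have dt: "dg (t_minus z) = Suc 0" using deg_eq[OF tb] t_minus_lead[OF z(1)] nontriv by simp
    have h0: "h \<noteq> zr" using h f0 z(1) by auto
    have "dg h + Suc 0 = p" using dg_mult(2)[OF h(1) _ h0 t0] z dt h f0 by simp
    then have "deg_below p h" using dg_lead[OF h(1) h0] by simp
    moreover have "deg_below p (t_minus z)" using t_minus_deg_below[OF z(1)] p_ge_2 by (rule deg_below_mono)
    moreover have "h \<star> t_minus z \<in> lmults R ?f" unfolding h(2)[symmetric] using f0 by (intro R.lmults_self) (simp add: R_simps)
    ultimately show "\<exists>h k. deg_below p h \<and> deg_below p k \<and> h \<noteq> zr \<and> k \<noteq> zr \<and> h \<star> k \<in> lmults R ?f"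
      using h0 t0 by blast
  }
qed

end

section \<open>Petit algebras\<close>

text \<open>\<open>der_smult\<close> makes scalars commute with \<open>t\<close>; this gives
  homogeneity of polynomial multiplication in the right factor for the coefficientwise scalar
  action.\<close>

locale diff_algebra = diff_ring B \<delta> for B :: "('k, 'b, 'm) module_scheme" (structure) and \<delta> +
  fixes K :: "('k, 'n) ring_scheme"
  assumes vectorspace_B: "vectorspace K B"
    and smult_mult_left: "\<lbrakk>c \<in> carrier K; x \<in> carrier B; y \<in> carrier B\<rbrakk> \<Longrightarrow> (c \<odot> x) \<otimes> y = c \<odot> (x \<otimes> y)"
    and smult_mult_right: "\<lbrakk>c \<in> carrier K; x \<in> carrier B; y \<in> carrier B\<rbrakk> \<Longrightarrow> x \<otimes> (c \<odot> y) = c \<odot> (x \<otimes> y)"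
    and der_smult: "\<lbrakk>c \<in> carrier K; x \<in> carrier B\<rbrakk> \<Longrightarrow> \<delta> (c \<odot> x) = c \<odot> \<delta> x"
    and nontrivial: "\<one> \<noteq> \<zero>"
begin

sublocale V: vectorspace K B by (rule vectorspace_B)

lemma scale_up [simp]:
  assumes "c \<in> carrier K" "h \<in> up B" shows "(\<lambda>n. c \<odot> h n) \<in> up B"
proof -
  obtain n where "\<And>i. i \<ge> n \<Longrightarrow> h i = \<zero>" using assms upE by blast
  then show ?thesis using assms by (intro upI[where n=n]) auto
qed

lemma deg_below_scale: "c \<in> carrier K \<Longrightarrow> deg_below n h \<Longrightarrow> deg_below n (\<lambda>n. c \<odot> h n)"
  unfolding deg_below_def by auto

lemma \<tau>_scale: "c \<in> carrier K \<Longrightarrow> h \<in> up B \<Longrightarrow> \<tau> (\<lambda>n. c \<odot> h n) = (\<lambda>n. c \<odot> \<tau> h n)"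
  by (rule ext) (simp add: t_times_def der_smult V.smult_r_distr)

lemma \<tau>_pow_scale: "c \<in> carrier K \<Longrightarrow> h \<in> up B \<Longrightarrow> (\<tau> ^^ i) (\<lambda>n. c \<odot> h n) = (\<lambda>n. c \<odot> (\<tau> ^^ i) h n)"
  by (induction i) (auto simp: \<tau>_scale)

lemma mon_scale: "c \<in> carrier K \<Longrightarrow> a \<in> carrier B \<Longrightarrow> (\<lambda>n. c \<odot> mon a i n) = mon (c \<odot> a) i"
  by (auto simp: mon_def)

lemma mult_scale_left: "h \<in> up B \<Longrightarrow> c \<in> carrier K \<Longrightarrow> q \<in> up B \<Longrightarrow>
    (\<lambda>n. c \<odot> h n) \<star> q = (\<lambda>n. c \<odot> (h \<star> q) n)"
proof (induction h rule: up_induct)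
  case (add h q)
  then show ?case by (simp add: V.smult_r_distr mult_add_left)
next
  case (mon a i)
  then show ?case by (simp add: mon_scale mult_mon smult_mult_left)
qed

lemma mult_scale_right: "h \<in> up B \<Longrightarrow> c \<in> carrier K \<Longrightarrow> q \<in> up B \<Longrightarrow>
    h \<star> (\<lambda>n. c \<odot> q n) = (\<lambda>n. c \<odot> (h \<star> q) n)"
proof (induction h rule: up_induct)
  case (add h q)
  then show ?case by (simp add: V.smult_r_distr mult_add_left)
next
  case (mon a i)
  then show ?case by (simp add: mult_mon \<tau>_pow_scale smult_mult_right)
qed

lemma subst_t_scale: "h \<in> up B \<Longrightarrow> c \<in> carrier K \<Longrightarrow> s \<in> up B \<Longrightarrow>
    subst_t s (\<lambda>n. c \<odot> h n) = (\<lambda>n. c \<odot> subst_t s h n)"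
proof (induction h rule: up_induct)
  case (add h q)
  then show ?case by (simp add: V.smult_r_distr subst_t_add)
next
  case (mon a i)
  have "subst_t s (\<lambda>n. c \<odot> mon a i n) = (\<lambda>n. c \<odot> mon a 0 n) \<star> s [^]\<^bsub>R\<^esub> i" using mon by (simp add: mon_scale subst_t_mon)
  then show ?case using mon by (simp add: mult_scale_left subst_t_mon)
qed

lemma petit_simps:
  "\<zero>\<^bsub>petit_algebra B \<delta> f\<^esub> = (\<lambda>n. \<zero>)" "\<one>\<^bsub>petit_algebra B \<delta> f\<^esub> = mon \<one> 0"
  "h \<oplus>\<^bsub>petit_algebra B \<delta> f\<^esub> q = (\<lambda>n. h n \<oplus> q n)"
  "c \<odot>\<^bsub>petit_algebra B \<delta> f\<^esub> h = (\<lambda>n. c \<odot> h n)"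
  "h \<otimes>\<^bsub>petit_algebra B \<delta> f\<^esub> q = right_mod B \<delta> (h \<star> q) f"
  by (auto simp: petit_algebra_def Let_def R_simps)

context
  fixes f m
  assumes f: "deg_below (Suc m) f" "f m = \<one>" "m > 0"
begin

lemma petit_carrier: "carrier (petit_algebra B \<delta> f) = {h. deg_below m h}"
proof -
  have "deg B f = m" using f nontrivial by (intro deg_eq) auto
  then show ?thesis using deg_less_iff[OF _ f(3)]
    by (auto simp: petit_algebra_def Let_def R_simps deg_below_def)
qed

lemma rem_obtain:
  assumes "h \<in> up B"
  obtains q r where "q \<in> up B" "deg_below m r" "h = (\<lambda>n. (q \<star> f) n \<oplus> r n)" "right_mod B \<delta> h f = r"
proof -
  obtain q r where qr: "q \<in> up B" "deg_below m r" "h = (\<lambda>n. (q \<star> f) n \<oplus> r n)"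
    using division_exists[OF f(1,2) assms] by blast
  then show ?thesis using that right_mod_eq[OF f nontrivial qr] by blast
qed

lemma rem_deg_below: "h \<in> up B \<Longrightarrow> deg_below m (right_mod B \<delta> h f)"
  by (erule rem_obtain) simp

lemma rem_add:
  assumes "h \<in> up B" "k \<in> up B"
  shows "right_mod B \<delta> (\<lambda>n. h n \<oplus> k n) f = (\<lambda>n. right_mod B \<delta> h f n \<oplus> right_mod B \<delta> k f n)"
proof -
  have fu: "f \<in> up B" using f by simp
  obtain q r where h: "q \<in> up B" "deg_below m r" "h = (\<lambda>n. (q \<star> f) n \<oplus> r n)" "right_mod B \<delta> h f = r"
    using rem_obtain[OF assms(1)] .
  obtain q' r' where k: "q' \<in> up B" "deg_below m r'" "k = (\<lambda>n. (q' \<star> f) n \<oplus> r' n)" "right_mod B \<delta> k f = r'"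
    using rem_obtain[OF assms(2)] .
  have "(\<lambda>n. h n \<oplus> k n) = (\<lambda>n. ((\<lambda>n. q n \<oplus> q' n) \<star> f) n \<oplus> (r n \<oplus> r' n))"
    unfolding h(3) k(3) using h(1,2) k(1,2) fu by (intro ext) (simp add: mult_add_left a_ac)
  then show ?thesis unfolding h(4) k(4)
    using right_mod_eq[OF f nontrivial _ deg_below_add[OF h(2) k(2)]] add_up[OF h(1) k(1)] by blast
qed

lemma rem_scale:
  assumes "h \<in> up B" "c \<in> carrier K"
  shows "right_mod B \<delta> (\<lambda>n. c \<odot> h n) f = (\<lambda>n. c \<odot> right_mod B \<delta> h f n)"
proof -
  have fu: "f \<in> up B" using f by simp
  obtain q r where h: "q \<in> up B" "deg_below m r" "h = (\<lambda>n. (q \<star> f) n \<oplus> r n)" "right_mod B \<delta> h f = r"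
    using rem_obtain[OF assms(1)] .
  have "(\<lambda>n. c \<odot> h n) = (\<lambda>n. ((\<lambda>n. c \<odot> q n) \<star> f) n \<oplus> (c \<odot> r n))"
    unfolding h(3) using h(1,2) fu assms(2) by (intro ext) (simp add: mult_scale_left V.smult_r_distr)
  then show ?thesis unfolding h(4)
    using right_mod_eq[OF f nontrivial _ deg_below_scale[OF assms(2) h(2)]] scale_up[OF assms(2) h(1)] by blast
qed

text \<open>Turns a vanishing product of the Petit algebra into membership in the left ideal of
  \<open>f\<close>.\<close>

lemma rem_zero_iff:
  assumes "h \<in> up B"
  shows "right_mod B \<delta> h f = (\<lambda>n. \<zero>) \<longleftrightarrow> h \<in> lmults R f"
proof
  have fu: "f \<in> up B" using f by simp
  obtain q r where h: "q \<in> up B" "deg_below m r" "h = (\<lambda>n. (q \<star> f) n \<oplus> r n)" "right_mod B \<delta> h f = r"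
    using rem_obtain[OF assms] .
  assume "right_mod B \<delta> h f = (\<lambda>n. \<zero>)"
  then have "r = (\<lambda>n. \<zero>)" using h(4) by simp
  then have "h = q \<star> f" unfolding h(3) using h(1) fu by simp
  then show "h \<in> lmults R f" using R.lmultsI[of q f] h by (simp add: R_simps)
next
  have fu: "f \<in> up B" using f by simp
  assume "h \<in> lmults R f"
  then obtain q where q: "q \<in> up B" "h = q \<star> f" using R.lmultsE R_simps(1) by metis
  then have "h = (\<lambda>n. (q \<star> f) n \<oplus> \<zero>)" using fu by simp
  moreover have "deg_below m (\<lambda>n. \<zero>)" by (simp add: deg_below_def)
  ultimately show "right_mod B \<delta> h f = (\<lambda>n. \<zero>)" using right_mod_eq[OF f nontrivial q(1)] by blast
qed

lemma petit_vectorspace: "vectorspace K (petit_algebra B \<delta> f)"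
proof (rule vectorspace.intro)
  have "abelian_group (petit_algebra B \<delta> f)"
  proof (rule abelian_groupI)
    fix x assume "x \<in> carrier (petit_algebra B \<delta> f)"
    then show "\<exists>y\<in>carrier (petit_algebra B \<delta> f). y \<oplus>\<^bsub>petit_algebra B \<delta> f\<^esub> x = \<zero>\<^bsub>petit_algebra B \<delta> f\<^esub>"
      by (intro bexI[of _ "\<lambda>n. \<ominus> x n"]) (auto simp: petit_simps petit_carrier l_neg deg_below_uminus)
  qed (auto simp: petit_simps petit_carrier deg_below_add a_ac, auto simp: deg_below_def)
  then show "module K (petit_algebra B \<delta> f)"
    by (intro moduleI) (auto simp: petit_simps petit_carrier deg_below_scale V.smult_l_distr V.smult_r_distr
        V.smult_assoc1 V.R.cring_axioms)
  show "field K" by (rule V.field_axioms)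
qed

lemma petit_nonassoc: "nonassoc_algebra K (petit_algebra B \<delta> f)"
  unfolding nonassoc_algebra_def
  by (auto simp: petit_vectorspace petit_simps petit_carrier rem_deg_below mult_add_left mult_add_right rem_add
      mult_scale_left mult_scale_right rem_scale)

end

end

section \<open>Tensor products\<close>

definition bilinear_map where
  "bilinear_map K A B V \<beta> \<longleftrightarrow>
     (\<forall>a\<in>carrier A. \<forall>b\<in>carrier B. \<beta> a b \<in> carrier V) \<and>
     (\<forall>a\<in>carrier A. \<forall>a'\<in>carrier A. \<forall>b\<in>carrier B. \<beta> (a \<oplus>\<^bsub>A\<^esub> a') b = \<beta> a b \<oplus>\<^bsub>V\<^esub> \<beta> a' b) \<and>
     (\<forall>a\<in>carrier A. \<forall>b\<in>carrier B. \<forall>b'\<in>carrier B. \<beta> a (b \<oplus>\<^bsub>B\<^esub> b') = \<beta> a b \<oplus>\<^bsub>V\<^esub> \<beta> a b') \<and>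
     (\<forall>c\<in>carrier K. \<forall>a\<in>carrier A. \<forall>b\<in>carrier B.
        \<beta> (c \<odot>\<^bsub>A\<^esub> a) b = c \<odot>\<^bsub>V\<^esub> \<beta> a b \<and> \<beta> a (c \<odot>\<^bsub>B\<^esub> b) = c \<odot>\<^bsub>V\<^esub> \<beta> a b)"

text \<open>Neither factor is assumed associative, because one of them will be a Petit algebra. That
  the kernel is a two-sided ideal is therefore proved from bilinearity alone.\<close>

locale tensor_product =
  fixes K :: "('k, 'm) ring_scheme" and A :: "('k, 'a, 'n) module_scheme" and B :: "('k, 'b, 'o) module_scheme"
  assumes alg_A: "nonassoc_algebra K A" and alg_B: "nonassoc_algebra K B"
begin

sublocale A: vectorspace K A using alg_A by (simp add: nonassoc_algebra_def)
sublocale B: vectorspace K B using alg_B by (simp add: nonassoc_algebra_def)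

abbreviation M where "M \<equiv> free_algebra K A B"
abbreviation N where "N \<equiv> tensor_kernel K A B"
abbreviation T where "T \<equiv> tensor_algebra K A B"
abbreviation gen where "gen \<equiv> free_gen K"
abbreviation supp where "supp u \<equiv> {z. u z \<noteq> \<zero>\<^bsub>K\<^esub>}"

section \<open>The free algebra on pairs\<close>

lemma A_mult: "x \<in> carrier A \<Longrightarrow> y \<in> carrier A \<Longrightarrow> x \<otimes>\<^bsub>A\<^esub> y \<in> carrier A"
  "\<lbrakk>x \<in> carrier A; y \<in> carrier A; z \<in> carrier A\<rbrakk> \<Longrightarrow> (x \<oplus>\<^bsub>A\<^esub> y) \<otimes>\<^bsub>A\<^esub> z = (x \<otimes>\<^bsub>A\<^esub> z) \<oplus>\<^bsub>A\<^esub> (y \<otimes>\<^bsub>A\<^esub> z)"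
  "\<lbrakk>x \<in> carrier A; y \<in> carrier A; z \<in> carrier A\<rbrakk> \<Longrightarrow> z \<otimes>\<^bsub>A\<^esub> (x \<oplus>\<^bsub>A\<^esub> y) = (z \<otimes>\<^bsub>A\<^esub> x) \<oplus>\<^bsub>A\<^esub> (z \<otimes>\<^bsub>A\<^esub> y)"
  "\<lbrakk>c \<in> carrier K; x \<in> carrier A; y \<in> carrier A\<rbrakk> \<Longrightarrow> (c \<odot>\<^bsub>A\<^esub> x) \<otimes>\<^bsub>A\<^esub> y = c \<odot>\<^bsub>A\<^esub> (x \<otimes>\<^bsub>A\<^esub> y)"
  "\<lbrakk>c \<in> carrier K; x \<in> carrier A; y \<in> carrier A\<rbrakk> \<Longrightarrow> x \<otimes>\<^bsub>A\<^esub> (c \<odot>\<^bsub>A\<^esub> y) = c \<odot>\<^bsub>A\<^esub> (x \<otimes>\<^bsub>A\<^esub> y)"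
  using alg_A unfolding nonassoc_algebra_def by blast+

lemma B_mult: "x \<in> carrier B \<Longrightarrow> y \<in> carrier B \<Longrightarrow> x \<otimes>\<^bsub>B\<^esub> y \<in> carrier B"
  "\<lbrakk>x \<in> carrier B; y \<in> carrier B; z \<in> carrier B\<rbrakk> \<Longrightarrow> (x \<oplus>\<^bsub>B\<^esub> y) \<otimes>\<^bsub>B\<^esub> z = (x \<otimes>\<^bsub>B\<^esub> z) \<oplus>\<^bsub>B\<^esub> (y \<otimes>\<^bsub>B\<^esub> z)"
  "\<lbrakk>x \<in> carrier B; y \<in> carrier B; z \<in> carrier B\<rbrakk> \<Longrightarrow> z \<otimes>\<^bsub>B\<^esub> (x \<oplus>\<^bsub>B\<^esub> y) = (z \<otimes>\<^bsub>B\<^esub> x) \<oplus>\<^bsub>B\<^esub> (z \<otimes>\<^bsub>B\<^esub> y)"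
  "\<lbrakk>c \<in> carrier K; x \<in> carrier B; y \<in> carrier B\<rbrakk> \<Longrightarrow> (c \<odot>\<^bsub>B\<^esub> x) \<otimes>\<^bsub>B\<^esub> y = c \<odot>\<^bsub>B\<^esub> (x \<otimes>\<^bsub>B\<^esub> y)"
  "\<lbrakk>c \<in> carrier K; x \<in> carrier B; y \<in> carrier B\<rbrakk> \<Longrightarrow> x \<otimes>\<^bsub>B\<^esub> (c \<odot>\<^bsub>B\<^esub> y) = c \<odot>\<^bsub>B\<^esub> (x \<otimes>\<^bsub>B\<^esub> y)"
  using alg_B unfolding nonassoc_algebra_def by blast+

lemma cring_K: "cring K" by (rule A.R.cring_axioms)
lemma field_K: "field K" by (rule A.field_axioms)

lemma M_carrier: "u \<in> carrier M \<longleftrightarrow> (\<forall>z. u z \<in> carrier K) \<and> finite (supp u) \<and> supp u \<subseteq> carrier A \<times> carrier B"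
  unfolding free_algebra_def by (simp add: Pi_iff)

lemma M_simps: "\<zero>\<^bsub>M\<^esub> = (\<lambda>z. \<zero>\<^bsub>K\<^esub>)" "u \<oplus>\<^bsub>M\<^esub> v = (\<lambda>z. u z \<oplus>\<^bsub>K\<^esub> v z)" "c \<odot>\<^bsub>M\<^esub> u = (\<lambda>z. c \<otimes>\<^bsub>K\<^esub> u z)"
  "\<one>\<^bsub>M\<^esub> = gen \<one>\<^bsub>A\<^esub> \<one>\<^bsub>B\<^esub>"
  by (auto simp: free_algebra_def free_gen_def)

lemma M_closed: "u \<in> carrier M \<Longrightarrow> u z \<in> carrier K" and M_finite: "u \<in> carrier M \<Longrightarrow> finite (supp u)"
  and M_supp: "u \<in> carrier M \<Longrightarrow> supp u \<subseteq> carrier A \<times> carrier B"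
  unfolding M_carrier by blast+

lemma M_intro: "(\<And>z. u z \<in> carrier K) \<Longrightarrow> finite X \<Longrightarrow> X \<subseteq> carrier A \<times> carrier B \<Longrightarrow> supp u \<subseteq> X \<Longrightarrow> u \<in> carrier M"
  unfolding M_carrier using finite_subset by blast

lemma M_add_closed: assumes "u \<in> carrier M" "v \<in> carrier M" shows "u \<oplus>\<^bsub>M\<^esub> v \<in> carrier M"
  using M_closed[OF assms(1)] M_closed[OF assms(2)] M_finite[OF assms(1)] M_finite[OF assms(2)]
    M_supp[OF assms(1)] M_supp[OF assms(2)]
  by (intro M_intro[where X="supp u \<union> supp v"]) (auto simp: M_simps)

lemma M_smult_closed: assumes "c \<in> carrier K" "v \<in> carrier M" shows "c \<odot>\<^bsub>M\<^esub> v \<in> carrier M"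
  using assms M_closed[OF assms(2)] M_finite[OF assms(2)] M_supp[OF assms(2)]
  by (intro M_intro[where X="supp v"]) (auto simp: M_simps)

lemma M_zero_closed: "\<zero>\<^bsub>M\<^esub> \<in> carrier M"
  by (auto simp: M_carrier M_simps)

lemma gen_closed: "a \<in> carrier A \<Longrightarrow> b \<in> carrier B \<Longrightarrow> gen a b \<in> carrier M"
  by (intro M_intro[where X="{(a,b)}"]) (auto simp: free_gen_def)

lemma module_M: "module K M"
proof (rule moduleI)
  show "abelian_group M"
  proof (rule abelian_groupI)
    fix u assume u: "u \<in> carrier M"
    have "(\<lambda>z. \<ominus>\<^bsub>K\<^esub> u z) \<in> carrier M"
      using M_closed[OF u] M_finite[OF u] M_supp[OF u] by (intro M_intro[where X="supp u"]) auto
    then show "\<exists>v\<in>carrier M. v \<oplus>\<^bsub>M\<^esub> u = \<zero>\<^bsub>M\<^esub>"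
      using M_closed[OF u] by (intro bexI[of _ "\<lambda>z. \<ominus>\<^bsub>K\<^esub> u z"]) (auto simp: M_simps A.R.l_neg)
  qed (auto simp: M_add_closed M_zero_closed, auto simp: M_simps M_closed A.R.a_ac)
qed (auto simp: cring_K M_smult_closed, auto simp: M_simps M_closed A.R.l_distr A.R.r_distr A.R.m_assoc)

sublocale M: module K M by (rule module_M)

text \<open>Removes one point of the support at a time, so that bilinear claims reduce to
  generators.\<close>

lemma M_induct [consumes 1, case_names add gen]:
  assumes u: "u \<in> carrier M"
    and add: "\<And>u v. u \<in> carrier M \<Longrightarrow> v \<in> carrier M \<Longrightarrow> P u \<Longrightarrow> P v \<Longrightarrow> P (u \<oplus>\<^bsub>M\<^esub> v)"
    and gen: "\<And>c a b. c \<in> carrier K \<Longrightarrow> a \<in> carrier A \<Longrightarrow> b \<in> carrier B \<Longrightarrow> P (c \<odot>\<^bsub>M\<^esub> gen a b)"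
  shows "P u"
proof -
  have "finite X \<Longrightarrow> X \<subseteq> carrier A \<times> carrier B \<Longrightarrow> (\<And>u. u \<in> carrier M \<Longrightarrow> supp u \<subseteq> X \<Longrightarrow> P u)" for X
  proof (induction X rule: finite_induct)
    case empty
    \<comment> \<open>There is no separate case for zero; it is covered as a zero multiple of a
      generator.\<close>
    have "u = \<zero>\<^bsub>K\<^esub> \<odot>\<^bsub>M\<^esub> gen \<zero>\<^bsub>A\<^esub> \<zero>\<^bsub>B\<^esub>"
      using empty by (auto simp: M_simps free_gen_def)
    then show ?case using gen[of "\<zero>\<^bsub>K\<^esub>" "\<zero>\<^bsub>A\<^esub>" "\<zero>\<^bsub>B\<^esub>"] by simp
  next
    case (insert x X)
    obtain a b where x: "x = (a, b)" "a \<in> carrier A" "b \<in> carrier B" using insert.prems by auto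
    let ?v = "\<lambda>z. if z = x then \<zero>\<^bsub>K\<^esub> else u z"
    have v: "?v \<in> carrier M" using M_closed[OF insert.prems(2)] insert by (intro M_intro[where X=X]) auto
    have "supp ?v \<subseteq> X" using insert by auto
    then have Pv: "P ?v" using insert v by auto
    have Pg: "P (u x \<odot>\<^bsub>M\<^esub> gen a b)" using gen x M_closed[OF insert.prems(2)] by auto
    have e: "u = ?v \<oplus>\<^bsub>M\<^esub> (u x \<odot>\<^bsub>M\<^esub> gen a b)"
      using M_closed[OF insert.prems(2)] x by (auto simp: M_simps free_gen_def)
    have "u x \<odot>\<^bsub>M\<^esub> gen a b \<in> carrier M"
      using M_closed[OF insert.prems(2)] x M_smult_closed gen_closed by blast
    from add[OF v this Pv Pg] show ?case unfolding e[symmetric] .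
  qed
  then show ?thesis using u M_finite[OF u] M_supp[OF u] by blast
qed

definition pair_mult :: "('a \<times> 'b) \<Rightarrow> ('a \<times> 'b) \<Rightarrow> 'a \<times> 'b" where
  "pair_mult x y = (fst x \<otimes>\<^bsub>A\<^esub> fst y, snd x \<otimes>\<^bsub>B\<^esub> snd y)"

text \<open>Rewrites the sum over a fibre as a sum over a full rectangle with an indicator. The
  index set then depends neither on \<open>z\<close> nor on the exact supports, and linearity
  becomes termwise.\<close>

lemma M_mult_alt:
  assumes u: "u \<in> carrier M" and v: "v \<in> carrier M"
    and X: "finite X" "supp u \<subseteq> X" and Y: "finite Y" "supp v \<subseteq> Y"
  shows "(u \<otimes>\<^bsub>M\<^esub> v) z =
    (\<Oplus>\<^bsub>K\<^esub>w\<in>X \<times> Y. if pair_mult (fst w) (snd w) = z then u (fst w) \<otimes>\<^bsub>K\<^esub> v (snd w) else \<zero>\<^bsub>K\<^esub>)"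
proof -
  have "(u \<otimes>\<^bsub>M\<^esub> v) z = (\<Oplus>\<^bsub>K\<^esub>w \<in> {(x, y). u x \<noteq> \<zero>\<^bsub>K\<^esub> \<and> v y \<noteq> \<zero>\<^bsub>K\<^esub> \<and> pair_mult x y = z}. u (fst w) \<otimes>\<^bsub>K\<^esub> v (snd w))"
    by (simp add: free_algebra_def pair_mult_def)
  also have "\<dots> = (\<Oplus>\<^bsub>K\<^esub>w\<in>X \<times> Y. if pair_mult (fst w) (snd w) = z then u (fst w) \<otimes>\<^bsub>K\<^esub> v (snd w) else \<zero>\<^bsub>K\<^esub>)"
    using X Y M_closed[OF u] M_closed[OF v] by (intro A.R.add.finprod_mono_neutral_cong_left) auto
  finally show ?thesis .
qed

lemma pair_mult_closed: "x \<in> carrier A \<times> carrier B \<Longrightarrow> y \<in> carrier A \<times> carrier B \<Longrightarrow> pair_mult x y \<in> carrier A \<times> carrier B"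
  by (auto simp: pair_mult_def A_mult B_mult)

lemma M_mult_closed: assumes u: "u \<in> carrier M" and v: "v \<in> carrier M" shows "u \<otimes>\<^bsub>M\<^esub> v \<in> carrier M"
proof (rule M_intro[where X="(\<lambda>w. pair_mult (fst w) (snd w)) ` (supp u \<times> supp v)"])
  note mm = M_mult_alt[OF u v M_finite[OF u] subset_refl M_finite[OF v] subset_refl]
  show "(u \<otimes>\<^bsub>M\<^esub> v) z \<in> carrier K" for z
    unfolding mm using M_closed[OF u] M_closed[OF v] by (intro A.R.finsum_closed) auto
  show "finite ((\<lambda>w. pair_mult (fst w) (snd w)) ` (supp u \<times> supp v))" using M_finite[OF u] M_finite[OF v] by simp
  show "(\<lambda>w. pair_mult (fst w) (snd w)) ` (supp u \<times> supp v) \<subseteq> carrier A \<times> carrier B"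
  proof (rule image_subsetI)
    fix w assume "w \<in> supp u \<times> supp v"
    then have "fst w \<in> carrier A \<times> carrier B" "snd w \<in> carrier A \<times> carrier B"
      using M_supp[OF u] M_supp[OF v] by auto
    then show "pair_mult (fst w) (snd w) \<in> carrier A \<times> carrier B" by (rule pair_mult_closed)
  qed
  show "supp (u \<otimes>\<^bsub>M\<^esub> v) \<subseteq> (\<lambda>w. pair_mult (fst w) (snd w)) ` (supp u \<times> supp v)"
  proof (rule ccontr)
    assume "\<not> ?thesis"
    then obtain z where z: "(u \<otimes>\<^bsub>M\<^esub> v) z \<noteq> \<zero>\<^bsub>K\<^esub>" "z \<notin> (\<lambda>w. pair_mult (fst w) (snd w)) ` (supp u \<times> supp v)" by blast
    have "(u \<otimes>\<^bsub>M\<^esub> v) z = (\<Oplus>\<^bsub>K\<^esub>w\<in>supp u \<times> supp v. \<zero>\<^bsub>K\<^esub>)"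
      unfolding mm using z(2) by (intro A.R.add.finprod_cong') auto
    then show False using z(1) by (simp add: A.R.finsum_zero)
  qed
qed

lemma M_mult_add_left:
  assumes u: "u \<in> carrier M" and u': "u' \<in> carrier M" and v: "v \<in> carrier M"
  shows "(u \<oplus>\<^bsub>M\<^esub> u') \<otimes>\<^bsub>M\<^esub> v = u \<otimes>\<^bsub>M\<^esub> v \<oplus>\<^bsub>M\<^esub> u' \<otimes>\<^bsub>M\<^esub> v"
proof
  fix z
  let ?X = "supp u \<union> supp u'" and ?Y = "supp v"
  have f: "finite ?X" "finite ?Y" using M_finite u u' v by auto
  note c = M_closed[OF u] M_closed[OF u'] M_closed[OF v]
  have s: "supp (u \<oplus>\<^bsub>M\<^esub> u') \<subseteq> ?X" by (auto simp: M_simps)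
  have "((u \<oplus>\<^bsub>M\<^esub> u') \<otimes>\<^bsub>M\<^esub> v) z = (\<Oplus>\<^bsub>K\<^esub>w\<in>?X \<times> ?Y. if pair_mult (fst w) (snd w) = z then (u \<oplus>\<^bsub>M\<^esub> u') (fst w) \<otimes>\<^bsub>K\<^esub> v (snd w) else \<zero>\<^bsub>K\<^esub>)"
    by (rule M_mult_alt[OF M_add_closed[OF u u'] v f(1) s f(2) subset_refl])
  also have "\<dots> = (\<Oplus>\<^bsub>K\<^esub>w\<in>?X \<times> ?Y. (if pair_mult (fst w) (snd w) = z then u (fst w) \<otimes>\<^bsub>K\<^esub> v (snd w) else \<zero>\<^bsub>K\<^esub>)
      \<oplus>\<^bsub>K\<^esub> (if pair_mult (fst w) (snd w) = z then u' (fst w) \<otimes>\<^bsub>K\<^esub> v (snd w) else \<zero>\<^bsub>K\<^esub>))"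
    using c by (intro A.R.add.finprod_cong') (auto simp: M_simps A.R.l_distr)
  also have "\<dots> = (\<Oplus>\<^bsub>K\<^esub>w\<in>?X \<times> ?Y. if pair_mult (fst w) (snd w) = z then u (fst w) \<otimes>\<^bsub>K\<^esub> v (snd w) else \<zero>\<^bsub>K\<^esub>)
      \<oplus>\<^bsub>K\<^esub> (\<Oplus>\<^bsub>K\<^esub>w\<in>?X \<times> ?Y. if pair_mult (fst w) (snd w) = z then u' (fst w) \<otimes>\<^bsub>K\<^esub> v (snd w) else \<zero>\<^bsub>K\<^esub>)"
    using c by (intro A.R.add.finprod_multf) auto
  also have "\<dots> = (u \<otimes>\<^bsub>M\<^esub> v) z \<oplus>\<^bsub>K\<^esub> (u' \<otimes>\<^bsub>M\<^esub> v) z"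
    using M_mult_alt[OF u v f(1) _ f(2) subset_refl] M_mult_alt[OF u' v f(1) _ f(2) subset_refl] by simp
  finally show "((u \<oplus>\<^bsub>M\<^esub> u') \<otimes>\<^bsub>M\<^esub> v) z = (u \<otimes>\<^bsub>M\<^esub> v \<oplus>\<^bsub>M\<^esub> u' \<otimes>\<^bsub>M\<^esub> v) z" by (simp add: M_simps)
qed

lemma M_mult_add_right:
  assumes u: "u \<in> carrier M" and u': "u' \<in> carrier M" and v: "v \<in> carrier M"
  shows "v \<otimes>\<^bsub>M\<^esub> (u \<oplus>\<^bsub>M\<^esub> u') = v \<otimes>\<^bsub>M\<^esub> u \<oplus>\<^bsub>M\<^esub> v \<otimes>\<^bsub>M\<^esub> u'"
proof
  fix z
  let ?X = "supp u \<union> supp u'" and ?Y = "supp v"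
  have f: "finite ?X" "finite ?Y" using M_finite u u' v by auto
  note c = M_closed[OF u] M_closed[OF u'] M_closed[OF v]
  have s: "supp (u \<oplus>\<^bsub>M\<^esub> u') \<subseteq> ?X" by (auto simp: M_simps)
  have "(v \<otimes>\<^bsub>M\<^esub> (u \<oplus>\<^bsub>M\<^esub> u')) z = (\<Oplus>\<^bsub>K\<^esub>w\<in>?Y \<times> ?X. if pair_mult (fst w) (snd w) = z then v (fst w) \<otimes>\<^bsub>K\<^esub> (u \<oplus>\<^bsub>M\<^esub> u') (snd w) else \<zero>\<^bsub>K\<^esub>)"
    by (rule M_mult_alt[OF v M_add_closed[OF u u'] f(2) subset_refl f(1) s])
  also have "\<dots> = (\<Oplus>\<^bsub>K\<^esub>w\<in>?Y \<times> ?X. (if pair_mult (fst w) (snd w) = z then v (fst w) \<otimes>\<^bsub>K\<^esub> u (snd w) else \<zero>\<^bsub>K\<^esub>)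
      \<oplus>\<^bsub>K\<^esub> (if pair_mult (fst w) (snd w) = z then v (fst w) \<otimes>\<^bsub>K\<^esub> u' (snd w) else \<zero>\<^bsub>K\<^esub>))"
    using c by (intro A.R.add.finprod_cong') (auto simp: M_simps A.R.r_distr)
  also have "\<dots> = (\<Oplus>\<^bsub>K\<^esub>w\<in>?Y \<times> ?X. if pair_mult (fst w) (snd w) = z then v (fst w) \<otimes>\<^bsub>K\<^esub> u (snd w) else \<zero>\<^bsub>K\<^esub>)
      \<oplus>\<^bsub>K\<^esub> (\<Oplus>\<^bsub>K\<^esub>w\<in>?Y \<times> ?X. if pair_mult (fst w) (snd w) = z then v (fst w) \<otimes>\<^bsub>K\<^esub> u' (snd w) else \<zero>\<^bsub>K\<^esub>)"
    using c by (intro A.R.add.finprod_multf) auto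
  also have "\<dots> = (v \<otimes>\<^bsub>M\<^esub> u) z \<oplus>\<^bsub>K\<^esub> (v \<otimes>\<^bsub>M\<^esub> u') z"
    using M_mult_alt[OF v u f(2) subset_refl f(1)] M_mult_alt[OF v u' f(2) subset_refl f(1)] by simp
  finally show "(v \<otimes>\<^bsub>M\<^esub> (u \<oplus>\<^bsub>M\<^esub> u')) z = (v \<otimes>\<^bsub>M\<^esub> u \<oplus>\<^bsub>M\<^esub> v \<otimes>\<^bsub>M\<^esub> u') z" by (simp add: M_simps)
qed

lemma M_mult_smult:
  assumes u: "u \<in> carrier M" and v: "v \<in> carrier M" and k: "k \<in> carrier K"
  shows "(k \<odot>\<^bsub>M\<^esub> u) \<otimes>\<^bsub>M\<^esub> v = k \<odot>\<^bsub>M\<^esub> (u \<otimes>\<^bsub>M\<^esub> v)" "u \<otimes>\<^bsub>M\<^esub> (k \<odot>\<^bsub>M\<^esub> v) = k \<odot>\<^bsub>M\<^esub> (u \<otimes>\<^bsub>M\<^esub> v)"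
proof -
  let ?X = "supp u" and ?Y = "supp v"
  have f: "finite ?X" "finite ?Y" using M_finite u v by auto
  note c = M_closed[OF u] M_closed[OF v]
  have s: "supp (k \<odot>\<^bsub>M\<^esub> u) \<subseteq> ?X" "supp (k \<odot>\<^bsub>M\<^esub> v) \<subseteq> ?Y" using k by (auto simp: M_simps)
  let ?S = "\<lambda>z. \<Oplus>\<^bsub>K\<^esub>w\<in>?X \<times> ?Y. k \<otimes>\<^bsub>K\<^esub> (if pair_mult (fst w) (snd w) = z then u (fst w) \<otimes>\<^bsub>K\<^esub> v (snd w) else \<zero>\<^bsub>K\<^esub>)"
  have S: "?S z = (k \<odot>\<^bsub>M\<^esub> (u \<otimes>\<^bsub>M\<^esub> v)) z" for z
  proof -
    have "(k \<odot>\<^bsub>M\<^esub> (u \<otimes>\<^bsub>M\<^esub> v)) z = k \<otimes>\<^bsub>K\<^esub> (\<Oplus>\<^bsub>K\<^esub>w\<in>?X \<times> ?Y. (if pair_mult (fst w) (snd w) = z then u (fst w) \<otimes>\<^bsub>K\<^esub> v (snd w) else \<zero>\<^bsub>K\<^esub>))"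
      using M_mult_alt[OF u v f(1) subset_refl f(2) subset_refl] by (simp add: M_simps)
    also have "\<dots> = ?S z" using c k f by (intro A.R.finsum_rdistr) auto
    finally show ?thesis by simp
  qed
  have "((k \<odot>\<^bsub>M\<^esub> u) \<otimes>\<^bsub>M\<^esub> v) z = ?S z" for z
    unfolding M_mult_alt[OF M_smult_closed[OF k u] v f(1) s(1) f(2) subset_refl]
    using c k by (intro A.R.add.finprod_cong') (auto simp: M_simps A.R.m_assoc)
  then show "(k \<odot>\<^bsub>M\<^esub> u) \<otimes>\<^bsub>M\<^esub> v = k \<odot>\<^bsub>M\<^esub> (u \<otimes>\<^bsub>M\<^esub> v)" using S by auto
  have "(u \<otimes>\<^bsub>M\<^esub> (k \<odot>\<^bsub>M\<^esub> v)) z = ?S z" for z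
    unfolding M_mult_alt[OF u M_smult_closed[OF k v] f(1) subset_refl f(2) s(2)]
    using c k by (intro A.R.add.finprod_cong') (auto simp: M_simps A.R.m_lcomm)
  then show "u \<otimes>\<^bsub>M\<^esub> (k \<odot>\<^bsub>M\<^esub> v) = k \<odot>\<^bsub>M\<^esub> (u \<otimes>\<^bsub>M\<^esub> v)" using S by auto
qed

lemma gen_mult:
  assumes "a \<in> carrier A" "a' \<in> carrier A" "b \<in> carrier B" "b' \<in> carrier B"
  shows "gen a b \<otimes>\<^bsub>M\<^esub> gen a' b' = gen (a \<otimes>\<^bsub>A\<^esub> a') (b \<otimes>\<^bsub>B\<^esub> b')"
proof
  fix z
  have "(gen a b \<otimes>\<^bsub>M\<^esub> gen a' b') z = (\<Oplus>\<^bsub>K\<^esub>w\<in>{(a,b)} \<times> {(a',b')}. if pair_mult (fst w) (snd w) = z then gen a b (fst w) \<otimes>\<^bsub>K\<^esub> gen a' b' (snd w) else \<zero>\<^bsub>K\<^esub>)"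
    by (rule M_mult_alt) (use assms gen_closed in \<open>auto simp: free_gen_def\<close>)
  then show "(gen a b \<otimes>\<^bsub>M\<^esub> gen a' b') z = gen (a \<otimes>\<^bsub>A\<^esub> a') (b \<otimes>\<^bsub>B\<^esub> b') z"
    by (auto simp: free_gen_def pair_mult_def)
qed

lemma M_mult_minus:
  assumes "u \<in> carrier M" "v \<in> carrier M" "w \<in> carrier M"
  shows "(u \<ominus>\<^bsub>M\<^esub> v) \<otimes>\<^bsub>M\<^esub> w = u \<otimes>\<^bsub>M\<^esub> w \<ominus>\<^bsub>M\<^esub> v \<otimes>\<^bsub>M\<^esub> w"
    "w \<otimes>\<^bsub>M\<^esub> (u \<ominus>\<^bsub>M\<^esub> v) = w \<otimes>\<^bsub>M\<^esub> u \<ominus>\<^bsub>M\<^esub> w \<otimes>\<^bsub>M\<^esub> v"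
proof -
  have d: "u \<ominus>\<^bsub>M\<^esub> v \<in> carrier M" using assms by simp
  have e: "u = (u \<ominus>\<^bsub>M\<^esub> v) \<oplus>\<^bsub>M\<^esub> v" using assms by (simp add: M.M.minus_eq M.M.a_assoc M.M.l_neg)
  have "u \<otimes>\<^bsub>M\<^esub> w = (u \<ominus>\<^bsub>M\<^esub> v) \<otimes>\<^bsub>M\<^esub> w \<oplus>\<^bsub>M\<^esub> v \<otimes>\<^bsub>M\<^esub> w"
    using M_mult_add_left[OF d assms(2,3)] e by simp
  then show "(u \<ominus>\<^bsub>M\<^esub> v) \<otimes>\<^bsub>M\<^esub> w = u \<otimes>\<^bsub>M\<^esub> w \<ominus>\<^bsub>M\<^esub> v \<otimes>\<^bsub>M\<^esub> w"
    using M_mult_closed[OF d assms(3)] M_mult_closed[OF assms(2,3)]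
    by (simp add: M.M.minus_eq[of "_ \<oplus>\<^bsub>M\<^esub> _"] M.M.a_assoc M.M.r_neg)
  have "w \<otimes>\<^bsub>M\<^esub> u = w \<otimes>\<^bsub>M\<^esub> (u \<ominus>\<^bsub>M\<^esub> v) \<oplus>\<^bsub>M\<^esub> w \<otimes>\<^bsub>M\<^esub> v"
    using M_mult_add_right[OF d assms(2,3)] e by simp
  then show "w \<otimes>\<^bsub>M\<^esub> (u \<ominus>\<^bsub>M\<^esub> v) = w \<otimes>\<^bsub>M\<^esub> u \<ominus>\<^bsub>M\<^esub> w \<otimes>\<^bsub>M\<^esub> v"
    using M_mult_closed[OF assms(3) d] M_mult_closed[OF assms(3,2)]
    by (simp add: M.M.minus_eq[of "_ \<oplus>\<^bsub>M\<^esub> _"] M.M.a_assoc M.M.r_neg)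
qed

section \<open>The ideal of bilinear relations\<close>

abbreviation rel where "rel \<equiv> tensor_relators K A B"

lemma rel_intros:
  "\<lbrakk>a \<in> carrier A; a' \<in> carrier A; b \<in> carrier B\<rbrakk> \<Longrightarrow>
    gen (a \<oplus>\<^bsub>A\<^esub> a') b \<ominus>\<^bsub>M\<^esub> (gen a b \<oplus>\<^bsub>M\<^esub> gen a' b) \<in> rel"
  "\<lbrakk>a \<in> carrier A; b \<in> carrier B; b' \<in> carrier B\<rbrakk> \<Longrightarrow>
    gen a (b \<oplus>\<^bsub>B\<^esub> b') \<ominus>\<^bsub>M\<^esub> (gen a b \<oplus>\<^bsub>M\<^esub> gen a b') \<in> rel"
  "\<lbrakk>a \<in> carrier A; b \<in> carrier B; c \<in> carrier K\<rbrakk> \<Longrightarrow>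
    gen (c \<odot>\<^bsub>A\<^esub> a) b \<ominus>\<^bsub>M\<^esub> (c \<odot>\<^bsub>M\<^esub> gen a b) \<in> rel"
  "\<lbrakk>a \<in> carrier A; b \<in> carrier B; c \<in> carrier K\<rbrakk> \<Longrightarrow>
    gen a (c \<odot>\<^bsub>B\<^esub> b) \<ominus>\<^bsub>M\<^esub> (c \<odot>\<^bsub>M\<^esub> gen a b) \<in> rel"
  unfolding tensor_relators_def Let_def by blast+

lemma rel_cases:
  assumes "r \<in> rel"
  obtains a a' b where "r = gen (a \<oplus>\<^bsub>A\<^esub> a') b \<ominus>\<^bsub>M\<^esub> (gen a b \<oplus>\<^bsub>M\<^esub> gen a' b)" "a \<in> carrier A" "a' \<in> carrier A" "b \<in> carrier B"
  | a b b' where "r = gen a (b \<oplus>\<^bsub>B\<^esub> b') \<ominus>\<^bsub>M\<^esub> (gen a b \<oplus>\<^bsub>M\<^esub> gen a b')" "a \<in> carrier A" "b \<in> carrier B" "b' \<in> carrier B"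
  | a b c where "r = gen (c \<odot>\<^bsub>A\<^esub> a) b \<ominus>\<^bsub>M\<^esub> (c \<odot>\<^bsub>M\<^esub> gen a b)" "a \<in> carrier A" "b \<in> carrier B" "c \<in> carrier K"
  | a b c where "r = gen a (c \<odot>\<^bsub>B\<^esub> b) \<ominus>\<^bsub>M\<^esub> (c \<odot>\<^bsub>M\<^esub> gen a b)" "a \<in> carrier A" "b \<in> carrier B" "c \<in> carrier K"
  using assms unfolding tensor_relators_def Let_def by blast

lemma rel_closed: "r \<in> rel \<Longrightarrow> r \<in> carrier M"
  by (erule rel_cases) (auto simp: gen_closed)

lemma N_submodule: "LinearCombinations.submodule K N M"
  unfolding tensor_kernel_def using rel_closed by (intro M.span_is_submodule) blast

lemma rel_in_N: "r \<in> rel \<Longrightarrow> r \<in> N"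
proof -
  assume r: "r \<in> rel"
  have "M.lincomb (\<lambda>_. \<one>\<^bsub>K\<^esub>) {r} = r" using rel_closed[OF r] unfolding M.lincomb_def by simp
  then show "r \<in> N" unfolding tensor_kernel_def M.span_def using r
    by (intro CollectI exI[of _ "\<lambda>_. \<one>\<^bsub>K\<^esub>"] exI[of _ "{r}"]) auto
qed

lemma N_least: "LinearCombinations.submodule K W M \<Longrightarrow> rel \<subseteq> W \<Longrightarrow> N \<subseteq> W"
  unfolding tensor_kernel_def by (rule M.span_is_subset)

lemma N_closed: "n \<in> N \<Longrightarrow> n \<in> carrier M" "n \<in> N \<Longrightarrow> n' \<in> N \<Longrightarrow> n \<oplus>\<^bsub>M\<^esub> n' \<in> N" "\<zero>\<^bsub>M\<^esub> \<in> N"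
  "c \<in> carrier K \<Longrightarrow> n \<in> N \<Longrightarrow> c \<odot>\<^bsub>M\<^esub> n \<in> N"
  using N_submodule by (auto simp: LinearCombinations.submodule_def)

lemma N_uminus: "n \<in> N \<Longrightarrow> \<ominus>\<^bsub>M\<^esub> n \<in> N"
  using N_closed(4)[of "\<ominus>\<^bsub>K\<^esub> \<one>\<^bsub>K\<^esub>" n] M.smult_minus_1[of n] N_closed(1)[of n] by auto

text \<open>Bilinearity of the two multiplications carries each of the four families of relators
  into itself under multiplication by a generator.\<close>

lemma gen_mult_rel: 
  assumes "r \<in> rel" "x \<in> carrier A" "y \<in> carrier B"
  shows "gen x y \<otimes>\<^bsub>M\<^esub> r \<in> rel" "r \<otimes>\<^bsub>M\<^esub> gen x y \<in> rel"
  using assms(1)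
  by (cases r rule: rel_cases;
      simp add: M_mult_minus M_mult_add_right M_mult_add_left M_mult_smult gen_mult gen_closed A_mult B_mult assms rel_intros)+

text \<open>For fixed \<open>u\<close> the elements that \<open>u\<close> multiplies into
  \<open>N\<close> form a submodule. It contains the relators, by induction on \<open>u\<close> from
  \<open>gen_mult_rel\<close>, and hence contains their span.\<close>

lemma N_ideal: assumes n: "n \<in> N" and u: "u \<in> carrier M" shows "u \<otimes>\<^bsub>M\<^esub> n \<in> N" "n \<otimes>\<^bsub>M\<^esub> u \<in> N"
proof -
  have sub: "LinearCombinations.submodule K {n \<in> carrier M. u \<otimes>\<^bsub>M\<^esub> n \<in> N} M"
            "LinearCombinations.submodule K {n \<in> carrier M. n \<otimes>\<^bsub>M\<^esub> u \<in> N} M" if u: "u \<in> carrier M" for u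
  proof -
    have z: "u \<otimes>\<^bsub>M\<^esub> \<zero>\<^bsub>M\<^esub> = \<zero>\<^bsub>M\<^esub>" "\<zero>\<^bsub>M\<^esub> \<otimes>\<^bsub>M\<^esub> u = \<zero>\<^bsub>M\<^esub>"
      using M_mult_smult[OF u M_zero_closed, of "\<zero>\<^bsub>K\<^esub>"] M_mult_smult[OF M_zero_closed u, of "\<zero>\<^bsub>K\<^esub>"]
        M_mult_closed[OF u M_zero_closed] M_mult_closed[OF M_zero_closed u] by simp_all
    show "LinearCombinations.submodule K {n \<in> carrier M. u \<otimes>\<^bsub>M\<^esub> n \<in> N} M"
      by (rule LinearCombinations.submodule.intro) (auto simp: module_M M_mult_add_right u N_closed M_mult_smult z)
    show "LinearCombinations.submodule K {n \<in> carrier M. n \<otimes>\<^bsub>M\<^esub> u \<in> N} M"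
      by (rule LinearCombinations.submodule.intro) (auto simp: module_M M_mult_add_left u N_closed M_mult_smult z)
  qed
  have r: "u \<otimes>\<^bsub>M\<^esub> r \<in> N \<and> r \<otimes>\<^bsub>M\<^esub> u \<in> N" if r: "r \<in> rel" for r
    using u
  proof (induction u rule: M_induct)
    case (add u v)
    then show ?case using rel_closed[OF r] by (simp add: M_mult_add_left M_mult_add_right N_closed)
  next
    case (gen c a b)
    then show ?case using rel_closed[OF r] gen_mult_rel[OF r gen(2,3)]
      by (simp add: M_mult_smult gen_closed N_closed rel_in_N)
  qed
  show "u \<otimes>\<^bsub>M\<^esub> n \<in> N" using N_least[OF sub(1)[OF u]] r rel_closed n by blast
  show "n \<otimes>\<^bsub>M\<^esub> u \<in> N" using N_least[OF sub(2)[OF u]] r rel_closed n by blast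
qed

lemma N_abelian_subgroup: "abelian_subgroup N M"
proof (rule abelian_subgroupI3)
  show "additive_subgroup N M"
  proof (rule additive_subgroupI, rule subgroup.intro)
    fix x assume "x \<in> N"
    then show "inv\<^bsub>add_monoid M\<^esub> x \<in> N" using N_uminus[of x] by (simp add: a_inv_def)
  qed (use N_closed in auto)
  show "abelian_group M" by (rule M.M.abelian_group_axioms)
qed

sublocale NS: abelian_subgroup N M by (rule N_abelian_subgroup)

section \<open>The quotient algebra and its universal property\<close>

definition \<pi> :: "('a \<times> 'b \<Rightarrow> 'k) \<Rightarrow> ('a \<times> 'b \<Rightarrow> 'k) set" where
  "\<pi> u = N +>\<^bsub>M\<^esub> u"

lemma \<pi>_memD: assumes "u \<in> carrier M" "v \<in> \<pi> u" shows "v \<in> carrier M" "v \<ominus>\<^bsub>M\<^esub> u \<in> N" "\<pi> v = \<pi> u"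
  using assms NS.a_elemrcos_carrier[of u v] NS.a_rcos_module_imp[of u v] NS.a_repr_independence'[of v u]
  by (auto simp: \<pi>_def M.M.minus_eq)

lemma \<pi>_self: "u \<in> carrier M \<Longrightarrow> u \<in> \<pi> u"
  unfolding \<pi>_def by (rule NS.a_rcos_self)

lemma \<pi>_eqI: "u \<in> carrier M \<Longrightarrow> v \<in> carrier M \<Longrightarrow> v \<ominus>\<^bsub>M\<^esub> u \<in> N \<Longrightarrow> \<pi> v = \<pi> u"
  using NS.a_rcos_module_rev[of u v] NS.a_repr_independence'[of v u] by (auto simp: \<pi>_def M.M.minus_eq)

lemma T_carrier: "carrier T = \<pi> ` carrier M"
  by (auto simp: tensor_algebra_def Let_def FactRing_def A_RCOSETS_def' \<pi>_def)

lemma T_zero: "\<zero>\<^bsub>T\<^esub> = \<pi> \<zero>\<^bsub>M\<^esub>"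
  using NS.a_rcos_const[of "\<zero>\<^bsub>M\<^esub>"] by (simp add: tensor_algebra_def Let_def FactRing_def \<pi>_def)

lemma T_one: "\<one>\<^bsub>T\<^esub> = \<pi> (gen \<one>\<^bsub>A\<^esub> \<one>\<^bsub>B\<^esub>)"
  by (simp add: tensor_algebra_def Let_def FactRing_def \<pi>_def M_simps)

lemma T_add: "u \<in> carrier M \<Longrightarrow> v \<in> carrier M \<Longrightarrow> \<pi> u \<oplus>\<^bsub>T\<^esub> \<pi> v = \<pi> (u \<oplus>\<^bsub>M\<^esub> v)"
  using NS.a_rcos_sum[of u v] by (simp add: tensor_algebra_def Let_def FactRing_def \<pi>_def)

text \<open>The scalar action is defined as a union over all representatives; they all give the same
  coset, so the union is that coset.\<close>

lemma T_smult:
  assumes c: "c \<in> carrier K" and u: "u \<in> carrier M" shows "c \<odot>\<^bsub>T\<^esub> \<pi> u = \<pi> (c \<odot>\<^bsub>M\<^esub> u)"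
proof -
  have "\<pi> (c \<odot>\<^bsub>M\<^esub> v) = \<pi> (c \<odot>\<^bsub>M\<^esub> u)" if "v \<in> \<pi> u" for v
  proof (rule \<pi>_eqI)
    note v = \<pi>_memD[OF u that]
    show "c \<odot>\<^bsub>M\<^esub> u \<in> carrier M" "c \<odot>\<^bsub>M\<^esub> v \<in> carrier M" using c u v by auto
    have "c \<odot>\<^bsub>M\<^esub> (v \<ominus>\<^bsub>M\<^esub> u) = c \<odot>\<^bsub>M\<^esub> v \<ominus>\<^bsub>M\<^esub> c \<odot>\<^bsub>M\<^esub> u"
      using c u v by (simp add: M.M.minus_eq M.smult_r_distr M.smult_r_minus)
    then show "c \<odot>\<^bsub>M\<^esub> v \<ominus>\<^bsub>M\<^esub> c \<odot>\<^bsub>M\<^esub> u \<in> N" using N_closed(4)[OF c v(2)] by simp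
  qed
  then have "(\<Union>v\<in>\<pi> u. \<pi> (c \<odot>\<^bsub>M\<^esub> v)) = \<pi> (c \<odot>\<^bsub>M\<^esub> u)"
    using \<pi>_self[OF u] by (intro SUP_eq_const) blast+
  then show ?thesis by (simp add: tensor_algebra_def Let_def \<pi>_def)
qed

text \<open>Representatives are changed one factor at a time, with the two halves of
  \<open>N_ideal\<close>; the union in the coset product then collapses.\<close>

lemma T_mult:
  assumes u: "u \<in> carrier M" and v: "v \<in> carrier M" shows "\<pi> u \<otimes>\<^bsub>T\<^esub> \<pi> v = \<pi> (u \<otimes>\<^bsub>M\<^esub> v)"
proof -
  have "\<pi> (u' \<otimes>\<^bsub>M\<^esub> v') = \<pi> (u \<otimes>\<^bsub>M\<^esub> v)" if "u' \<in> \<pi> u" "v' \<in> \<pi> v" for u' v'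
  proof -
    note u' = \<pi>_memD[OF u that(1)] and v' = \<pi>_memD[OF v that(2)]
    have "\<pi> (u' \<otimes>\<^bsub>M\<^esub> v') = \<pi> (u \<otimes>\<^bsub>M\<^esub> v')"
      using N_ideal(2)[OF u'(2) v'(1)] u u' v' by (intro \<pi>_eqI) (auto simp: M_mult_minus M_mult_closed)
    also have "\<dots> = \<pi> (u \<otimes>\<^bsub>M\<^esub> v)"
      using N_ideal(1)[OF v'(2) u] u v v' by (intro \<pi>_eqI) (auto simp: M_mult_minus M_mult_closed)
    finally show ?thesis .
  qed
  then have "(\<Union>u'\<in>\<pi> u. \<Union>v'\<in>\<pi> v. \<pi> (u' \<otimes>\<^bsub>M\<^esub> v')) = \<pi> (u \<otimes>\<^bsub>M\<^esub> v)"
    using \<pi>_self[OF u] \<pi>_self[OF v] by (intro SUP_eq_const) blast+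
  then show ?thesis by (simp add: tensor_algebra_def Let_def \<pi>_def FactRing_def rcoset_mult_def)
qed

lemma T_nonassoc: "nonassoc_algebra K T"
proof -
  have ag: "abelian_group T"
  proof (rule abelian_groupI)
    fix x assume "x \<in> carrier T"
    then obtain u where u: "u \<in> carrier M" "x = \<pi> u" by (auto simp: T_carrier)
    then have "\<pi> (\<ominus>\<^bsub>M\<^esub> u) \<oplus>\<^bsub>T\<^esub> x = \<zero>\<^bsub>T\<^esub>" by (simp add: T_add T_zero M.M.l_neg)
    then show "\<exists>y\<in>carrier T. y \<oplus>\<^bsub>T\<^esub> x = \<zero>\<^bsub>T\<^esub>" using u by (auto simp: T_carrier)
  qed (auto simp: T_carrier T_add T_zero M.M.a_ac)
  have "module K T"
    by (rule moduleI[OF cring_K ag])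
       (auto simp: T_carrier T_add T_smult M.smult_l_distr M.smult_r_distr M.smult_assoc1)
  then have "vectorspace K T" using field_K by (rule vectorspace.intro)
  then show ?thesis unfolding nonassoc_algebra_def
    by (auto simp: T_carrier T_add T_smult T_mult M_mult_closed M_mult_add_left M_mult_add_right M_mult_smult)
qed

sublocale T: vectorspace K T using T_nonassoc by (simp add: nonassoc_algebra_def)

abbreviation pt where "pt \<equiv> pure_tensor K A B"

lemma pt_eq: "pt a b = \<pi> (gen a b)"
  by (simp add: pure_tensor_def \<pi>_def)

lemma pt_closed: "a \<in> carrier A \<Longrightarrow> b \<in> carrier B \<Longrightarrow> pt a b \<in> carrier T"
  by (simp add: pt_eq T_carrier gen_closed)

lemma pt_bilinear: "bilinear_map K A B T pt"
proof -
  have "pt (a \<oplus>\<^bsub>A\<^esub> a') b = pt a b \<oplus>\<^bsub>T\<^esub> pt a' b" if "a \<in> carrier A" "a' \<in> carrier A" "b \<in> carrier B" for a a' b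
    using rel_in_N[OF rel_intros(1)[OF that]] that by (simp add: pt_eq T_add gen_closed) (intro \<pi>_eqI, auto simp: gen_closed)
  moreover have "pt a (b \<oplus>\<^bsub>B\<^esub> b') = pt a b \<oplus>\<^bsub>T\<^esub> pt a b'" if "a \<in> carrier A" "b \<in> carrier B" "b' \<in> carrier B" for a b b'
    using rel_in_N[OF rel_intros(2)[OF that]] that by (simp add: pt_eq T_add gen_closed) (intro \<pi>_eqI, auto simp: gen_closed)
  moreover have "pt (c \<odot>\<^bsub>A\<^esub> a) b = c \<odot>\<^bsub>T\<^esub> pt a b" if "a \<in> carrier A" "b \<in> carrier B" "c \<in> carrier K" for a b c
    using rel_in_N[OF rel_intros(3)[OF that]] that by (simp add: pt_eq T_smult gen_closed) (intro \<pi>_eqI, auto simp: gen_closed)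
  moreover have "pt a (c \<odot>\<^bsub>B\<^esub> b) = c \<odot>\<^bsub>T\<^esub> pt a b" if "a \<in> carrier A" "b \<in> carrier B" "c \<in> carrier K" for a b c
    using rel_in_N[OF rel_intros(4)[OF that]] that by (simp add: pt_eq T_smult gen_closed) (intro \<pi>_eqI, auto simp: gen_closed)
  ultimately show ?thesis unfolding bilinear_map_def by (intro conjI ballI) (simp_all add: pt_closed)
qed

lemma pt_simps:
  "\<lbrakk>a \<in> carrier A; a' \<in> carrier A; b \<in> carrier B\<rbrakk> \<Longrightarrow> pt (a \<oplus>\<^bsub>A\<^esub> a') b = pt a b \<oplus>\<^bsub>T\<^esub> pt a' b"
  "\<lbrakk>a \<in> carrier A; b \<in> carrier B; b' \<in> carrier B\<rbrakk> \<Longrightarrow> pt a (b \<oplus>\<^bsub>B\<^esub> b') = pt a b \<oplus>\<^bsub>T\<^esub> pt a b'"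
  "\<lbrakk>c \<in> carrier K; a \<in> carrier A; b \<in> carrier B\<rbrakk> \<Longrightarrow> pt (c \<odot>\<^bsub>A\<^esub> a) b = c \<odot>\<^bsub>T\<^esub> pt a b"
  "\<lbrakk>c \<in> carrier K; a \<in> carrier A; b \<in> carrier B\<rbrakk> \<Longrightarrow> pt a (c \<odot>\<^bsub>B\<^esub> b) = c \<odot>\<^bsub>T\<^esub> pt a b"
  using pt_bilinear unfolding bilinear_map_def by blast+

lemma pt_mult:
  "\<lbrakk>a \<in> carrier A; a' \<in> carrier A; b \<in> carrier B; b' \<in> carrier B\<rbrakk> \<Longrightarrow>
    pt a b \<otimes>\<^bsub>T\<^esub> pt a' b' = pt (a \<otimes>\<^bsub>A\<^esub> a') (b \<otimes>\<^bsub>B\<^esub> b')"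
  by (simp add: pt_eq T_mult gen_mult gen_closed)

lemma T_one_pt: "\<one>\<^bsub>T\<^esub> = pt \<one>\<^bsub>A\<^esub> \<one>\<^bsub>B\<^esub>"
  by (simp add: T_one pt_eq)

lemma pt_zero: "a \<in> carrier A \<Longrightarrow> pt a \<zero>\<^bsub>B\<^esub> = \<zero>\<^bsub>T\<^esub>" "b \<in> carrier B \<Longrightarrow> pt \<zero>\<^bsub>A\<^esub> b = \<zero>\<^bsub>T\<^esub>"
  using pt_simps(4)[of "\<zero>\<^bsub>K\<^esub>" a "\<zero>\<^bsub>B\<^esub>"] pt_simps(3)[of "\<zero>\<^bsub>K\<^esub>" "\<zero>\<^bsub>A\<^esub>" b] pt_closed[of a "\<zero>\<^bsub>B\<^esub>"] pt_closed[of "\<zero>\<^bsub>A\<^esub>" b]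
  by simp_all

text \<open>Scalars are absorbed into the left component, so only sums and pure tensors
  remain.\<close>

lemma T_induct [consumes 1, case_names add pt]:
  assumes x: "x \<in> carrier T"
    and add: "\<And>x y. x \<in> carrier T \<Longrightarrow> y \<in> carrier T \<Longrightarrow> P x \<Longrightarrow> P y \<Longrightarrow> P (x \<oplus>\<^bsub>T\<^esub> y)"
    and pt: "\<And>a b. a \<in> carrier A \<Longrightarrow> b \<in> carrier B \<Longrightarrow> P (pt a b)"
  shows "P x"
proof -
  obtain u where u: "u \<in> carrier M" "x = \<pi> u" using x by (auto simp: T_carrier)
  from u(1) have "P (\<pi> u)"
  proof (induction u rule: M_induct)
    case (add u v)
    then show ?case using assms(2)[of "\<pi> u" "\<pi> v"] by (simp add: T_add T_carrier)
  next
    case (gen c a b)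
    then have "\<pi> (c \<odot>\<^bsub>M\<^esub> gen a b) = pt (c \<odot>\<^bsub>A\<^esub> a) b" by (simp add: pt_simps) (simp add: pt_eq T_smult gen_closed)
    then show ?case using gen pt by simp
  qed
  then show ?thesis using u by simp
qed

text \<open>The linear extension \<open>L\<close> of \<open>\<beta>\<close> to the free module kills
  the relators; its kernel is a submodule, so \<open>L\<close> kills \<open>N\<close> and descends
  to cosets.\<close>

lemma T_lift:
  assumes V: "vectorspace K V" and \<beta>: "bilinear_map K A B V \<beta>"
  shows "\<exists>\<Phi> \<in> module_hom K T V. \<forall>a\<in>carrier A. \<forall>b\<in>carrier B. \<Phi> (pt a b) = \<beta> a b"
proof -
  interpret V: vectorspace K V by (rule V)
  have \<beta>c: "\<And>a b. a \<in> carrier A \<Longrightarrow> b \<in> carrier B \<Longrightarrow> \<beta> a b \<in> carrier V" using \<beta> by (simp add: bilinear_map_def)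
  define L where "L u = (\<Oplus>\<^bsub>V\<^esub>z\<in>supp u. u z \<odot>\<^bsub>V\<^esub> \<beta> (fst z) (snd z))" for u
  have L_alt: "L u = (\<Oplus>\<^bsub>V\<^esub>z\<in>X. u z \<odot>\<^bsub>V\<^esub> \<beta> (fst z) (snd z))"
    if "u \<in> carrier M" "finite X" "supp u \<subseteq> X" "X \<subseteq> carrier A \<times> carrier B" for u X
    unfolding L_def using that M_closed[OF that(1)] \<beta>c
    by (intro V.M.add.finprod_mono_neutral_cong_left) auto
  have L_closed: "L u \<in> carrier V" if "u \<in> carrier M" for u
    unfolding L_def using M_closed[OF that] M_supp[OF that] \<beta>c by (intro V.M.finsum_closed) auto
  have L_add: "L (u \<oplus>\<^bsub>M\<^esub> v) = L u \<oplus>\<^bsub>V\<^esub> L v" if u: "u \<in> carrier M" and v: "v \<in> carrier M" for u v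
  proof -
    let ?X = "supp u \<union> supp v"
    have X: "finite ?X" "?X \<subseteq> carrier A \<times> carrier B" using M_finite M_supp u v by auto
    have s: "supp (u \<oplus>\<^bsub>M\<^esub> v) \<subseteq> ?X" by (auto simp: M_simps)
    have b: "\<beta> (fst z) (snd z) \<in> carrier V" if "z \<in> ?X" for z using that X \<beta>c by auto
    note c = M_closed[OF u] M_closed[OF v]
    have "L (u \<oplus>\<^bsub>M\<^esub> v) = (\<Oplus>\<^bsub>V\<^esub>z\<in>?X. (u z \<oplus>\<^bsub>K\<^esub> v z) \<odot>\<^bsub>V\<^esub> \<beta> (fst z) (snd z))"
      using L_alt[OF M_add_closed[OF u v] X(1) s X(2)] by (simp add: M_simps)
    also have "\<dots> = (\<Oplus>\<^bsub>V\<^esub>z\<in>?X. u z \<odot>\<^bsub>V\<^esub> \<beta> (fst z) (snd z) \<oplus>\<^bsub>V\<^esub> v z \<odot>\<^bsub>V\<^esub> \<beta> (fst z) (snd z))"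
      using b c by (intro V.M.add.finprod_cong') (auto simp: V.smult_l_distr)
    also have "\<dots> = (\<Oplus>\<^bsub>V\<^esub>z\<in>?X. u z \<odot>\<^bsub>V\<^esub> \<beta> (fst z) (snd z)) \<oplus>\<^bsub>V\<^esub> (\<Oplus>\<^bsub>V\<^esub>z\<in>?X. v z \<odot>\<^bsub>V\<^esub> \<beta> (fst z) (snd z))"
      using b c by (intro V.M.add.finprod_multf) auto
    finally show ?thesis using L_alt[OF u X(1) _ X(2)] L_alt[OF v X(1) _ X(2)] by simp
  qed
  have L_smult: "L (k \<odot>\<^bsub>M\<^esub> u) = k \<odot>\<^bsub>V\<^esub> L u" if u: "u \<in> carrier M" and k: "k \<in> carrier K" for u k
  proof -
    have s: "supp (k \<odot>\<^bsub>M\<^esub> u) \<subseteq> supp u" using k by (auto simp: M_simps)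
    have b: "\<beta> (fst z) (snd z) \<in> carrier V" if "z \<in> supp u" for z using that M_supp[OF u] \<beta>c by auto
    note c = M_closed[OF u]
    have "L (k \<odot>\<^bsub>M\<^esub> u) = (\<Oplus>\<^bsub>V\<^esub>z\<in>supp u. (k \<otimes>\<^bsub>K\<^esub> u z) \<odot>\<^bsub>V\<^esub> \<beta> (fst z) (snd z))"
      using L_alt[OF M_smult_closed[OF k u] M_finite[OF u] s M_supp[OF u]] by (simp add: M_simps)
    also have "\<dots> = (\<Oplus>\<^bsub>V\<^esub>z\<in>supp u. k \<odot>\<^bsub>V\<^esub> (u z \<odot>\<^bsub>V\<^esub> \<beta> (fst z) (snd z)))"
      using b c k by (intro V.M.add.finprod_cong') (auto simp: V.smult_assoc1)
    also have "\<dots> = k \<odot>\<^bsub>V\<^esub> L u" unfolding L_def using b c k M_finite[OF u] by (intro V.finsum_smult[symmetric]) auto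
    finally show ?thesis .
  qed
  have L_gen: "L (gen a b) = \<beta> a b" if "a \<in> carrier A" "b \<in> carrier B" for a b
  proof -
    have "L (gen a b) = (\<Oplus>\<^bsub>V\<^esub>z\<in>{(a,b)}. gen a b z \<odot>\<^bsub>V\<^esub> \<beta> (fst z) (snd z))"
      using that by (intro L_alt) (auto simp: gen_closed, auto simp: free_gen_def split: if_splits)
    then show ?thesis using \<beta>c[OF that] by (simp add: free_gen_def)
  qed
  have L_minus: "L (u \<ominus>\<^bsub>M\<^esub> v) = \<zero>\<^bsub>V\<^esub> \<longleftrightarrow> L u = L v" if u: "u \<in> carrier M" and v: "v \<in> carrier M" for u v
  proof -
    have "L u = L (u \<ominus>\<^bsub>M\<^esub> v) \<oplus>\<^bsub>V\<^esub> L v"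
      using L_add[of "u \<ominus>\<^bsub>M\<^esub> v" v] u v by (simp add: M.M.minus_eq M.M.a_assoc M.M.l_neg)
    then show ?thesis using L_closed[OF v] L_closed[of "u \<ominus>\<^bsub>M\<^esub> v"] u v
      by (metis M.M.minus_closed V.M.add.r_cancel_one)
  qed
  have sub: "LinearCombinations.submodule K {u \<in> carrier M. L u = \<zero>\<^bsub>V\<^esub>} M"
  proof (rule LinearCombinations.submodule.intro)
    have "L \<zero>\<^bsub>M\<^esub> = \<zero>\<^bsub>V\<^esub>" using L_def by (simp add: M_simps)
    then show "\<zero>\<^bsub>M\<^esub> \<in> {u \<in> carrier M. L u = \<zero>\<^bsub>V\<^esub>}" using M_zero_closed by simp
  qed (auto simp: module_M L_add L_smult)
  have "L r = \<zero>\<^bsub>V\<^esub>" if "r \<in> rel" for r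
    using that \<beta> unfolding bilinear_map_def
    by (cases r rule: rel_cases) (simp_all add: L_minus L_add L_smult L_gen gen_closed)
  then have LN: "L n = \<zero>\<^bsub>V\<^esub>" if "n \<in> N" for n using N_least[OF sub] rel_closed that by blast
  \<comment> \<open>The choice of a representative is harmless because \<open>L\<close> vanishes on
    \<open>N\<close>.\<close>
  define \<Phi> where "\<Phi> U = L (SOME u. u \<in> U)" for U
  have \<Phi>: "\<Phi> (\<pi> u) = L u" if u: "u \<in> carrier M" for u
  proof -
    define v where "v = (SOME v. v \<in> \<pi> u)"
    have "v \<in> \<pi> u" unfolding v_def using \<pi>_self[OF u] by (rule someI[of "\<lambda>v. v \<in> \<pi> u"])
    note v = \<pi>_memD[OF u this]
    have "L v = L u" using LN[OF v(2)] L_minus[OF v(1) u] by simp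
    then show ?thesis by (simp add: \<Phi>_def v_def)
  qed
  have "\<Phi> \<in> module_hom K T V" unfolding module_hom_def
    by (auto simp: T_carrier \<Phi> L_closed T_add L_add T_smult L_smult)
  moreover have "\<forall>a\<in>carrier A. \<forall>b\<in>carrier B. \<Phi> (pt a b) = \<beta> a b"
    by (simp add: pt_eq \<Phi> gen_closed L_gen)
  ultimately show ?thesis by blast
qed

end

section \<open>Dimensions\<close>

definition base_module :: "('k, 'm) ring_scheme \<Rightarrow> ('k, 'k) module" where
  "base_module K =
     \<lparr>carrier = carrier K, mult = mult K, one = one K, zero = zero K, add = add K, smult = mult K\<rparr>"

lemma base_module_simps [simp]:
  "carrier (base_module K) = carrier K" "\<zero>\<^bsub>base_module K\<^esub> = \<zero>\<^bsub>K\<^esub>"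
  "x \<oplus>\<^bsub>base_module K\<^esub> y = x \<oplus>\<^bsub>K\<^esub> y" "x \<odot>\<^bsub>base_module K\<^esub> y = x \<otimes>\<^bsub>K\<^esub> y"
  by (simp_all add: base_module_def)

lemma (in field) vectorspace_base_module: "vectorspace R (base_module R)"
proof (rule vectorspace.intro)
  have "abelian_group (base_module R)"
    by (rule abelian_groupI) (auto simp: a_ac intro: exI bexI[of _ "\<ominus> x" for x] l_neg)
  then show "module R (base_module R)"
    by (intro moduleI) (auto simp: is_cring l_distr r_distr m_assoc)
  show "field R" by (rule field_axioms)
qed

text \<open>A finite basis, with linear independence expressed by the existence of dual functionals;
  in this form bases of tensor products need no rearrangement of sums.\<close>

definition dual_basis :: "('k, 'm) ring_scheme \<Rightarrow> ('k, 'v, 'n) module_scheme \<Rightarrow> 'i set \<Rightarrow> ('i \<Rightarrow> 'v) \<Rightarrow> bool" where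
  "dual_basis K V I v \<longleftrightarrow> finite I \<and> v \<in> I \<rightarrow> carrier V \<and>
     (\<forall>W. LinearCombinations.submodule K W V \<longrightarrow> v ` I \<subseteq> W \<longrightarrow> carrier V \<subseteq> W) \<and>
     (\<forall>i\<in>I. \<exists>l\<in>module_hom K V (base_module K). \<forall>j\<in>I. l (v j) = (if j = i then \<one>\<^bsub>K\<^esub> else \<zero>\<^bsub>K\<^esub>))"

context vectorspace
begin

lemma functional_kernel:
  assumes l: "l \<in> module_hom K V (base_module K)"
  shows "LinearCombinations.submodule K {x \<in> carrier V. l x = \<zero>\<^bsub>K\<^esub>} V"
proof (rule LinearCombinations.submodule.intro)
  have "l \<zero>\<^bsub>V\<^esub> \<in> carrier K" using module_hom_closed[OF l] by auto
  then have "l \<zero>\<^bsub>V\<^esub> = \<zero>\<^bsub>K\<^esub>" using module_hom_smult[OF l, of "\<zero>\<^bsub>K\<^esub>" "\<zero>\<^bsub>V\<^esub>"] by simp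
  then show "\<zero>\<^bsub>V\<^esub> \<in> {x \<in> carrier V. l x = \<zero>\<^bsub>K\<^esub>}" by simp
qed (use l in \<open>auto simp: module_hom_def module_axioms\<close>)

text \<open>Independence: the functional dual to \<open>i\<close> kills the span of the other
  vectors but not \<open>v i\<close>. Generation is phrased through submodules, so it applies
  directly to the span.\<close>

lemma dual_basis_dim:
  assumes db: "dual_basis K V I v" shows "fin_dim" "dim = card I"
proof -
  have fin: "finite I" and vc: "v \<in> I \<rightarrow> carrier V"
    and gen: "\<And>W. LinearCombinations.submodule K W V \<Longrightarrow> v ` I \<subseteq> W \<Longrightarrow> carrier V \<subseteq> W"
    and dual: "\<And>i. i \<in> I \<Longrightarrow> \<exists>l\<in>module_hom K V (base_module K). \<forall>j\<in>I. l (v j) = (if j = i then \<one>\<^bsub>K\<^esub> else \<zero>\<^bsub>K\<^esub>)"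
    using db unfolding dual_basis_def by blast+
  have U: "v ` I \<subseteq> carrier V" using vc by auto
  have inj: "inj_on v I"
  proof (rule inj_onI, rule ccontr)
    fix i j assume ij: "i \<in> I" "j \<in> I" "v i = v j" "i \<noteq> j"
    obtain l where "\<forall>j\<in>I. l (v j) = (if j = i then \<one>\<^bsub>K\<^esub> else \<zero>\<^bsub>K\<^esub>)" using dual[OF ij(1)] by blast
    then show False using ij one_not_zero by (metis (full_types))
  qed
  have "carrier V \<subseteq> span (v ` I)" using U by (intro gen span_is_submodule) (auto intro: span_mem)
  then have g: "gen_set (v ` I)" using span_is_subset2[OF U] by blast
  have "lin_indpt (v ` I)"
  proof
    assume "lin_dep (v ` I)"
    then obtain i where i: "i \<in> I" "v i \<in> span (v ` I - {v i})" using lindep_span[OF U] fin by auto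
    obtain l where l: "l \<in> module_hom K V (base_module K)" "\<forall>j\<in>I. l (v j) = (if j = i then \<one>\<^bsub>K\<^esub> else \<zero>\<^bsub>K\<^esub>)"
      using dual[OF i(1)] by blast
    have "v ` I - {v i} \<subseteq> {x \<in> carrier V. l x = \<zero>\<^bsub>K\<^esub>}" using l(2) vc by auto
    then have "span (v ` I - {v i}) \<subseteq> {x \<in> carrier V. l x = \<zero>\<^bsub>K\<^esub>}"
      using functional_kernel[OF l(1)] by (rule span_is_subset)
    then show False using i l(2) by auto
  qed
  then have b: "basis (v ` I)" using g U by (simp add: basis_def)
  show "fin_dim" unfolding fin_dim_def using g U fin by blast
  show "dim = card I" using dim_basis[OF _ b] fin card_image[OF inj] by simp
qed

lemma basis_dual_basis:
  assumes X: "finite X" "basis X" shows "dual_basis K V X (\<lambda>x. x)"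
  unfolding dual_basis_def
proof (intro conjI allI impI ballI)
  have Xc: "X \<subseteq> carrier V" and g: "gen_set X" using X by (auto simp: basis_def)
  show "finite X" by (rule X)
  show "(\<lambda>x. x) \<in> X \<rightarrow> carrier V" using Xc by auto
  fix W assume "LinearCombinations.submodule K W V" "(\<lambda>x. x) ` X \<subseteq> W"
  then have "span X \<subseteq> W" by (intro span_is_subset) auto
  then show "carrier V \<subseteq> W" using g by simp
next
  have Xc: "X \<subseteq> carrier V" using X by (auto simp: basis_def)
  fix i assume i: "i \<in> X"
  have ex: "\<exists>!a. a \<in> X \<rightarrow>\<^sub>E carrier K \<and> lincomb a X = y" if "y \<in> carrier V" for y
    using basis_criterion[OF X(1) Xc] X(2) that by blast
  define co where "co y = (THE a. a \<in> X \<rightarrow>\<^sub>E carrier K \<and> lincomb a X = y)" for y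
  have co: "co y \<in> X \<rightarrow>\<^sub>E carrier K" "lincomb (co y) X = y" if "y \<in> carrier V" for y
    using theI'[OF ex[OF that]] unfolding co_def by auto
  have uniq: "co y = a" if "a \<in> X \<rightarrow>\<^sub>E carrier K" "lincomb a X = y" "y \<in> carrier V" for a y
    using ex[OF that(3)] co[OF that(3)] that(1,2) by blast
  \<comment> \<open>Coordinates are unique only among functions extensional on \<open>X\<close>;
    sums and multiples of coordinate functions must be restricted before uniqueness applies.\<close>
  have lr: "lincomb (restrict a X) X = lincomb a X" if "a \<in> X \<rightarrow> carrier K" for a
    unfolding lincomb_def using that Xc by (intro M.add.finprod_cong') auto
  have "co (x \<oplus>\<^bsub>V\<^esub> y) i = co x i \<oplus>\<^bsub>K\<^esub> co y i" if x: "x \<in> carrier V" and y: "y \<in> carrier V" for x y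
  proof -
    have c: "co x \<in> X \<rightarrow> carrier K" "co y \<in> X \<rightarrow> carrier K" using co x y by (auto simp: PiE_iff)
    then have "lincomb (restrict (\<lambda>z. co x z \<oplus>\<^bsub>K\<^esub> co y z) X) X = x \<oplus>\<^bsub>V\<^esub> y"
      using lr[of "\<lambda>z. co x z \<oplus>\<^bsub>K\<^esub> co y z"] lincomb_sum[OF X(1) Xc c] co x y by (auto simp: Pi_iff)
    then have "co (x \<oplus>\<^bsub>V\<^esub> y) = restrict (\<lambda>z. co x z \<oplus>\<^bsub>K\<^esub> co y z) X"
      using c x y by (intro uniq) (auto simp: Pi_iff)
    then show ?thesis using i by simp
  qed
  moreover have "co (k \<odot>\<^bsub>V\<^esub> x) i = k \<otimes>\<^bsub>K\<^esub> co x i" if x: "x \<in> carrier V" and k: "k \<in> carrier K" for x k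
  proof -
    have c: "co x \<in> X \<rightarrow> carrier K" using co x by (auto simp: PiE_iff)
    then have "lincomb (restrict (\<lambda>z. k \<otimes>\<^bsub>K\<^esub> co x z) X) X = k \<odot>\<^bsub>V\<^esub> x"
      using lr[of "\<lambda>z. k \<otimes>\<^bsub>K\<^esub> co x z"] lincomb_smult[OF Xc c k] co x k by (auto simp: Pi_iff)
    then have "co (k \<odot>\<^bsub>V\<^esub> x) = restrict (\<lambda>z. k \<otimes>\<^bsub>K\<^esub> co x z) X"
      using c x k by (intro uniq) (auto simp: Pi_iff)
    then show ?thesis using i by simp
  qed
  moreover have "co x i \<in> carrier K" if "x \<in> carrier V" for x using co(1)[OF that] i by auto
  ultimately have "(\<lambda>x. co x i) \<in> module_hom K V (base_module K)" by (auto simp: module_hom_def)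
  moreover have "co j i = (if j = i then \<one>\<^bsub>K\<^esub> else \<zero>\<^bsub>K\<^esub>)" if j: "j \<in> X" for j
  proof -
    let ?a = "restrict (\<lambda>z. if j = z then \<one>\<^bsub>K\<^esub> else \<zero>\<^bsub>K\<^esub>) X"
    have "lincomb ?a X = (\<Oplus>\<^bsub>V\<^esub>z\<in>X. if j = z then z else \<zero>\<^bsub>V\<^esub>)"
      unfolding lincomb_def using Xc by (intro M.add.finprod_cong') (auto simp: subset_iff)
    also have "\<dots> = j" using j X(1) Xc by (intro M.add.finprod_singleton) auto
    finally have "co j = ?a" using j Xc by (intro uniq) auto
    then show ?thesis using i by simp
  qed
  ultimately show "\<exists>l\<in>module_hom K V (base_module K). \<forall>j\<in>X. l j = (if j = i then \<one>\<^bsub>K\<^esub> else \<zero>\<^bsub>K\<^esub>)"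
    by (intro bexI[of _ "\<lambda>x. co x i"]) auto
qed

lemma dual_basis_exists:
  assumes "fin_dim" shows "\<exists>X. dual_basis K V X (\<lambda>x. x) \<and> card X = dim"
  using finite_basis_exists[OF assms] basis_dual_basis dual_basis_dim(2) by metis

end

context tensor_product
begin

text \<open>Generation is obtained one tensor slot at a time. The dual functionals come from the
  universal property applied to the products \<open>l x m y\<close>.\<close>

lemma dual_basis_tensor:
  assumes a: "dual_basis K A I v" and b: "dual_basis K B J w"
  shows "dual_basis K T (I \<times> J) (\<lambda>(i, j). pt (v i) (w j))"
proof -
  have vc: "\<And>i. i \<in> I \<Longrightarrow> v i \<in> carrier A" and wc: "\<And>j. j \<in> J \<Longrightarrow> w j \<in> carrier B"
    and fin: "finite I" "finite J" using a b by (auto simp: dual_basis_def)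
  have "carrier T \<subseteq> W" if W: "LinearCombinations.submodule K W T" and g: "(\<lambda>(i, j). pt (v i) (w j)) ` (I \<times> J) \<subseteq> W" for W
  proof
    have Wc: "\<zero>\<^bsub>T\<^esub> \<in> W" "\<And>x y. x \<in> W \<Longrightarrow> y \<in> W \<Longrightarrow> x \<oplus>\<^bsub>T\<^esub> y \<in> W" "\<And>c x. c \<in> carrier K \<Longrightarrow> x \<in> W \<Longrightarrow> c \<odot>\<^bsub>T\<^esub> x \<in> W"
      using W by (auto simp: LinearCombinations.submodule_def)
    have 1: "pt a (w j) \<in> W" if j: "j \<in> J" and ac: "a \<in> carrier A" for a j
    proof -
      have "LinearCombinations.submodule K {a \<in> carrier A. pt a (w j) \<in> W} A"
        by (rule LinearCombinations.submodule.intro)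
          (use wc[OF j] Wc in \<open>auto simp: A.module_axioms pt_simps pt_zero\<close>)
      moreover have "v ` I \<subseteq> {a \<in> carrier A. pt a (w j) \<in> W}" using g j vc by auto
      ultimately show ?thesis using a ac unfolding dual_basis_def by blast
    qed
    have 2: "pt a b \<in> W" if ac: "a \<in> carrier A" and bc: "b \<in> carrier B" for a b
    proof -
      have "LinearCombinations.submodule K {b \<in> carrier B. pt a b \<in> W} B"
        by (rule LinearCombinations.submodule.intro)
          (use ac Wc in \<open>auto simp: B.module_axioms pt_simps pt_zero\<close>)
      moreover have "w ` J \<subseteq> {b \<in> carrier B. pt a b \<in> W}" using 1 ac wc by auto
      ultimately show ?thesis using b bc unfolding dual_basis_def by blast
    qed
    fix x assume "x \<in> carrier T"
    then show "x \<in> W" by (induction x rule: T_induct) (auto simp: Wc 2)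
  qed
  moreover have "\<exists>l\<in>module_hom K T (base_module K). \<forall>q\<in>I \<times> J. l (case q of (i, j) \<Rightarrow> pt (v i) (w j)) = (if q = r then \<one>\<^bsub>K\<^esub> else \<zero>\<^bsub>K\<^esub>)"
    if r: "r \<in> I \<times> J" for r
  proof -
    obtain i j where ij: "r = (i, j)" "i \<in> I" "j \<in> J" using r by auto
    obtain l where l: "l \<in> module_hom K A (base_module K)" "\<forall>i'\<in>I. l (v i') = (if i' = i then \<one>\<^bsub>K\<^esub> else \<zero>\<^bsub>K\<^esub>)"
      using a ij unfolding dual_basis_def by blast
    obtain m where m: "m \<in> module_hom K B (base_module K)" "\<forall>j'\<in>J. m (w j') = (if j' = j then \<one>\<^bsub>K\<^esub> else \<zero>\<^bsub>K\<^esub>)"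
      using b ij unfolding dual_basis_def by blast
    have lc: "\<And>x. x \<in> carrier A \<Longrightarrow> l x \<in> carrier K" and mc: "\<And>x. x \<in> carrier B \<Longrightarrow> m x \<in> carrier K"
      using module_hom_closed[OF l(1)] module_hom_closed[OF m(1)] by auto
    have "bilinear_map K A B (base_module K) (\<lambda>x y. l x \<otimes>\<^bsub>K\<^esub> m y)"
      using l(1) m(1) lc mc unfolding bilinear_map_def module_hom_def
      by (auto simp: A.R.l_distr A.R.r_distr A.R.m_assoc A.R.m_lcomm)
    then obtain \<Phi> where \<Phi>: "\<Phi> \<in> module_hom K T (base_module K)" "\<forall>a\<in>carrier A. \<forall>b\<in>carrier B. \<Phi> (pt a b) = l a \<otimes>\<^bsub>K\<^esub> m b"
      using T_lift[OF A.vectorspace_base_module] by blast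
    have "\<forall>q\<in>I \<times> J. \<Phi> (case q of (i, j) \<Rightarrow> pt (v i) (w j)) = (if q = r then \<one>\<^bsub>K\<^esub> else \<zero>\<^bsub>K\<^esub>)"
      using \<Phi>(2) l(2) m(2) vc wc ij by auto
    then show ?thesis using \<Phi>(1) by blast
  qed
  ultimately show ?thesis unfolding dual_basis_def using fin vc wc by (auto simp: pt_closed)
qed

end

section \<open>The polynomial X^p - X as a falling factorial modulo p\<close>

lemma int_poly_dvd_of_roots:
  fixes p :: nat and P :: "int poly"
  assumes p: "Factorial_Ring.prime p"
  shows "k \<le> p \<Longrightarrow> P = 0 \<or> Polynomial.degree P < k \<Longrightarrow> (\<And>i. i < k \<Longrightarrow> int p dvd poly P (int i)) \<Longrightarrow> [:int p:] dvd P"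
proof (induction k arbitrary: P)
  case 0
  then show ?case by simp
next
  case (Suc k)
  \<comment> \<open>The root \<open>k\<close> is split off over the integers, with remainder
    divisible by \<open>p\<close>. At the remaining points \<open>i\<close> the factor
    \<open>i - k\<close> is prime to \<open>p\<close>, since \<open>0 < k - i < p\<close>, so
    \<open>Q\<close> has the other roots modulo \<open>p\<close>.\<close>
  define Q where "Q = synthetic_div P (int k)"
  have PQ: "P = [:- int k, 1:] * Q + [:poly P (int k):]" using synthetic_div_correct'[of "int k" P] by (simp add: Q_def)
  have "int p dvd poly Q (int i)" if i: "i < k" for i
  proof -
    have "poly P (int i) = (int i - int k) * poly Q (int i) + poly P (int k)" by (subst PQ) (simp add: algebra_simps)
    then have "int p dvd (int i - int k) * poly Q (int i)"
      using Suc.prems(3)[of i] Suc.prems(3)[of k] i by (metis dvd_add_left_iff less_Suc_eq)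
    moreover have "\<not> int p dvd int i - int k"
    proof
      assume "int p dvd int i - int k"
      then have "int p dvd int k - int i" by (simp add: dvd_diff_commute)
      then show False using i Suc.prems(1) zdvd_imp_le[of "int p" "int k - int i"] by simp
    qed
    ultimately show ?thesis using p by (metis prime_dvd_mult_iff prime_nat_int_transfer)
  qed
  moreover have "Q = 0 \<or> Polynomial.degree Q < k"
  proof (cases "Polynomial.degree P = 0")
    case True
    then show ?thesis by (simp add: Q_def synthetic_div_eq_0_iff)
  next
    case False
    then show ?thesis using Suc.prems(2) by (auto simp: Q_def degree_synthetic_div)
  qed
  ultimately have "[:int p:] dvd Q" using Suc.IH Suc.prems(1) by simp
  moreover have "[:int p:] dvd [:poly P (int k):]" using Suc.prems(3)[of k] by simp
  ultimately show ?case by (subst PQ) (intro dvd_add dvd_mult)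
qed

definition falling_poly :: "nat \<Rightarrow> int poly" where
  "falling_poly k = (\<Prod>i<k. [:- int i, 1:])"

lemma falling_poly_Suc: "falling_poly (Suc k) = [:- int k, 1:] * falling_poly k"
  by (simp add: falling_poly_def mult.commute)

lemma falling_poly_monic: "lead_coeff (falling_poly k) = 1 \<and> Polynomial.degree (falling_poly k) = k"
proof (induction k)
  case (Suc k)
  then have "falling_poly k \<noteq> 0" by auto
  moreover have "lead_coeff ([:- int k, 1:] * falling_poly k) = 1" 
    unfolding lead_coeff_mult using Suc by (auto simp: Suc[THEN conjunct2])
  ultimately show ?case using Suc by (simp add: falling_poly_Suc degree_mult_eq del: mult_pCons_left)
qed (simp add: falling_poly_def)

text \<open>Both polynomials are monic of degree \<open>p\<close> and vanish modulo \<open>p\<close>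
  at 0, ..., p - 1, the second by Fermat. Their difference has smaller degree and so all its
  coefficients are divisible by \<open>p\<close>.\<close>

lemma falling_poly_prime:
  fixes p :: nat
  assumes p: "Factorial_Ring.prime p"
  shows "[:int p:] dvd falling_poly p - (Polynomial.monom 1 p - Polynomial.monom 1 1)"
proof (rule int_poly_dvd_of_roots[OF p order_refl])
  let ?D = "falling_poly p - (Polynomial.monom 1 p - Polynomial.monom 1 1)"
  have p2: "p \<ge> 2" using p prime_ge_2_nat by blast
  note m = falling_poly_monic[of p]
  have "Polynomial.degree ?D < p \<or> ?D = 0"
  proof -
    have "Polynomial.degree (falling_poly p - Polynomial.monom 1 p) < p \<or> falling_poly p - Polynomial.monom 1 p = 0"
    proof (rule disjCI)
      assume nz: "falling_poly p - Polynomial.monom 1 p \<noteq> 0"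
      have "Polynomial.coeff (falling_poly p - Polynomial.monom 1 p) p = 0" using m by (auto simp: m[THEN conjunct2])
      moreover have "Polynomial.degree (falling_poly p - Polynomial.monom 1 p) \<le> p"
        using m by (intro degree_diff_le) (auto simp: degree_monom_le)
      ultimately show "Polynomial.degree (falling_poly p - Polynomial.monom 1 p) < p"
        using nz by (metis le_neq_implies_less leading_coeff_0_iff)
    qed
    then have "Polynomial.degree (falling_poly p - Polynomial.monom 1 p) < p" using p2 by auto
    then have "Polynomial.degree (falling_poly p - Polynomial.monom 1 p + Polynomial.monom 1 1) < p"
      using p2 by (intro degree_add_less) (auto simp: degree_monom_eq)
    then show ?thesis by (simp add: algebra_simps)
  qed
  then show "?D = 0 \<or> Polynomial.degree ?D < p" by blast
  fix i assume i: "i < p"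
  have "poly (falling_poly p) (int i) = 0" unfolding falling_poly_def poly_prod using i by (intro prod_zero) auto
  then have e: "poly ?D (int i) = - (int i ^ p - int i)" by (simp add: poly_monom)
  have "int p dvd int i ^ p - int i"
  proof (cases "i = 0")
    case True
    then show ?thesis using p2 by (simp add: zero_power)
  next
    case False
    then have "\<not> p dvd i" using i by (auto dest: dvd_imp_le)
    then have "[i ^ (p - 1) = 1] (mod p)" using fermat_theorem[OF p] by blast
    then have "[i ^ (p - 1) * i = 1 * i] (mod p)" by (rule cong_mult) simp
    moreover have "i ^ (p - 1) * i = i ^ p" using p2 by (simp add: power_eq_if)
    ultimately have "[i ^ p = i] (mod p)" by simp
    then show ?thesis by (metis cong_iff_dvd_diff cong_int_iff of_nat_power)
  qed
  then show "int p dvd poly ?D (int i)" unfolding e by (simp only: dvd_minus_iff)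
qed

lemma (in field) characteristic_prime:
  assumes "has_characteristic R p" "p > 0" shows "Factorial_Ring.prime p"
proof -
  have ch: "\<And>n::nat. [n] \<cdot> \<one> = \<zero> \<longleftrightarrow> p dvd n" using assms by (simp add: has_characteristic_def)
  have "prime_elem p"
  proof (rule prime_elemI)
    show "p \<noteq> 0" using assms by simp
    show "\<not> is_unit p" using ch[of 1] by simp
    fix a b assume "p dvd a * b"
    then have "[(a * b)] \<cdot> \<one> = \<zero>" using ch by simp
    moreover have "[(a * b)] \<cdot> \<one> = [a] \<cdot> \<one> \<otimes> [b] \<cdot> \<one>"
      by (simp add: add_pow_ldistr add.nat_pow_pow mult.commute)
    ultimately have "[a] \<cdot> \<one> = \<zero> \<or> [b] \<cdot> \<one> = \<zero>" by (simp add: integral_iff)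
    then show "p dvd a \<or> p dvd b" using ch by simp
  qed
  then show ?thesis unfolding normalization_semidom_class.prime_def by simp
qed

section \<open>Eigenvectors of the derivation\<close>

locale AS_field = field E + diff_ring_p E \<delta> p for E (structure) and \<delta> p +
  assumes der_pow_p: "x \<in> carrier E \<Longrightarrow> (\<delta> ^^ p) x = \<delta> x"
    and der_nonzero: "\<exists>x\<in>carrier E. \<delta> x \<noteq> \<zero>"
begin

lemma der_uminus: "x \<in> carrier E \<Longrightarrow> \<delta> (\<ominus> x) = \<ominus> \<delta> x"
proof -
  assume x: "x \<in> carrier E"
  have "\<delta> (\<ominus> x) \<oplus> \<delta> x = \<zero>" using x der_add[of "\<ominus> x" x] by (simp add: l_neg)
  then show ?thesis using x minus_equality[of "\<delta> (\<ominus> x)" "\<delta> x"] by simp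
qed

lemma int_mult_zero [simp]: "x \<in> carrier E \<Longrightarrow> [(0::int)] \<cdot> x = \<zero>"
  by (simp add: add_pow_def int_pow_def2)

lemma int_mult_int: "[(int n)] \<cdot> x = [n] \<cdot> x"
  by (simp add: add_pow_def int_pow_int)

lemma der_pow_closed [simp]: "x \<in> carrier E \<Longrightarrow> (\<delta> ^^ i) x \<in> carrier E"
  by (induction i) auto

lemma der_int_pow: "x \<in> carrier E \<Longrightarrow> \<delta> ([(k::int)] \<cdot> x) = [k] \<cdot> \<delta> x"
  by (cases k rule: int_cases2) (auto simp: add.int_pow_neg der_uminus der_add_pow int_mult_int)

text \<open>\<open>P\<close> evaluated at the operator \<delta>. The sum is cut at a fixed
  \<open>n\<close> instead of the degree of \<open>P\<close>, which makes additivity in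
  \<open>P\<close> unconditional.\<close>

definition int_poly_op :: "nat \<Rightarrow> int poly \<Rightarrow> 'a \<Rightarrow> 'a" where
  "int_poly_op n P x = (\<Oplus>i\<in>{..n}. [(Polynomial.coeff P i)] \<cdot> (\<delta> ^^ i) x)"

lemma int_poly_op_closed [simp]: "x \<in> carrier E \<Longrightarrow> int_poly_op n P x \<in> carrier E"
  unfolding int_poly_op_def by (intro finsum_closed) auto

lemma int_poly_op_add: "x \<in> carrier E \<Longrightarrow> int_poly_op n (P + Q) x = int_poly_op n P x \<oplus> int_poly_op n Q x"
  unfolding int_poly_op_def by (subst finsum_addf[symmetric]) (auto simp: add.int_pow_mult)

lemma int_poly_op_smult: "x \<in> carrier E \<Longrightarrow> int_poly_op n (Polynomial.smult c P) x = [c] \<cdot> int_poly_op n P x"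
proof -
  assume x: "x \<in> carrier E"
  have "finite S \<Longrightarrow> (\<Oplus>i\<in>S. [(c * Polynomial.coeff P i)] \<cdot> (\<delta> ^^ i) x) = [c] \<cdot> (\<Oplus>i\<in>S. [(Polynomial.coeff P i)] \<cdot> (\<delta> ^^ i) x)" for S
    by (induction S rule: finite_induct)
       (use x in \<open>auto simp: add.int_pow_distrib add.int_pow_pow mult.commute Pi_iff\<close>)
  then show ?thesis by (simp add: int_poly_op_def)
qed

lemma int_poly_op_pCons: "x \<in> carrier E \<Longrightarrow> int_poly_op (Suc n) (pCons 0 P) x = \<delta> (int_poly_op n P x)"
proof -
  assume x: "x \<in> carrier E"
  have d: "finite S \<Longrightarrow> \<delta> (\<Oplus>i\<in>S. [(Polynomial.coeff P i)] \<cdot> (\<delta> ^^ i) x) = (\<Oplus>i\<in>S. [(Polynomial.coeff P i)] \<cdot> \<delta> ((\<delta> ^^ i) x))" for S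
    by (induction S rule: finite_induct) (use x in \<open>auto simp: der_add der_int_pow Pi_iff\<close>)
  show ?thesis unfolding int_poly_op_def using x by (subst finsum_Suc2) (auto simp: d)
qed

lemma int_poly_op_monom: "x \<in> carrier E \<Longrightarrow> i \<le> n \<Longrightarrow> int_poly_op n (Polynomial.monom 1 i) x = (\<delta> ^^ i) x"
proof -
  assume x: "x \<in> carrier E" and i: "i \<le> n"
  have "int_poly_op n (Polynomial.monom 1 i) x = (\<Oplus>j\<in>{..n}. if i = j then (\<delta> ^^ j) x else \<zero>)"
    unfolding int_poly_op_def using x by (intro add.finprod_cong') auto
  also have "\<dots> = (\<delta> ^^ i) x" using x i by (intro add.finprod_singleton) auto
  finally show ?thesis .
qed

lemma int_poly_op_Suc_le: "x \<in> carrier E \<Longrightarrow> Polynomial.degree P \<le> n \<Longrightarrow> int_poly_op (Suc n) P x = int_poly_op n P x"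
  unfolding int_poly_op_def by (subst finsum_Suc) (auto simp: Polynomial.coeff_eq_0)

text \<open>The operator \<open>(\<delta> - (k - 1)) ... (\<delta> - 1) \<delta>\<close>, i.e.
  \<open>falling_poly k\<close> evaluated at \<delta>.\<close>

primrec falling_op :: "nat \<Rightarrow> 'a \<Rightarrow> 'a" where
  "falling_op 0 x = x"
| "falling_op (Suc k) x = \<delta> (falling_op k x) \<ominus> [k] \<cdot> falling_op k x"

lemma falling_op_closed [simp]: "x \<in> carrier E \<Longrightarrow> falling_op k x \<in> carrier E"
  by (induction k) auto

lemma falling_op_int_poly_op: "x \<in> carrier E \<Longrightarrow> falling_op k x = int_poly_op k (falling_poly k) x"
proof (induction k)
  case 0
  then show ?case by (simp add: int_poly_op_def falling_poly_def)
next
  case (Suc k)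
  have "falling_poly (Suc k) = pCons 0 (falling_poly k) + Polynomial.smult (- int k) (falling_poly k)"
    by (simp add: falling_poly_Suc)
  then have "int_poly_op (Suc k) (falling_poly (Suc k)) x = \<delta> (int_poly_op k (falling_poly k) x) \<oplus> [(- int k)] \<cdot> int_poly_op (Suc k) (falling_poly k) x"
    using Suc by (simp add: int_poly_op_add int_poly_op_pCons int_poly_op_smult del: smult_minus_left)
  also have "int_poly_op (Suc k) (falling_poly k) x = int_poly_op k (falling_poly k) x"
    using Suc falling_poly_monic by (intro int_poly_op_Suc_le) auto
  finally show ?case using Suc by (simp add: minus_eq add.int_pow_neg int_mult_int)
qed

text \<open>Modulo \<open>p\<close> the operator is \<open>\<delta>^p - \<delta>\<close>, and
  multiples of \<open>p\<close> vanish on \<open>E\<close>.\<close>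

lemma falling_op_p: "x \<in> carrier E \<Longrightarrow> falling_op p x = \<zero>"
proof -
  assume x: "x \<in> carrier E"
  obtain Q where "falling_poly p - (Polynomial.monom 1 p - Polynomial.monom 1 1) = [:int p:] * Q"
    using falling_poly_prime[OF prime_p] by (elim dvdE)
  then have "falling_poly p = Polynomial.monom 1 p + Polynomial.smult (-1) (Polynomial.monom 1 1) + Polynomial.smult (int p) Q"
    by (simp add: algebra_simps)
  then have "falling_op p x = (\<delta> ^^ p) x \<oplus> [(-1::int)] \<cdot> ((\<delta> ^^ 1) x) \<oplus> [(int p)] \<cdot> int_poly_op p Q x"
    using x p_ge_2 by (simp add: falling_op_int_poly_op int_poly_op_add int_poly_op_smult int_poly_op_monom del: smult_minus_left One_nat_def)
  also have "[(int p)] \<cdot> int_poly_op p Q x = \<zero>" using x char_p[of "int_poly_op p Q x"] by (simp add: int_mult_int)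
  also have "[(-1::int)] \<cdot> ((\<delta> ^^ 1) x) = \<ominus> \<delta> x" using x add.int_pow_neg[of "\<delta> x" 1] by (simp add: int_mult_int)
  finally show ?thesis using x der_pow_p by (simp add: r_neg)
qed

text \<open>Start from \<open>x\<close> with \<delta> x nonzero. Among the iterates of
  \<open>falling_op\<close> on \<open>x\<close>, the last nonzero one, \<open>w\<close>, satisfies
  \<open>\<delta> w = k w\<close> with \<open>0 < k < p\<close>. By the Leibniz rule
  \<open>w^u\<close> has eigenvalue \<open>u k\<close>, and a suitable power has eigenvalue
  1.\<close>

lemma eigenvector_exists: "\<exists>e\<in>carrier E. e \<noteq> \<zero> \<and> \<delta> e = e"
proof -
  obtain x where x: "x \<in> carrier E" "\<delta> x \<noteq> \<zero>" using der_nonzero by blast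
  have d1: "falling_op 1 x \<noteq> \<zero>" using x by (simp add: minus_eq)
  define k where "k = (LEAST k. falling_op (Suc k) x = \<zero>)"
  obtain p' where p': "p = Suc p'" using p_ge_2 by (cases p) auto
  have k0: "falling_op (Suc k) x = \<zero>" unfolding k_def using falling_op_p[OF x(1)] p' by (intro LeastI[of "\<lambda>k. falling_op (Suc k) x = \<zero>" p']) simp
  have kp: "k \<le> p'" unfolding k_def using falling_op_p[OF x(1)] p' by (intro Least_le) simp
  have k1: "k \<noteq> 0" using k0 d1 by (metis One_nat_def)
  then obtain j where j: "k = Suc j" by (cases k) auto
  have wn: "falling_op k x \<noteq> \<zero>" using not_less_Least[of j "\<lambda>k. falling_op (Suc k) x = \<zero>"] j unfolding k_def by auto
  define w where "w = falling_op k x"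
  have w: "w \<in> carrier E" "w \<noteq> \<zero>" "\<delta> w = [k] \<cdot> w" using k0 wn x by (auto simp: w_def)
  have pow: "\<delta> (w [^] r) = [(r * k)] \<cdot> (w [^] r)" for r :: nat
  proof (induction r)
    case (Suc r)
    have "\<delta> (w [^] Suc r) = w [^] r \<otimes> [k] \<cdot> w \<oplus> ([(r * k)] \<cdot> (w [^] r)) \<otimes> w" using w Suc by (simp add: der_mult)
    also have "\<dots> = [k] \<cdot> (w [^] Suc r) \<oplus> [(r * k)] \<cdot> (w [^] Suc r)" using w by (simp add: add_pow_rdistr add_pow_ldistr)
    finally show ?case using w by (simp add: add.nat_pow_mult)
  qed simp
  have "\<not> p dvd k" using k1 kp p' by (auto dest: dvd_imp_le)
  then have "gcd k p = 1" using prime_p by (metis coprime_iff_gcd_eq_1 prime_imp_coprime gcd.commute)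
  \<comment> \<open>\<open>u\<close> is an inverse of \<open>k\<close> modulo
    \<open>p\<close>.\<close>
  moreover obtain u v where "k * u = p * v + gcd k p" using bezout_nat[of k p] k1 by auto
  ultimately have uv: "u * k = p * v + 1" by (simp add: mult.commute)
  define e where "e = w [^] u"
  have e: "e \<in> carrier E" using w by (simp add: e_def)
  have "\<delta> e = [(p * v + 1)] \<cdot> e" unfolding e_def pow uv ..
  also have "\<dots> = e" using e mult_p[of "p * v" e] by (simp add: add.nat_pow_mult[symmetric])
  finally have "\<delta> e = e" .
  moreover have "e \<noteq> \<zero>" unfolding e_def using w by (induction u) (auto simp: integral_iff)
  ultimately show ?thesis using e by blast
qed

end

lemma (in diff_algebra) petit_dual_basis:
  assumes f: "deg_below (Suc m) f" "f m = \<one>" "m > 0" and db: "dual_basis K B X v"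
  shows "dual_basis K (petit_algebra B \<delta> f) ({..<m} \<times> X) (\<lambda>(i, x). mon (v x) i)"
proof -
  let ?P = "petit_algebra B \<delta> f"
  note car = petit_carrier[OF f]
  have vc: "\<And>x. x \<in> X \<Longrightarrow> v x \<in> carrier B" and fin: "finite X" using db by (auto simp: dual_basis_def)
  have "carrier ?P \<subseteq> W" if W: "LinearCombinations.submodule K W ?P" and g: "(\<lambda>(i, x). mon (v x) i) ` ({..<m} \<times> X) \<subseteq> W" for W
  proof
    have Wc: "(\<lambda>n. \<zero>) \<in> W" "\<And>x y. x \<in> W \<Longrightarrow> y \<in> W \<Longrightarrow> (\<lambda>n. x n \<oplus> y n) \<in> W" "\<And>c x. c \<in> carrier K \<Longrightarrow> x \<in> W \<Longrightarrow> (\<lambda>n. c \<odot> x n) \<in> W"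
      using W by (auto simp: LinearCombinations.submodule_def petit_simps)
    have 1: "mon a i \<in> W" if i: "i < m" and a: "a \<in> carrier B" for a i
    proof -
      have "LinearCombinations.submodule K {a \<in> carrier B. mon a i \<in> W} B"
      proof (rule LinearCombinations.submodule.intro)
        fix c a assume "c \<in> carrier K" "a \<in> {a \<in> carrier B. mon a i \<in> W}"
        then show "c \<odot> a \<in> {a \<in> carrier B. mon a i \<in> W}" using Wc(3)[of c "mon a i"] by (simp add: mon_scale)
      qed (use Wc in \<open>auto simp: V.module_axioms mon_add\<close>)
      moreover have "v ` X \<subseteq> {a \<in> carrier B. mon a i \<in> W}" using g i vc by auto
      ultimately show ?thesis using db a unfolding dual_basis_def by blast
    qed
    have 2: "n \<le> m \<Longrightarrow> deg_below n h \<Longrightarrow> h \<in> W" for n h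
    proof (induction n arbitrary: h)
      case 0
      then show ?case using Wc by (simp add: deg_below_0)
    next
      case (Suc n)
      obtain g where gg: "deg_below n g" "h = (\<lambda>i. g i \<oplus> mon (h n) n i)" using deg_below_split Suc.prems by blast
      have "(\<lambda>i. g i \<oplus> mon (h n) n i) \<in> W"
        using Suc.IH[OF _ gg(1)] Suc.prems 1[of n "h n"] by (intro Wc(2)) auto
      then show ?case using gg(2) by simp
    qed
    fix x assume "x \<in> carrier ?P"
    then show "x \<in> W" using 2[of m] car by simp
  qed
  moreover have "\<exists>l\<in>module_hom K ?P (base_module K). \<forall>q\<in>{..<m} \<times> X. l (case q of (i, x) \<Rightarrow> mon (v x) i) = (if q = r then \<one>\<^bsub>K\<^esub> else \<zero>\<^bsub>K\<^esub>)"
    if r: "r \<in> {..<m} \<times> X" for r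
  proof -
    obtain i x where ix: "r = (i, x)" "i < m" "x \<in> X" using r by auto
    obtain l where l: "l \<in> module_hom K B (base_module K)" "\<forall>x'\<in>X. l (v x') = (if x' = x then \<one>\<^bsub>K\<^esub> else \<zero>\<^bsub>K\<^esub>)"
      using db ix unfolding dual_basis_def by blast
    have l0: "l \<zero> = \<zero>\<^bsub>K\<^esub>" using V.functional_kernel[OF l(1)] by (auto simp: LinearCombinations.submodule_def)
    have "(\<lambda>h. l (h i)) \<in> module_hom K ?P (base_module K)"
      using l(1) by (auto simp: module_hom_def petit_simps car Pi_iff)
    moreover have "\<forall>q\<in>{..<m} \<times> X. l ((case q of (i, x) \<Rightarrow> mon (v x) i) i) = (if q = r then \<one>\<^bsub>K\<^esub> else \<zero>\<^bsub>K\<^esub>)"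
      using l(2) l0 ix by (auto simp: mon_def)
    ultimately show ?thesis by (intro bexI[of _ "\<lambda>h. l (h i)"])
  qed
  moreover have "(\<lambda>(i, x). mon (v x) i) \<in> {..<m} \<times> X \<rightarrow> carrier ?P" using vc by (auto simp: car deg_below_mon)
  ultimately show ?thesis unfolding dual_basis_def using fin by blast
qed

section \<open>The degree of E over F\<close>

context AS_field
begin

lemma falling_op_add: "x \<in> carrier E \<Longrightarrow> y \<in> carrier E \<Longrightarrow> falling_op k (x \<oplus> y) = falling_op k x \<oplus> falling_op k y"
proof (induction k)
  case (Suc k)
  have "falling_op (Suc k) (x \<oplus> y) = (\<delta> (falling_op k x) \<oplus> \<delta> (falling_op k y)) \<oplus> (\<ominus> ([k] \<cdot> falling_op k x) \<oplus> \<ominus> ([k] \<cdot> falling_op k y))"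
    using Suc by (simp add: minus_eq der_add add.nat_pow_distrib minus_add)
  then show ?case using Suc by (simp add: minus_eq a_ac)
qed simp

lemma falling_op_smult: "c \<in> carrier E \<Longrightarrow> \<delta> c = \<zero> \<Longrightarrow> x \<in> carrier E \<Longrightarrow> falling_op k (c \<otimes> x) = c \<otimes> falling_op k x"
proof (induction k)
  case (Suc k)
  then show ?case by (simp add: minus_eq der_mult r_distr r_minus add_pow_rdistr)
qed simp

lemma falling_op_eigen:
  assumes e: "e \<in> carrier E" "\<delta> e = [j] \<cdot> e"
  shows "falling_op k e = [(\<Prod>i<k. j - i)] \<cdot> e"
proof (induction k)
  case (Suc k)
  let ?P = "\<Prod>i<k. j - i"
  have "falling_op (Suc k) e = [?P] \<cdot> ([j] \<cdot> e) \<ominus> [k] \<cdot> ([?P] \<cdot> e)" using e Suc by (simp add: der_add_pow)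
  also have "\<dots> = [(?P * (j - k))] \<cdot> e"
  proof (cases "k \<le> j")
    case True
    then have j: "[j] \<cdot> e = [(j - k)] \<cdot> e \<oplus> [k] \<cdot> e" using e by (simp add: add.nat_pow_mult)
    have "[?P] \<cdot> ([j] \<cdot> e) \<ominus> [k] \<cdot> ([?P] \<cdot> e) = [?P] \<cdot> ([(j - k)] \<cdot> e) \<oplus> [?P] \<cdot> ([k] \<cdot> e) \<ominus> [k] \<cdot> ([?P] \<cdot> e)"
      unfolding j using e by (simp add: add.nat_pow_distrib)
    also have "[?P] \<cdot> ([k] \<cdot> e) = [k] \<cdot> ([?P] \<cdot> e)" using e by (simp add: add.nat_pow_pow mult.commute)
    finally show ?thesis using e by (simp add: minus_eq a_assoc r_neg add.nat_pow_pow mult.commute)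
  next
    case False
    \<comment> \<open>For \<open>j < k\<close> the factor with \<open>i = j\<close> is zero, so
      truncated subtraction in the later factors is irrelevant.\<close>
    then have P0: "?P = 0" by auto
    show ?thesis unfolding P0 using e by (simp add: minus_eq)
  qed
  finally show ?case by simp
qed (use e in simp)

text \<open>Eigenspaces are lines over the constants: writing \<open>y = c z\<close>, the Leibniz
  rule leaves \<open>\<delta> c z = 0\<close>.\<close>

lemma eigen_quotient:
  assumes y: "y \<in> carrier E" "\<delta> y = [k] \<cdot> y" and z: "z \<in> carrier E" "z \<noteq> \<zero>" "\<delta> z = [(k::nat)] \<cdot> z"
  shows "\<exists>c\<in>carrier E. \<delta> c = \<zero> \<and> y = c \<otimes> z"
proof -
  have u: "z \<in> Units E" using z field_Units by simp
  define c where "c = y \<otimes> inv z"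
  have c: "c \<in> carrier E" "y = c \<otimes> z" using y z u by (auto simp: c_def m_assoc)
  have "[k] \<cdot> y = c \<otimes> [k] \<cdot> z \<oplus> \<delta> c \<otimes> z" using c y z der_mult[of c z] by simp
  also have "c \<otimes> [k] \<cdot> z = [k] \<cdot> y" using c z by (simp add: add_pow_rdistr)
  finally have "\<delta> c \<otimes> z = \<zero>" using c y z by (metis add.l_cancel_one' add.nat_pow_closed der_closed m_closed)
  then have "\<delta> c = \<zero>" using c z by (simp add: integral_iff)
  then show ?thesis using c by blast
qed

end

lemma self_algebra_simps [simp]:
  "carrier (self_algebra E) = carrier E" "monoid.mult (self_algebra E) = monoid.mult E" "\<one>\<^bsub>self_algebra E\<^esub> = \<one>\<^bsub>E\<^esub>"
  "\<zero>\<^bsub>self_algebra E\<^esub> = \<zero>\<^bsub>E\<^esub>" "add (self_algebra E) = add E" "module.smult (self_algebra E) = monoid.mult E"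
  by (simp_all add: self_algebra_def)

lemma (in ring) ring_self_algebra:
  fixes S :: "('k, 'a, 'o) module_scheme"
  assumes "carrier S = carrier R" "monoid.mult S = monoid.mult R" "\<one>\<^bsub>S\<^esub> = \<one>" "\<zero>\<^bsub>S\<^esub> = \<zero>" "add S = add R"
  shows "ring S"
proof (rule ringI)
  show "abelian_group S"
    by (rule abelian_groupI) (auto simp: assms a_ac intro: l_neg)
  show "monoid S" by (rule monoidI) (auto simp: assms m_assoc)
qed (auto simp: assms l_distr r_distr)

lemma nonassoc_self_algebra:
  fixes E :: "'e ring"
  assumes "field E" "subfield F E"
  shows "nonassoc_algebra (E\<lparr>carrier := F\<rparr>) (self_algebra E)"
proof -
  interpret field E by fact
  have F: "F \<subseteq> carrier E" using assms(2) by (simp add: subfieldE(3))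
  interpret S: ring "self_algebra E" by (rule ring_self_algebra) auto
  have fK: "field (E\<lparr>carrier := F\<rparr>)" using assms(2) subfield_iff(2) by blast
  then interpret K: field "E\<lparr>carrier := F\<rparr>" .
  have "module (E\<lparr>carrier := F\<rparr>) (self_algebra E)"
    by (rule moduleI[OF K.is_cring S.is_abelian_group])
       (use F in \<open>auto simp: subset_iff l_distr r_distr m_assoc\<close>)
  then have "vectorspace (E\<lparr>carrier := F\<rparr>) (self_algebra E)" using fK by (rule vectorspace.intro)
  then show ?thesis unfolding nonassoc_algebra_def
    using F by (auto simp: subset_iff l_distr r_distr m_assoc m_lcomm)
qed

text \<open>The basis is 1, e, ..., e^(p-1) for an eigenvector \<open>e\<close> of eigenvalue 1. The
  kernels of \<open>falling_op k\<close> filter \<open>E\<close>: each is spanned by the powers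
  below \<open>k\<close>, the power \<open>e^k\<close> lies outside it for \<open>k < p\<close>, and
  at \<open>k = p\<close> the kernel is everything.\<close>

lemma AS_field_dual_basis:
  fixes E :: "'e ring"
  assumes AS: "AS_field E \<delta> p" and F: "F = {a \<in> carrier E. \<delta> a = \<zero>\<^bsub>E\<^esub>}" "subfield F E"
  shows "\<exists>X. dual_basis (E\<lparr>carrier := F\<rparr>) (self_algebra E) X (\<lambda>x. x) \<and> card X = p"
proof -
  interpret AS_field E \<delta> p by (rule AS)
  define K where "K = E\<lparr>carrier := F\<rparr>"
  define EF where "EF = self_algebra E"
  have "nonassoc_algebra K EF" unfolding K_def EF_def using field_axioms F(2) by (rule nonassoc_self_algebra)
  then interpret V: vectorspace K EF by (simp add: nonassoc_algebra_def)
  have sim: "carrier EF = carrier E" "carrier K = F" "module.smult EF = monoid.mult E" "add EF = add E" "\<zero>\<^bsub>EF\<^esub> = \<zero>\<^bsub>E\<^esub>" "\<zero>\<^bsub>K\<^esub> = \<zero>\<^bsub>E\<^esub>"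
    by (simp_all add: EF_def K_def)
  obtain e where e: "e \<in> carrier E" "e \<noteq> \<zero>\<^bsub>E\<^esub>" "\<delta> e = e" using eigenvector_exists by blast
  define v where "v j = e [^]\<^bsub>E\<^esub> j" for j :: nat
  have vc: "v j \<in> carrier E" for j using e by (simp add: v_def)
  have v0: "v j \<noteq> \<zero>\<^bsub>E\<^esub>" for j unfolding v_def using e by (induction j) (auto simp: integral_iff)
  have dv: "\<delta> (v j) = [j] \<cdot>\<^bsub>E\<^esub> v j" for j
  proof (induction j)
    case (Suc j)
    have "\<delta> (v (Suc j)) = v j \<otimes>\<^bsub>E\<^esub> e \<oplus>\<^bsub>E\<^esub> ([j] \<cdot>\<^bsub>E\<^esub> v j) \<otimes>\<^bsub>E\<^esub> e" using e Suc vc[of j] by (simp add: v_def der_mult)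
    then show ?case using e vc[of j] by (simp add: v_def add_pow_ldistr a_comm)
  qed (simp add: v_def)
  have Dl: "j < k \<Longrightarrow> falling_op k (v j) = \<zero>\<^bsub>E\<^esub>" for j k
  proof -
    assume "j < k"
    then have P0: "(\<Prod>i<k. j - i) = 0" by auto
    show ?thesis using falling_op_eigen[OF vc dv, of k j] unfolding P0 by simp
  qed
  \<comment> \<open>The scaling factor is \<open>k!\<close>, a product of numbers between 1 and
    \<open>p - 1\<close>.\<close>
  have De: "k < p \<Longrightarrow> falling_op k (v k) \<noteq> \<zero>\<^bsub>E\<^esub>" for k
  proof -
    assume k: "k < p"
    have "m \<le> k \<Longrightarrow> [(\<Prod>i<m. k - i)] \<cdot>\<^bsub>E\<^esub> v k \<noteq> \<zero>\<^bsub>E\<^esub>" for m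
    proof (induction m)
      case (Suc m)
      have "[(\<Prod>i<Suc m. k - i)] \<cdot>\<^bsub>E\<^esub> v k = [(k - m)] \<cdot>\<^bsub>E\<^esub> ([(\<Prod>i<m. k - i)] \<cdot>\<^bsub>E\<^esub> v k)"
        using vc by (simp add: add.nat_pow_pow)
      moreover have "[(\<Prod>i<m. k - i)] \<cdot>\<^bsub>E\<^esub> v k \<noteq> \<zero>\<^bsub>E\<^esub>" using Suc by simp
      ultimately show ?case using Suc.prems k vc by (simp add: mult_p_nonzero)
    qed (use vc v0 in simp)
    then show ?thesis using falling_op_eigen[OF vc dv, of k k] by simp
  qed
  have sub: "LinearCombinations.submodule K {x \<in> carrier EF. falling_op k x = \<zero>\<^bsub>E\<^esub>} EF" for k
  proof (rule LinearCombinations.submodule.intro)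
    have "falling_op k \<zero>\<^bsub>E\<^esub> = \<zero>\<^bsub>E\<^esub>" by (induction k) (auto simp: minus_eq)
    then show "\<zero>\<^bsub>EF\<^esub> \<in> {x \<in> carrier EF. falling_op k x = \<zero>\<^bsub>E\<^esub>}" by (simp add: sim)
  qed (auto simp: sim V.module_axioms falling_op_add F(1) falling_op_smult simp del: falling_op.simps intro: V.module_axioms)
  have ind: "k \<le> p \<Longrightarrow> V.lin_indpt (v ` {..<k}) \<and> card (v ` {..<k}) = k" for k
  proof (induction k)
    case 0
    then show ?case by (simp add: V.lin_dep_def)
  next
    case (Suc k)
    have S: "v ` {..<k} \<subseteq> carrier EF" using vc by (auto simp: sim)
    have "v ` {..<k} \<subseteq> {x \<in> carrier EF. falling_op k x = \<zero>\<^bsub>E\<^esub>}" using vc Dl by (auto simp: sim)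
    then have "V.span (v ` {..<k}) \<subseteq> {x \<in> carrier EF. falling_op k x = \<zero>\<^bsub>E\<^esub>}" using sub by (rule V.span_is_subset)
    then have n: "v k \<notin> V.span (v ` {..<k})" using De[of k] Suc.prems by auto
    have n': "v k \<notin> v ` {..<k}" using n V.span_mem[OF S] by blast
    have "V.lin_indpt (v ` {..<k} \<union> {v k})"
      using V.lin_dep_iff_in_span[of "v ` {..<k}" "v k"] S n n' Suc vc by (auto simp: sim)
    moreover have "v ` {..<Suc k} = v ` {..<k} \<union> {v k}" by (auto simp: less_Suc_eq)
    moreover have "card (v ` {..<k} \<union> {v k}) = Suc k" using n' Suc by simp
    ultimately show ?case by simp
  qed
  have gen: "k \<le> p \<Longrightarrow> x \<in> carrier E \<Longrightarrow> falling_op k x = \<zero>\<^bsub>E\<^esub> \<Longrightarrow> x \<in> V.span (v ` {..<k})" for k x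
  proof (induction k arbitrary: x)
    case 0
    then show ?case using V.span_zero[of "v ` {..<0}"] by (simp add: sim)
  next
    case (Suc k)
    have S: "v ` {..<Suc k} \<subseteq> carrier EF" using vc by (auto simp: sim)
    have sm: "LinearCombinations.submodule K (V.span (v ` {..<Suc k})) EF" by (rule V.span_is_submodule[OF S])
    \<comment> \<open>Both \<open>falling_op k x\<close> and \<open>?z\<close> are eigenvectors for
      \<open>k\<close>, so they differ by a constant \<open>c\<close>. Subtracting
      \<open>c e^k\<close> from \<open>x\<close> lands in the kernel of \<open>falling_op k\<close>,
      where the induction hypothesis applies.\<close>
    let ?z = "falling_op k (v k)"
    have z: "?z \<in> carrier E" "?z \<noteq> \<zero>\<^bsub>E\<^esub>" "\<delta> ?z = [k] \<cdot>\<^bsub>E\<^esub> ?z"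
      using vc[of k] De[of k] Suc.prems Dl[of k "Suc k"] by auto
    have y: "falling_op k x \<in> carrier E" "\<delta> (falling_op k x) = [k] \<cdot>\<^bsub>E\<^esub> falling_op k x" using Suc.prems by auto
    obtain c where c: "c \<in> carrier E" "\<delta> c = \<zero>\<^bsub>E\<^esub>" "falling_op k x = c \<otimes>\<^bsub>E\<^esub> ?z" using eigen_quotient[OF y z] by blast
    have cv: "c \<otimes>\<^bsub>E\<^esub> v k \<in> V.span (v ` {..<Suc k})"
    proof -
      have "v k \<in> V.span (v ` {..<Suc k})" using V.span_mem[OF S] by simp
      then show ?thesis using sm c by (auto simp: LinearCombinations.submodule_def sim F(1))
    qed
    define x' where "x' = x \<ominus>\<^bsub>E\<^esub> c \<otimes>\<^bsub>E\<^esub> v k"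
    have x': "x' \<in> carrier E" using Suc.prems c vc by (simp add: x'_def)
    have xx: "x = x' \<oplus>\<^bsub>E\<^esub> c \<otimes>\<^bsub>E\<^esub> v k" using Suc.prems c vc by (simp add: x'_def minus_eq a_assoc l_neg)
    then have "falling_op k x = falling_op k x' \<oplus>\<^bsub>E\<^esub> c \<otimes>\<^bsub>E\<^esub> ?z" using x' c vc by (simp add: falling_op_add falling_op_smult)
    then have "falling_op k x' = \<zero>\<^bsub>E\<^esub>" using c(3) x' c(1) z(1) by (metis add.r_cancel_one falling_op_closed m_closed)
    then have "x' \<in> V.span (v ` {..<k})" using Suc.IH x' Suc.prems by simp
    moreover have "V.span (v ` {..<k}) \<subseteq> V.span (v ` {..<Suc k})"
      using V.span_mem[OF S] by (intro V.span_is_subset[OF _ sm]) auto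
    ultimately have "x' \<in> V.span (v ` {..<Suc k})" by blast
    then have "x' \<oplus>\<^bsub>E\<^esub> c \<otimes>\<^bsub>E\<^esub> v k \<in> V.span (v ` {..<Suc k})" using sm cv by (simp add: LinearCombinations.submodule_def sim)
    then show ?case using xx by simp
  qed
  have S: "v ` {..<p} \<subseteq> carrier EF" using vc by (auto simp: sim)
  have "carrier EF \<subseteq> V.span (v ` {..<p})" using gen[of p] falling_op_p by (auto simp: sim)
  then have "V.basis (v ` {..<p})" using ind[of p] S V.span_is_subset2[OF S] by (auto simp: V.basis_def)
  then have "dual_basis K EF (v ` {..<p}) (\<lambda>x. x)" by (intro V.basis_dual_basis) auto
  then show ?thesis using ind[of p] unfolding K_def EF_def by blast
qed

section \<open>Division algebras and automorphism groups\<close>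

text \<open>The image of a basis is independent, since a relation pulls back along the injective
  map, and has \<open>dim\<close> elements, so it is a basis again.\<close>

lemma (in vectorspace) injective_endo_surjective:
  assumes fd: "fin_dim" and h: "h \<in> module_hom K V V" and inj: "inj_on h (carrier V)"
  shows "h ` carrier V = carrier V"
proof -
  have hc: "\<And>x. x \<in> carrier V \<Longrightarrow> h x \<in> carrier V" using module_hom_closed[OF h] by auto
  have h0: "h \<zero>\<^bsub>V\<^esub> = \<zero>\<^bsub>V\<^esub>" using module_hom_smult[OF h, of "\<zero>\<^bsub>K\<^esub>" "\<zero>\<^bsub>V\<^esub>"] hc[of "\<zero>\<^bsub>V\<^esub>"] by simp
  have im: "LinearCombinations.submodule K (h ` W) V" if W: "LinearCombinations.submodule K W V" for W
  proof -
    have Wc: "\<zero>\<^bsub>V\<^esub> \<in> W" "W \<subseteq> carrier V" "\<And>x y. x \<in> W \<Longrightarrow> y \<in> W \<Longrightarrow> x \<oplus>\<^bsub>V\<^esub> y \<in> W" "\<And>c x. c \<in> carrier K \<Longrightarrow> x \<in> W \<Longrightarrow> c \<odot>\<^bsub>V\<^esub> x \<in> W"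
      using W by (auto simp: LinearCombinations.submodule_def)
    show ?thesis
    proof (rule LinearCombinations.submodule.intro)
      show "module K V" by (rule module_axioms)
      show "h ` W \<subseteq> carrier V" using hc Wc by auto
      show "\<zero>\<^bsub>V\<^esub> \<in> h ` W" using h0 Wc by (metis image_eqI)
      show "v \<oplus>\<^bsub>V\<^esub> w \<in> h ` W" if vw: "v \<in> h ` W" "w \<in> h ` W" for v w
      proof -
        obtain x y where xy: "x \<in> W" "y \<in> W" "v = h x" "w = h y" using vw by auto
        then have "v \<oplus>\<^bsub>V\<^esub> w = h (x \<oplus>\<^bsub>V\<^esub> y)" using module_hom_add[OF h] Wc by (simp add: subset_iff)
        then show ?thesis using xy Wc(3) by simp
      qed
      show "c \<odot>\<^bsub>V\<^esub> v \<in> h ` W" if cv: "c \<in> carrier K" "v \<in> h ` W" for c v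
      proof -
        obtain x where x: "x \<in> W" "v = h x" using cv by auto
        then have "c \<odot>\<^bsub>V\<^esub> v = h (c \<odot>\<^bsub>V\<^esub> x)" using module_hom_smult[OF h] Wc cv by (simp add: subset_iff)
        then show ?thesis using x cv Wc(4) by simp
      qed
    qed
  qed
  obtain X where X: "finite X" "basis X" using finite_basis_exists[OF fd] by blast
  have Xc: "X \<subseteq> carrier V" using X by (simp add: basis_def)
  have hX: "h ` X \<subseteq> carrier V" "finite (h ` X)" using Xc hc X by auto
  have injX: "inj_on h X" using inj Xc by (rule inj_on_subset)
  have "lin_indpt (h ` X)"
  proof
    assume "lin_dep (h ` X)"
    then obtain u where u: "u \<in> X" "h u \<in> span (h ` X - {h u})" using lindep_span[OF hX] by auto
    have c: "X - {u} \<subseteq> carrier V" using Xc by auto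
    have "h ` X - {h u} \<subseteq> h ` span (X - {u})" using span_mem[OF c] by auto
    then have "span (h ` X - {h u}) \<subseteq> h ` span (X - {u})" using im[OF span_is_submodule[OF c]] by (rule span_is_subset)
    then obtain y where y: "y \<in> span (X - {u})" "h u = h y" using u by auto
    have "y \<in> carrier V" using y span_is_subset2[OF c] by auto
    then have "u = y" using inj y u Xc by (auto simp: inj_on_def)
    then have "lin_dep X" using lindep_span[OF Xc X(1)] u y by auto
    then show False using X by (simp add: basis_def)
  qed
  moreover have "card (h ` X) = dim" using card_image[OF injX] dim_basis[OF X] by simp
  ultimately have "basis (h ` X)" using dim_li_is_basis fd hX by auto
  then have "carrier V = span (h ` X)" by (simp add: basis_def)
  moreover have "LinearCombinations.submodule K (carrier V) V"
    by (rule LinearCombinations.submodule.intro) (auto intro: module_axioms)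
  then have "span (h ` X) \<subseteq> h ` carrier V" using Xc by (intro span_is_subset im) auto
  ultimately show ?thesis using hc by auto
qed

lemma nonassoc_algebraD:
  assumes "nonassoc_algebra K A"
  shows "vectorspace K A" "\<And>x y. x \<in> carrier A \<Longrightarrow> y \<in> carrier A \<Longrightarrow> x \<otimes>\<^bsub>A\<^esub> y \<in> carrier A"
    "\<And>x y z. \<lbrakk>x \<in> carrier A; y \<in> carrier A; z \<in> carrier A\<rbrakk> \<Longrightarrow> (x \<oplus>\<^bsub>A\<^esub> y) \<otimes>\<^bsub>A\<^esub> z = (x \<otimes>\<^bsub>A\<^esub> z) \<oplus>\<^bsub>A\<^esub> (y \<otimes>\<^bsub>A\<^esub> z)"
    "\<And>x y z. \<lbrakk>x \<in> carrier A; y \<in> carrier A; z \<in> carrier A\<rbrakk> \<Longrightarrow> z \<otimes>\<^bsub>A\<^esub> (x \<oplus>\<^bsub>A\<^esub> y) = (z \<otimes>\<^bsub>A\<^esub> x) \<oplus>\<^bsub>A\<^esub> (z \<otimes>\<^bsub>A\<^esub> y)"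
    "\<And>c x y. \<lbrakk>c \<in> carrier K; x \<in> carrier A; y \<in> carrier A\<rbrakk> \<Longrightarrow> (c \<odot>\<^bsub>A\<^esub> x) \<otimes>\<^bsub>A\<^esub> y = c \<odot>\<^bsub>A\<^esub> (x \<otimes>\<^bsub>A\<^esub> y)"
    "\<And>c x y. \<lbrakk>c \<in> carrier K; x \<in> carrier A; y \<in> carrier A\<rbrakk> \<Longrightarrow> x \<otimes>\<^bsub>A\<^esub> (c \<odot>\<^bsub>A\<^esub> y) = c \<odot>\<^bsub>A\<^esub> (x \<otimes>\<^bsub>A\<^esub> y)"
  using assms unfolding nonassoc_algebra_def by blast+

text \<open>Multiplications are linear, so absence of zero divisors is their injectivity; finite
  dimension upgrades this to bijectivity without associativity.\<close>

lemma division_algebra_iff_no_zero_divisors: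
  assumes A: "nonassoc_algebra K A" and fd: "vectorspace.fin_dim K A" and nz: "carrier A \<noteq> {\<zero>\<^bsub>A\<^esub>}"
  shows "division_algebra K A \<longleftrightarrow>
    (\<forall>x\<in>carrier A. \<forall>y\<in>carrier A. x \<otimes>\<^bsub>A\<^esub> y = \<zero>\<^bsub>A\<^esub> \<longrightarrow> x = \<zero>\<^bsub>A\<^esub> \<or> y = \<zero>\<^bsub>A\<^esub>)"
proof -
  note a = nonassoc_algebraD[OF A]
  interpret V: vectorspace K A by (rule a(1))
  have z: "x \<otimes>\<^bsub>A\<^esub> \<zero>\<^bsub>A\<^esub> = \<zero>\<^bsub>A\<^esub>" "\<zero>\<^bsub>A\<^esub> \<otimes>\<^bsub>A\<^esub> x = \<zero>\<^bsub>A\<^esub>" if x: "x \<in> carrier A" for x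
    using a(6)[of "\<zero>\<^bsub>K\<^esub>" x "\<zero>\<^bsub>A\<^esub>"] a(5)[of "\<zero>\<^bsub>K\<^esub>" "\<zero>\<^bsub>A\<^esub>" x] a(2)[of x "\<zero>\<^bsub>A\<^esub>"] a(2)[of "\<zero>\<^bsub>A\<^esub>" x] x by simp_all
  have hom: "(\<lambda>y. x \<otimes>\<^bsub>A\<^esub> y) \<in> module_hom K A A" "(\<lambda>y. y \<otimes>\<^bsub>A\<^esub> x) \<in> module_hom K A A" if "x \<in> carrier A" for x
    using that a by (auto simp: module_hom_def)
  have inj: "inj_on h (carrier A)" if h: "h \<in> module_hom K A A" "\<And>y. y \<in> carrier A \<Longrightarrow> h y = \<zero>\<^bsub>A\<^esub> \<Longrightarrow> y = \<zero>\<^bsub>A\<^esub>" for h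
  proof (rule inj_onI)
    fix x y assume xy: "x \<in> carrier A" "y \<in> carrier A" "h x = h y"
    have hy: "h y \<in> carrier A" using module_hom_closed[OF h(1)] xy by auto
    have e: "x = (x \<ominus>\<^bsub>A\<^esub> y) \<oplus>\<^bsub>A\<^esub> y" using xy by (simp add: V.M.minus_eq V.M.a_assoc V.M.l_neg)
    have hc: "h (x \<ominus>\<^bsub>A\<^esub> y) \<in> carrier A" using module_hom_closed[OF h(1)] xy by auto
    have "h y = h (x \<ominus>\<^bsub>A\<^esub> y) \<oplus>\<^bsub>A\<^esub> h y"
      using module_hom_add[OF h(1), of "x \<ominus>\<^bsub>A\<^esub> y" y] xy e by simp
    then have "h (x \<ominus>\<^bsub>A\<^esub> y) = \<zero>\<^bsub>A\<^esub>" using hc hy V.M.add.r_cancel_one'[of "h y" "h (x \<ominus>\<^bsub>A\<^esub> y)"] by simp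
    then have "x \<ominus>\<^bsub>A\<^esub> y = \<zero>\<^bsub>A\<^esub>" using h(2) xy by simp
    then show "x = y" using xy e by simp
  qed
  show ?thesis
  proof
    assume d: "division_algebra K A"
    show "\<forall>x\<in>carrier A. \<forall>y\<in>carrier A. x \<otimes>\<^bsub>A\<^esub> y = \<zero>\<^bsub>A\<^esub> \<longrightarrow> x = \<zero>\<^bsub>A\<^esub> \<or> y = \<zero>\<^bsub>A\<^esub>"
    proof (intro ballI impI disjCI)
      fix x y assume xy: "x \<in> carrier A" "y \<in> carrier A" "x \<otimes>\<^bsub>A\<^esub> y = \<zero>\<^bsub>A\<^esub>" "y \<noteq> \<zero>\<^bsub>A\<^esub>"
      then have "inj_on (\<lambda>x. x \<otimes>\<^bsub>A\<^esub> y) (carrier A)" using d by (auto simp: division_algebra_def bij_betw_def)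
      then show "x = \<zero>\<^bsub>A\<^esub>" using xy z by (auto simp: inj_on_def)
    qed
  next
    assume n: "\<forall>x\<in>carrier A. \<forall>y\<in>carrier A. x \<otimes>\<^bsub>A\<^esub> y = \<zero>\<^bsub>A\<^esub> \<longrightarrow> x = \<zero>\<^bsub>A\<^esub> \<or> y = \<zero>\<^bsub>A\<^esub>"
    have "bij_betw (\<lambda>y. x \<otimes>\<^bsub>A\<^esub> y) (carrier A) (carrier A) \<and> bij_betw (\<lambda>y. y \<otimes>\<^bsub>A\<^esub> x) (carrier A) (carrier A)"
      if x: "x \<in> carrier A" "x \<noteq> \<zero>\<^bsub>A\<^esub>" for x
    proof -
      have i: "inj_on (\<lambda>y. x \<otimes>\<^bsub>A\<^esub> y) (carrier A)" "inj_on (\<lambda>y. y \<otimes>\<^bsub>A\<^esub> x) (carrier A)"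
        using inj[OF hom(1)[OF x(1)]] inj[OF hom(2)[OF x(1)]] n x by auto
      show ?thesis unfolding bij_betw_def
        using i V.injective_endo_surjective[OF fd hom(1)[OF x(1)] i(1)] V.injective_endo_surjective[OF fd hom(2)[OF x(1)] i(2)]
        by simp
    qed
    then show "division_algebra K A" unfolding division_algebra_def using A nz by simp
  qed
qed

text \<open>Associativity is additive in each argument, and is extended from pure tensors one
  argument at a time.\<close>

lemma (in tensor_product) ring_T:
  assumes A: "ring A" and B: "ring B" shows "ring T"
proof -
  interpret rA: ring A by fact
  interpret rB: ring B by fact
  note t = nonassoc_algebraD[OF T_nonassoc]
  have assoc1: "(pt a b \<otimes>\<^bsub>T\<^esub> pt a' b') \<otimes>\<^bsub>T\<^esub> z = pt a b \<otimes>\<^bsub>T\<^esub> (pt a' b' \<otimes>\<^bsub>T\<^esub> z)"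
    if "a \<in> carrier A" "a' \<in> carrier A" "b \<in> carrier B" "b' \<in> carrier B" and z: "z \<in> carrier T" for a a' b b' z
    using z by (induction z rule: T_induct) (use that in \<open>auto simp: t pt_closed pt_mult rA.m_assoc rB.m_assoc\<close>)
  have assoc2: "(pt a b \<otimes>\<^bsub>T\<^esub> y) \<otimes>\<^bsub>T\<^esub> z = pt a b \<otimes>\<^bsub>T\<^esub> (y \<otimes>\<^bsub>T\<^esub> z)"
    if "a \<in> carrier A" "b \<in> carrier B" and y: "y \<in> carrier T" and z: "z \<in> carrier T" for a b y z
    using y by (induction y rule: T_induct) (use that in \<open>auto simp: t pt_closed assoc1\<close>)
  have assoc: "(x \<otimes>\<^bsub>T\<^esub> y) \<otimes>\<^bsub>T\<^esub> z = x \<otimes>\<^bsub>T\<^esub> (y \<otimes>\<^bsub>T\<^esub> z)"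
    if x: "x \<in> carrier T" and y: "y \<in> carrier T" and z: "z \<in> carrier T" for x y z
    using x by (induction x rule: T_induct) (use that in \<open>auto simp: t assoc2\<close>)
  have one: "\<one>\<^bsub>T\<^esub> \<otimes>\<^bsub>T\<^esub> x = x" "x \<otimes>\<^bsub>T\<^esub> \<one>\<^bsub>T\<^esub> = x" if x: "x \<in> carrier T" for x
    unfolding T_one_pt using x by (induction x rule: T_induct) (auto simp: t pt_closed pt_mult)
  show ?thesis
  proof (rule ringI)
    show "abelian_group T" by (rule T.M.abelian_group_axioms)
    show "monoid T" by (rule monoidI) (auto simp: t assoc one, auto simp: T_one_pt pt_closed)
  qed (auto simp: t)
qed

lemma algebra_iso_self_iff:
  "h \<in> algebra_iso K A A \<longleftrightarrow> bij_betw h (carrier A) (carrier A) \<and> h \<one>\<^bsub>A\<^esub> = \<one>\<^bsub>A\<^esub> \<and>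
     (\<forall>x\<in>carrier A. \<forall>y\<in>carrier A. h (x \<otimes>\<^bsub>A\<^esub> y) = h x \<otimes>\<^bsub>A\<^esub> h y \<and> h (x \<oplus>\<^bsub>A\<^esub> y) = h x \<oplus>\<^bsub>A\<^esub> h y) \<and>
     (\<forall>c\<in>carrier K. \<forall>x\<in>carrier A. h (c \<odot>\<^bsub>A\<^esub> x) = c \<odot>\<^bsub>A\<^esub> h x)"
  unfolding algebra_iso_def ring_iso_def ring_hom_def by (auto simp: bij_betw_def)

text \<open>Obtained as a subgroup of all extensional bijections; its inverse is the restricted
  inverse map, which again respects the operations.\<close>

lemma group_algebra_Aut:
  assumes A: "nonassoc_algebra K A" and one: "\<one>\<^bsub>A\<^esub> \<in> carrier A"
  shows "group (algebra_Aut K A)"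
proof -
  note a = nonassoc_algebraD[OF A]
  interpret V: vectorspace K A by (rule a(1))
  have "subgroup (algebra_iso K A A \<inter> Bij (carrier A)) (BijGroup (carrier A))"
  proof (rule subgroup.intro)
    show "algebra_iso K A A \<inter> Bij (carrier A) \<subseteq> carrier (BijGroup (carrier A))" by (auto simp: BijGroup_def)
    show "\<one>\<^bsub>BijGroup (carrier A)\<^esub> \<in> algebra_iso K A A \<inter> Bij (carrier A)"
      using id_Bij[of "carrier A"] a one by (auto simp: BijGroup_def algebra_iso_self_iff Bij_def)
    fix g assume g: "g \<in> algebra_iso K A A \<inter> Bij (carrier A)"
    then have gb: "g \<in> Bij (carrier A)" and gbb: "bij_betw g (carrier A) (carrier A)" by (auto simp: Bij_def)
    {
      fix h assume h: "h \<in> algebra_iso K A A \<inter> Bij (carrier A)"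
      then have hb: "h \<in> Bij (carrier A)" and hc: "\<And>x. x \<in> carrier A \<Longrightarrow> h x \<in> carrier A"
        by (auto simp: Bij_def bij_betw_def)
      have "compose (carrier A) g h \<in> Bij (carrier A)" using gb hb by (rule compose_Bij)
      moreover have "compose (carrier A) g h \<in> algebra_iso K A A"
        using calculation g h hc a one by (auto simp: algebra_iso_self_iff Bij_def compose_def)
      ultimately show "g \<otimes>\<^bsub>BijGroup (carrier A)\<^esub> h \<in> algebra_iso K A A \<inter> Bij (carrier A)"
        using gb hb by (simp add: BijGroup_def)
    }
    let ?i = "restrict (inv_into (carrier A) g) (carrier A)"
    have ib: "?i \<in> Bij (carrier A)" using gb by (rule restrict_inv_into_Bij)
    have ic: "\<And>x. x \<in> carrier A \<Longrightarrow> inv_into (carrier A) g x \<in> carrier A" using Bij_inv_into_mem[OF gb] .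
    have gi: "\<And>x. x \<in> carrier A \<Longrightarrow> g (inv_into (carrier A) g x) = x" using gbb by (simp add: bij_betw_inv_into_right)
    have ig: "\<And>x y. x \<in> carrier A \<Longrightarrow> g x = y \<Longrightarrow> inv_into (carrier A) g y = x" using gbb by (auto simp: bij_betw_inv_into_left)
    have gh: "g \<one>\<^bsub>A\<^esub> = \<one>\<^bsub>A\<^esub>" "\<And>x y. x \<in> carrier A \<Longrightarrow> y \<in> carrier A \<Longrightarrow> g (x \<otimes>\<^bsub>A\<^esub> y) = g x \<otimes>\<^bsub>A\<^esub> g y"
      "\<And>x y. x \<in> carrier A \<Longrightarrow> y \<in> carrier A \<Longrightarrow> g (x \<oplus>\<^bsub>A\<^esub> y) = g x \<oplus>\<^bsub>A\<^esub> g y"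
      "\<And>c x. c \<in> carrier K \<Longrightarrow> x \<in> carrier A \<Longrightarrow> g (c \<odot>\<^bsub>A\<^esub> x) = c \<odot>\<^bsub>A\<^esub> g x"
      using g by (auto simp: algebra_iso_self_iff)
    have "inv_into (carrier A) g \<one>\<^bsub>A\<^esub> = \<one>\<^bsub>A\<^esub>" using one gh(1) by (rule ig)
    moreover have "inv_into (carrier A) g (x \<otimes>\<^bsub>A\<^esub> y) = inv_into (carrier A) g x \<otimes>\<^bsub>A\<^esub> inv_into (carrier A) g y"
      "inv_into (carrier A) g (x \<oplus>\<^bsub>A\<^esub> y) = inv_into (carrier A) g x \<oplus>\<^bsub>A\<^esub> inv_into (carrier A) g y"
      if "x \<in> carrier A" "y \<in> carrier A" for x y
      using that a ic by (auto intro!: ig simp: gh gi)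
    moreover have "inv_into (carrier A) g (c \<odot>\<^bsub>A\<^esub> x) = c \<odot>\<^bsub>A\<^esub> inv_into (carrier A) g x"
      if "c \<in> carrier K" "x \<in> carrier A" for c x
      using that ic by (auto intro!: ig simp: gh gi)
    ultimately have "?i \<in> algebra_iso K A A" using ib a one by (auto simp: algebra_iso_self_iff Bij_def)
    then show "inv\<^bsub>BijGroup (carrier A)\<^esub> g \<in> algebra_iso K A A \<inter> Bij (carrier A)"
      using ib inv_BijGroup[OF gb] by simp
  qed
  then show ?thesis unfolding algebra_Aut_def using group_BijGroup by (rule subgroup.subgroup_is_group)
qed

lemma (in vectorspace) add_pow_eq_smult:
  "x \<in> carrier V \<Longrightarrow> [(n::nat)] \<cdot>\<^bsub>V\<^esub> x = ([n] \<cdot>\<^bsub>K\<^esub> \<one>\<^bsub>K\<^esub>) \<odot>\<^bsub>V\<^esub> x"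
  by (induction n) (auto simp: smult_l_distr)

section \<open>The isomorphism and the automorphism\<close>

text \<open>The constructed algebras are variables tied to their meaning by equations, so that the
  nested tensor and Petit constructions stay folded in goals.\<close>

locale AS_tensor =
  fixes E :: "'e ring" and F :: "'e set" and p :: nat and \<delta> :: "'e \<Rightarrow> 'e"
    and D :: "('e, 'd) module" and d :: 'e
    and \<delta>' :: "('d \<times> 'e \<Rightarrow> 'e) set \<Rightarrow> ('d \<times> 'e \<Rightarrow> 'e) set"
    and K :: "'e ring" and EF :: "('e, 'e) module"
    and DE :: "('e, ('d \<times> 'e \<Rightarrow> 'e) set) module"
    and S :: "('e, nat \<Rightarrow> 'e) module"
    and T :: "('e, ((nat \<Rightarrow> 'e) \<times> 'd \<Rightarrow> 'e) set) module"
    and P :: "('e, nat \<Rightarrow> ('d \<times> 'e \<Rightarrow> 'e) set) module"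
    and dE :: "('d \<times> 'e \<Rightarrow> 'e) set"
  assumes AS: "AS_field E \<delta> p" and subfield_F: "subfield F E"
    and F_def: "F = {a \<in> carrier E. \<delta> a = \<zero>\<^bsub>E\<^esub>}"
    and K_def: "K = E\<lparr>carrier := F\<rparr>" and EF_def: "EF = self_algebra E"
    and ring_D: "ring D" and algebra_D: "nonassoc_algebra K D" and fin_dim_D: "vectorspace.fin_dim K D"
    and DE_def: "DE = tensor_algebra K D EF"
    and DE_division: "division_algebra K DE"
    and der': "derivation DE \<delta>'"
    and ext_E: "\<And>a. a \<in> carrier E \<Longrightarrow>
      \<delta>' (pure_tensor K D EF \<one>\<^bsub>D\<^esub> a) = pure_tensor K D EF \<one>\<^bsub>D\<^esub> (\<delta> a)"
    and ext_D: "\<And>x. x \<in> carrier D \<Longrightarrow> \<delta>' (pure_tensor K D EF x \<one>\<^bsub>E\<^esub>) = \<zero>\<^bsub>DE\<^esub>"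
    and d: "d \<in> carrier E"
    and S_def: "S = petit_algebra EF \<delta> (AS_poly EF \<delta> p d)"
    and T_def: "T = tensor_algebra K S D"
    and dE_def: "dE = pure_tensor K D EF \<one>\<^bsub>D\<^esub> d"
    and P_def: "P = petit_algebra DE \<delta>' (AS_poly DE \<delta>' p dE)"
begin

sublocale E: AS_field E \<delta> p by (rule AS)
sublocale D: ring D by (rule ring_D)

lemma EF_simps [simp]: "carrier EF = carrier E" "monoid.mult EF = monoid.mult E" "\<one>\<^bsub>EF\<^esub> = \<one>\<^bsub>E\<^esub>"
  "\<zero>\<^bsub>EF\<^esub> = \<zero>\<^bsub>E\<^esub>" "add EF = add E" "module.smult EF = monoid.mult E"
  by (simp_all add: EF_def)

lemma K_simps: "carrier K = F" "\<one>\<^bsub>K\<^esub> = \<one>\<^bsub>E\<^esub>" "\<zero>\<^bsub>K\<^esub> = \<zero>\<^bsub>E\<^esub>" "add K = add E"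
  by (simp_all add: K_def)

lemma F_mem: "c \<in> carrier K \<longleftrightarrow> c \<in> carrier E \<and> \<delta> c = \<zero>\<^bsub>E\<^esub>"
  using K_simps(1) F_def by auto

lemma algebra_EF: "nonassoc_algebra K EF"
  unfolding K_def EF_def using E.field_axioms subfield_F by (rule nonassoc_self_algebra)

sublocale SA: diff_algebra EF \<delta> K
proof (intro diff_algebra.intro diff_ring.intro diff_ring_axioms.intro diff_algebra_axioms.intro)
  show "ring EF" by (rule E.ring_self_algebra) auto
  show "derivation EF \<delta>" using E.der by (simp add: derivation_def)
  show "vectorspace K EF" using algebra_EF by (simp add: nonassoc_algebra_def)
qed (auto simp: F_mem E.m_assoc E.m_lcomm E.der_mult E.nontriv)

sublocale TD: tensor_product K D EF by (rule tensor_product.intro[OF algebra_D algebra_EF])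

lemma DE_T: "TD.T = DE" by (simp add: DE_def)

abbreviation ptD where "ptD \<equiv> pure_tensor K D EF"

lemmas ptD_closed = TD.pt_closed[unfolded DE_T EF_simps]
lemmas ptD_simps = TD.pt_simps[unfolded DE_T EF_simps]
lemmas ptD_mult = TD.pt_mult[unfolded DE_T EF_simps]
lemmas ptD_zero = TD.pt_zero[unfolded DE_T EF_simps]
lemmas DE_one = TD.T_one_pt[unfolded DE_T EF_simps]
lemmas DE_induct = TD.T_induct[unfolded DE_T EF_simps, consumes 1, case_names add pt]

lemma ring_DE: "ring DE"
  using TD.ring_T[OF ring_D SA.ring_axioms] DE_T by simp

sublocale DE: ring DE by (rule ring_DE)

lemma algebra_DE: "nonassoc_algebra K DE"
  using DE_division by (simp add: division_algebra_def)

text \<open>Since \<open>x \<otimes> a\<close> is the product of \<open>x \<otimes> 1\<close> and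
  \<open>1 \<otimes> a\<close>, the Leibniz rule forces the extension to act on the \<open>E\<close>
  component only.\<close>

lemma der'_pt:
  assumes x: "x \<in> carrier D" and a: "a \<in> carrier E"
  shows "\<delta>' (ptD x a) = ptD x (\<delta> a)"
proof -
  have "ptD x a = ptD x \<one>\<^bsub>E\<^esub> \<otimes>\<^bsub>DE\<^esub> ptD \<one>\<^bsub>D\<^esub> a" using x a by (simp add: ptD_mult)
  then have "\<delta>' (ptD x a) = ptD x \<one>\<^bsub>E\<^esub> \<otimes>\<^bsub>DE\<^esub> ptD \<one>\<^bsub>D\<^esub> (\<delta> a) \<oplus>\<^bsub>DE\<^esub> \<zero>\<^bsub>DE\<^esub> \<otimes>\<^bsub>DE\<^esub> ptD \<one>\<^bsub>D\<^esub> a"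
    using der' x a ptD_closed ext_E ext_D by (simp add: derivation_def)
  then show ?thesis using x a ptD_closed by (simp add: ptD_mult)
qed

lemma one_neq_zero_DE: "\<one>\<^bsub>DE\<^esub> \<noteq> \<zero>\<^bsub>DE\<^esub>"
  using DE_division DE.one_zeroD by (simp add: division_algebra_def) blast

lemma inverse_DE:
  assumes x: "x \<in> carrier DE" "x \<noteq> \<zero>\<^bsub>DE\<^esub>"
  shows "\<exists>y\<in>carrier DE. y \<otimes>\<^bsub>DE\<^esub> x = \<one>\<^bsub>DE\<^esub> \<and> x \<otimes>\<^bsub>DE\<^esub> y = \<one>\<^bsub>DE\<^esub>"
proof -
  have b: "bij_betw (\<lambda>y. x \<otimes>\<^bsub>DE\<^esub> y) (carrier DE) (carrier DE)" "bij_betw (\<lambda>y. y \<otimes>\<^bsub>DE\<^esub> x) (carrier DE) (carrier DE)"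
    using DE_division x by (auto simp: division_algebra_def)
  have "\<one>\<^bsub>DE\<^esub> \<in> (\<lambda>y. x \<otimes>\<^bsub>DE\<^esub> y) ` carrier DE" "\<one>\<^bsub>DE\<^esub> \<in> (\<lambda>y. y \<otimes>\<^bsub>DE\<^esub> x) ` carrier DE"
    using b by (auto simp: bij_betw_def)
  then obtain y z where y: "y \<in> carrier DE" "\<one>\<^bsub>DE\<^esub> = x \<otimes>\<^bsub>DE\<^esub> y" and z: "z \<in> carrier DE" "\<one>\<^bsub>DE\<^esub> = z \<otimes>\<^bsub>DE\<^esub> x" by blast
  have "z = z \<otimes>\<^bsub>DE\<^esub> (x \<otimes>\<^bsub>DE\<^esub> y)" unfolding y(2)[symmetric] using z(1) by simp
  also have "\<dots> = y" using x y z by (metis DE.m_assoc DE.l_one)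
  finally show ?thesis using y z by auto
qed

sublocale DD: diff_division_ring DE \<delta>' p
proof (intro diff_division_ring.intro diff_ring_p.intro diff_ring.intro diff_ring_axioms.intro
    diff_ring_p_axioms.intro diff_division_ring_axioms.intro)
  show "ring DE" by (rule ring_DE)
  show "derivation DE \<delta>'" by (rule der')
  show "Factorial_Ring.prime p" by (rule E.prime_p)
  show "\<one>\<^bsub>DE\<^esub> \<noteq> \<zero>\<^bsub>DE\<^esub>" by (rule one_neq_zero_DE)
  fix x assume x: "x \<in> carrier DE"
  interpret V: vectorspace K DE using algebra_DE by (simp add: nonassoc_algebra_def)
  \<comment> \<open>Integer multiples in \<open>DE\<close> are scalar multiples by integers of
    \<open>K\<close>, so the characteristic passes from \<open>E\<close> through \<open>K\<close> to
    \<open>DE\<close>.\<close>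
  have "[p] \<cdot>\<^bsub>K\<^esub> \<one>\<^bsub>K\<^esub> = [p] \<cdot>\<^bsub>E\<^esub> \<one>\<^bsub>E\<^esub>" by (simp add: add_pow_def nat_pow_def K_def)
  then have "[p] \<cdot>\<^bsub>K\<^esub> \<one>\<^bsub>K\<^esub> = \<zero>\<^bsub>K\<^esub>" using E.char_p[of "\<one>\<^bsub>E\<^esub>"] by (simp add: K_simps)
  then show "[p] \<cdot>\<^bsub>DE\<^esub> x = \<zero>\<^bsub>DE\<^esub>" using V.add_pow_eq_smult[OF x, of p] x by simp
qed (rule inverse_DE)

sublocale DA: diff_algebra DE \<delta>' K
proof (intro diff_algebra.intro diff_algebra_axioms.intro)
  show "diff_ring DE \<delta>'" by (rule DD.diff_ring_axioms)
  show "vectorspace K DE" using algebra_DE by (simp add: nonassoc_algebra_def)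
  show "\<one>\<^bsub>DE\<^esub> \<noteq> \<zero>\<^bsub>DE\<^esub>" by (rule one_neq_zero_DE)
  note a = nonassoc_algebraD[OF algebra_DE]
  interpret V: vectorspace K DE by (rule a(1))
  show "(c \<odot>\<^bsub>DE\<^esub> x) \<otimes>\<^bsub>DE\<^esub> y = c \<odot>\<^bsub>DE\<^esub> (x \<otimes>\<^bsub>DE\<^esub> y)" "x \<otimes>\<^bsub>DE\<^esub> (c \<odot>\<^bsub>DE\<^esub> y) = c \<odot>\<^bsub>DE\<^esub> (x \<otimes>\<^bsub>DE\<^esub> y)"
    if "c \<in> carrier K" "x \<in> carrier DE" "y \<in> carrier DE" for c x y using a(5,6) that by auto
  show "\<delta>' (c \<odot>\<^bsub>DE\<^esub> x) = c \<odot>\<^bsub>DE\<^esub> \<delta>' x" if c: "c \<in> carrier K" and x: "x \<in> carrier DE" for c x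
    using x
  proof (induction x rule: DE_induct)
    case (add x y)
    then show ?case using c by (simp add: V.smult_r_distr DD.der_add)
  next
    case (pt x a)
    have ce: "c \<in> carrier E" "\<delta> c = \<zero>\<^bsub>E\<^esub>" using c F_mem by auto
    \<comment> \<open>The scalar is moved into the \<open>E\<close> component, where \<delta> treats
      it as a constant.\<close>
    have "\<delta>' (c \<odot>\<^bsub>DE\<^esub> ptD x a) = \<delta>' (ptD x (c \<otimes>\<^bsub>E\<^esub> a))" using c pt ptD_simps(4) by simp
    also have "\<dots> = ptD x (c \<otimes>\<^bsub>E\<^esub> \<delta> a)" using ce pt by (simp add: der'_pt E.der_mult)
    also have "\<dots> = c \<odot>\<^bsub>DE\<^esub> \<delta>' (ptD x a)" using c pt ptD_simps(4) by (simp add: der'_pt)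
    finally show ?case .
  qed
qed

section \<open>The two Petit algebras and their comparison\<close>

lemma p_pos: "p > 0" using E.p_ge_2 by simp

abbreviation fE where "fE \<equiv> AS_poly EF \<delta> p d"
abbreviation fD where "fD \<equiv> AS_poly DE \<delta>' p dE"

lemma dE_closed: "dE \<in> carrier DE"
  using ptD_closed d by (simp add: dE_def)

lemma fE: "SA.deg_below (Suc p) fE" "fE p = \<one>\<^bsub>EF\<^esub>" "p > 0"
  using SA.AS_poly_monic[of d p] d E.p_ge_2 by auto

lemma fD: "DD.deg_below (Suc p) fD" "fD p = \<one>\<^bsub>DE\<^esub>" "p > 0"
  using DD.AS_poly_monic[of dE p] dE_closed E.p_ge_2 by auto

lemma algebra_S: "nonassoc_algebra K S"
  unfolding S_def by (rule SA.petit_nonassoc[OF fE])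

lemma algebra_P: "nonassoc_algebra K P"
  unfolding P_def by (rule DA.petit_nonassoc[OF fD])

lemma S_carrier: "carrier S = {h. SA.deg_below p h}"
  unfolding S_def by (rule SA.petit_carrier[OF fE])

lemma P_carrier: "carrier P = {h. DD.deg_below p h}"
  unfolding P_def by (rule DA.petit_carrier[OF fD])

lemmas S_simps = SA.petit_simps[of fE, folded S_def]
lemmas P_simps = DA.petit_simps[of fD, folded P_def]

sublocale TS: tensor_product K S D by (rule tensor_product.intro[OF algebra_S algebra_D])

lemma TS_T: "TS.T = T" by (simp add: T_def)

abbreviation ptT where "ptT \<equiv> pure_tensor K S D"

lemmas ptT_closed = TS.pt_closed[unfolded TS_T]
lemmas ptT_simps = TS.pt_simps[unfolded TS_T]
lemmas ptT_mult = TS.pt_mult[unfolded TS_T]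
lemmas ptT_zero = TS.pt_zero[unfolded TS_T]
lemmas T_one = TS.T_one_pt[unfolded TS_T]
lemmas T_induct = TS.T_induct[unfolded TS_T, consumes 1, case_names add pt]
lemmas algebra_T = TS.T_nonassoc[unfolded TS_T]

text \<open>The three factors are the powers of \<open>t\<close>, the basis of \<open>E\<close> over
  \<open>F\<close> and a basis of \<open>D\<close>.\<close>

lemma dim_T: "vectorspace.fin_dim K T" "vectorspace.dim K T = p\<^sup>2 * vectorspace.dim K D"
proof -
  interpret VT: vectorspace K T using algebra_T by (simp add: nonassoc_algebra_def)
  obtain X where X: "dual_basis K EF X (\<lambda>x. x)" "card X = p"
    using AS_field_dual_basis[OF AS F_def subfield_F] unfolding K_def EF_def by blast
  obtain Y where Y: "dual_basis K D Y (\<lambda>x. x)" "card Y = vectorspace.dim K D"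
    using vectorspace.dual_basis_exists[OF TD.A.vectorspace_axioms fin_dim_D] by blast
  have "dual_basis K S ({..<p} \<times> X) (\<lambda>(i, x). SA.mon x i)"
    unfolding S_def by (rule SA.petit_dual_basis[OF fE X(1)])
  from TS.dual_basis_tensor[OF this Y(1)] have db: "dual_basis K T (({..<p} \<times> X) \<times> Y)
      (\<lambda>(i, j). ptT ((\<lambda>(i, x). SA.mon x i) i) j)" unfolding TS_T .
  show "vectorspace.fin_dim K T" using VT.dual_basis_dim(1)[OF db] .
  show "vectorspace.dim K T = p\<^sup>2 * vectorspace.dim K D" using VT.dual_basis_dim(2)[OF db] X(2) Y(2)
    by (simp add: card_cartesian_product power2_eq_square)
qed

text \<open>The image of \<open>h \<otimes> x\<close> in the polynomials over \<open>DE\<close>. The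
  order is exchanged because \<open>D\<close> is the left component of \<open>DE\<close> but the
  right one of \<open>T\<close>.\<close>

definition Psi :: "'d \<Rightarrow> (nat \<Rightarrow> 'e) \<Rightarrow> nat \<Rightarrow> ('d \<times> 'e \<Rightarrow> 'e) set" where
  "Psi x h = (\<lambda>i. ptD x (h i))"

lemma up_EF_closed: "h \<in> up EF \<Longrightarrow> h i \<in> carrier E"
  using SA.up_closed[of h i] by simp

lemma Psi_up: assumes "x \<in> carrier D" "h \<in> up EF" shows "Psi x h \<in> up DE"
proof -
  obtain n where "\<And>i. i \<ge> n \<Longrightarrow> h i = \<zero>\<^bsub>EF\<^esub>" using assms SA.upE by blast
  then show ?thesis using assms up_EF_closed by (intro DD.upI[where n=n]) (auto simp: Psi_def ptD_zero ptD_closed)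
qed

lemma Psi_deg_below: "x \<in> carrier D \<Longrightarrow> SA.deg_below n h \<Longrightarrow> DD.deg_below n (Psi x h)"
  unfolding SA.deg_below_def DD.deg_below_def using Psi_up by (auto simp: Psi_def ptD_zero)

lemma Psi_add: "x \<in> carrier D \<Longrightarrow> h \<in> up EF \<Longrightarrow> k \<in> up EF \<Longrightarrow>
    Psi x (\<lambda>n. h n \<oplus>\<^bsub>E\<^esub> k n) = (\<lambda>n. Psi x h n \<oplus>\<^bsub>DE\<^esub> Psi x k n)"
  using up_EF_closed by (simp add: Psi_def ptD_simps)

lemma Psi_mon: "x \<in> carrier D \<Longrightarrow> a \<in> carrier E \<Longrightarrow> Psi x (SA.mon a i) = DD.mon (ptD x a) i"
  by (rule ext) (simp add: Psi_def SA.mon_def DD.mon_def ptD_zero)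

lemma Psi_\<tau>: assumes x: "x \<in> carrier D" and h: "h \<in> up EF" shows "t_times DE \<delta>' (Psi x h) = Psi x (t_times EF \<delta> h)"
proof
  fix n
  show "t_times DE \<delta>' (Psi x h) n = Psi x (t_times EF \<delta> h) n"
    using x up_EF_closed[OF h] by (cases n) (simp_all add: t_times_def Psi_def der'_pt ptD_simps ptD_closed ptD_zero)
qed

lemma Psi_\<tau>_pow: assumes x: "x \<in> carrier D" and h: "h \<in> up EF"
  shows "(t_times DE \<delta>' ^^ i) (Psi x h) = Psi x ((t_times EF \<delta> ^^ i) h)"
  by (induction i) (simp_all add: Psi_\<tau> x h)

text \<open>Elements of \<open>D\<close> commute with \<open>E\<close> inside \<open>DE\<close>, and
  with \<open>t\<close> since the extended derivation kills them; so the two components multiply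
  independently.\<close>

lemma Psi_mult:
  assumes x: "x \<in> carrier D" and y: "y \<in> carrier D" and h: "h \<in> up EF" and k: "k \<in> up EF"
  shows "Psi x h \<otimes>\<^bsub>DD.R\<^esub> Psi y k = Psi (x \<otimes>\<^bsub>D\<^esub> y) (h \<otimes>\<^bsub>SA.R\<^esub> k)"
  using h
proof (induction h rule: SA.up_induct)
  case (add h q)
  then show ?case using x y k by (simp add: Psi_add DD.mult_add_left SA.mult_add_left[simplified] Psi_up)
next
  case (mon a i)
  then have a: "a \<in> carrier E" by simp
  have "Psi x (SA.mon a i) \<otimes>\<^bsub>DD.R\<^esub> Psi y k = (\<lambda>n. ptD x a \<otimes>\<^bsub>DE\<^esub> Psi y ((t_times EF \<delta> ^^ i) k) n)"
    using a x y k by (simp add: Psi_mon DD.mult_mon ptD_closed Psi_up Psi_\<tau>_pow)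
  also have "\<dots> = Psi (x \<otimes>\<^bsub>D\<^esub> y) (\<lambda>n. a \<otimes>\<^bsub>E\<^esub> (t_times EF \<delta> ^^ i) k n)"
    using a x y up_EF_closed[OF SA.\<tau>_pow_up[OF k]] by (simp add: Psi_def ptD_mult)
  also have "\<dots> = Psi (x \<otimes>\<^bsub>D\<^esub> y) (SA.mon a i \<otimes>\<^bsub>SA.R\<^esub> k)" using mon k by (simp add: SA.mult_mon)
  finally show ?case .
qed

lemma Psi_f: "Psi \<one>\<^bsub>D\<^esub> fE = fD"
proof
  fix n
  have minus: "ptD \<one>\<^bsub>D\<^esub> (a \<ominus>\<^bsub>EF\<^esub> b) = ptD \<one>\<^bsub>D\<^esub> a \<ominus>\<^bsub>DE\<^esub> ptD \<one>\<^bsub>D\<^esub> b" if "a \<in> carrier E" "b \<in> carrier E" for a b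
  proof -
    have c: "a \<ominus>\<^bsub>EF\<^esub> b \<in> carrier E" using SA.minus_closed[of a b] that by simp
    have "(a \<ominus>\<^bsub>EF\<^esub> b) \<oplus>\<^bsub>E\<^esub> b = a" using SA.a_assoc[of a "\<ominus>\<^bsub>EF\<^esub> b" b] SA.l_neg[of b] that by (simp add: SA.minus_eq SA.a_inv_closed[simplified])
    then have "ptD \<one>\<^bsub>D\<^esub> a = ptD \<one>\<^bsub>D\<^esub> (a \<ominus>\<^bsub>EF\<^esub> b) \<oplus>\<^bsub>DE\<^esub> ptD \<one>\<^bsub>D\<^esub> b" using ptD_simps(2)[of "\<one>\<^bsub>D\<^esub>" "a \<ominus>\<^bsub>EF\<^esub> b" b] c that by simp
    then show ?thesis using ptD_closed[of "\<one>\<^bsub>D\<^esub>"] c that by (simp add: DE.minus_eq DE.a_assoc DE.r_neg)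
  qed
  have m: "SA.mon a i n \<in> carrier E" if "a \<in> carrier E" for a i using that by (simp add: SA.mon_def)
  have m': "ptD \<one>\<^bsub>D\<^esub> (SA.mon a i n) = DD.mon (ptD \<one>\<^bsub>D\<^esub> a) i n" if "a \<in> carrier E" for a i
    using Psi_mon[of "\<one>\<^bsub>D\<^esub>" a i] that by (simp add: Psi_def fun_eq_iff)
  have mm: "SA.mon a i n \<ominus>\<^bsub>EF\<^esub> SA.mon b j n \<in> carrier E" if "a \<in> carrier E" "b \<in> carrier E" for a b i j
    using SA.minus_closed[of "SA.mon a i n" "SA.mon b j n"] m that by simp
  have "fE n = (SA.mon \<one>\<^bsub>E\<^esub> p n \<ominus>\<^bsub>EF\<^esub> SA.mon \<one>\<^bsub>E\<^esub> (Suc 0) n) \<ominus>\<^bsub>EF\<^esub> SA.mon d 0 n"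
    using SA.AS_poly_coeff[of d p n] d by simp
  then show "Psi \<one>\<^bsub>D\<^esub> fE n = fD n"
    using DD.AS_poly_coeff[OF dE_closed, of p n] d m mm by (simp add: Psi_def minus m' DE_one dE_def)
qed

lemma S_one: "\<one>\<^bsub>S\<^esub> = SA.mon \<one>\<^bsub>E\<^esub> 0" using S_simps(2) by simp

lemma S_one_closed: "\<one>\<^bsub>S\<^esub> \<in> carrier S"
  unfolding S_one S_carrier using SA.deg_below_mon[of "\<one>\<^bsub>E\<^esub>" 0 p] p_pos by simp

lemma Psi_bilinear: "bilinear_map K S D P (\<lambda>h x. Psi x h)"
  unfolding bilinear_map_def
proof (intro conjI ballI)
  show "Psi x h \<in> carrier P" if "h \<in> carrier S" "x \<in> carrier D" for h x
    using that Psi_deg_below by (simp add: S_carrier P_carrier)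
  show "Psi x (h \<oplus>\<^bsub>S\<^esub> k) = Psi x h \<oplus>\<^bsub>P\<^esub> Psi x k" if "h \<in> carrier S" "k \<in> carrier S" "x \<in> carrier D" for h k x
    using that by (simp add: S_carrier S_simps P_simps Psi_add)
  show "Psi (x \<oplus>\<^bsub>D\<^esub> y) h = Psi x h \<oplus>\<^bsub>P\<^esub> Psi y h" if "h \<in> carrier S" "x \<in> carrier D" "y \<in> carrier D" for h x y
    using that up_EF_closed by (simp add: S_carrier P_simps Psi_def ptD_simps)
  show "Psi x (c \<odot>\<^bsub>S\<^esub> h) = c \<odot>\<^bsub>P\<^esub> Psi x h" if "c \<in> carrier K" "h \<in> carrier S" "x \<in> carrier D" for c h x
    using that up_EF_closed by (simp add: S_carrier S_simps P_simps Psi_def ptD_simps)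
  show "Psi (c \<odot>\<^bsub>D\<^esub> x) h = c \<odot>\<^bsub>P\<^esub> Psi x h" if "c \<in> carrier K" "h \<in> carrier S" "x \<in> carrier D" for c h x
    using that up_EF_closed by (simp add: S_carrier P_simps Psi_def ptD_simps)
qed

text \<open>Applying \<open>Psi\<close> to the division \<open>h k = q f + r\<close> yields a
  division by \<open>fD\<close>, because \<open>Psi\<close> sends \<open>f\<close> to
  \<open>fD\<close> and respects degree bounds.\<close>

lemma Psi_mult_petit:
  assumes h: "h \<in> carrier S" and k: "k \<in> carrier S" and x: "x \<in> carrier D" and y: "y \<in> carrier D"
  shows "Psi (x \<otimes>\<^bsub>D\<^esub> y) (h \<otimes>\<^bsub>S\<^esub> k) = Psi x h \<otimes>\<^bsub>P\<^esub> Psi y k"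
proof -
  have hu: "h \<in> up EF" "k \<in> up EF" using h k by (auto simp: S_carrier)
  have fu: "fE \<in> up EF" using fE by simp
  obtain q r where qr: "q \<in> up EF" "SA.deg_below p r" "h \<otimes>\<^bsub>SA.R\<^esub> k = (\<lambda>n. (q \<otimes>\<^bsub>SA.R\<^esub> fE) n \<oplus>\<^bsub>EF\<^esub> r n)"
     "right_mod EF \<delta> (h \<otimes>\<^bsub>SA.R\<^esub> k) fE = r"
    using SA.rem_obtain[OF fE SA.mult_up[OF hu]] .
  have xy: "x \<otimes>\<^bsub>D\<^esub> y \<in> carrier D" using x y by simp
  have "Psi x h \<otimes>\<^bsub>DD.R\<^esub> Psi y k = Psi (x \<otimes>\<^bsub>D\<^esub> y) (h \<otimes>\<^bsub>SA.R\<^esub> k)" using Psi_mult x y hu by simp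
  also have "\<dots> = (\<lambda>n. Psi (x \<otimes>\<^bsub>D\<^esub> y) (q \<otimes>\<^bsub>SA.R\<^esub> fE) n \<oplus>\<^bsub>DE\<^esub> Psi (x \<otimes>\<^bsub>D\<^esub> y) r n)"
    unfolding qr(3) using Psi_add[OF xy SA.mult_up[OF qr(1) fu] SA.deg_below_up[OF qr(2)]] by simp
  also have "Psi (x \<otimes>\<^bsub>D\<^esub> y) (q \<otimes>\<^bsub>SA.R\<^esub> fE) = Psi (x \<otimes>\<^bsub>D\<^esub> y) q \<otimes>\<^bsub>DD.R\<^esub> fD"
    using Psi_mult[OF xy D.one_closed qr(1) fu] xy by (simp add: Psi_f)
  finally have "right_mod DE \<delta>' (Psi x h \<otimes>\<^bsub>DD.R\<^esub> Psi y k) fD = Psi (x \<otimes>\<^bsub>D\<^esub> y) r"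
    by (rule DD.right_mod_eq[OF fD DD.nontriv Psi_up[OF xy qr(1)] Psi_deg_below[OF xy qr(2)]])
  then show ?thesis by (simp add: S_simps P_simps qr(4))
qed

text \<open>Splits a tensor into its monomial parts; this is the shape in which the inverse of the
  isomorphism returns it.\<close>

lemma pt_sum:
  assumes x: "x \<in> carrier D"
  shows "n \<le> p \<Longrightarrow> SA.deg_below n h \<Longrightarrow> (\<Oplus>\<^bsub>T\<^esub>i\<in>{..<n}. ptT (SA.mon (h i) i) x) = ptT h x"
proof (induction n arbitrary: h)
  case 0
  interpret VT: vectorspace K T using algebra_T by (simp add: nonassoc_algebra_def)
  have "h = \<zero>\<^bsub>S\<^esub>" using 0 by (simp add: SA.deg_below_0 S_simps)
  then show ?case using ptT_zero(2)[OF x] by simp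
next
  case (Suc n)
  interpret VT: vectorspace K T using algebra_T by (simp add: nonassoc_algebra_def)
  obtain g where g: "SA.deg_below n g" "h = (\<lambda>i. g i \<oplus>\<^bsub>EF\<^esub> SA.mon (h n) n i)" "\<forall>i<n. g i = h i"
    using SA.deg_below_split[OF Suc.prems(2)] by blast
  have m: "SA.mon (h i) i \<in> carrier S" if "i < Suc n" for i
    using SA.deg_below_mon[of "h i" i p] Suc.prems that by (simp add: S_carrier up_EF_closed)
  have gS: "g \<in> carrier S" using SA.deg_below_mono[OF g(1), of p] Suc.prems by (simp add: S_carrier)
  have "(\<Oplus>\<^bsub>T\<^esub>i\<in>{..<Suc n}. ptT (SA.mon (h i) i) x) = ptT (SA.mon (h n) n) x \<oplus>\<^bsub>T\<^esub> (\<Oplus>\<^bsub>T\<^esub>i\<in>{..<n}. ptT (SA.mon (h i) i) x)"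
    unfolding lessThan_Suc using m x ptT_closed by (intro VT.M.finsum_insert) auto
  also have "(\<Oplus>\<^bsub>T\<^esub>i\<in>{..<n}. ptT (SA.mon (h i) i) x) = (\<Oplus>\<^bsub>T\<^esub>i\<in>{..<n}. ptT (SA.mon (g i) i) x)"
    using m x ptT_closed g(3) by (intro VT.M.add.finprod_cong') auto
  also have "\<dots> = ptT g x" using Suc.IH[OF _ g(1)] Suc.prems by simp
  also have "ptT (SA.mon (h n) n) x \<oplus>\<^bsub>T\<^esub> ptT g x = ptT (g \<oplus>\<^bsub>S\<^esub> SA.mon (h n) n) x"
    using ptT_simps(1)[OF gS m[of n] x] ptT_closed[OF gS x] ptT_closed[OF m[of n] x] VT.M.a_comm by simp
  also have "g \<oplus>\<^bsub>S\<^esub> SA.mon (h n) n = h" using g(2) S_simps(3) by simp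
  finally show ?case .
qed

text \<open>The map comes from the universal property; multiplicativity is extended from pure
  tensors. Injectivity follows from a left inverse, surjectivity from hitting every
  monomial.\<close>

lemma phi_exists:
  "\<exists>\<phi> \<in> algebra_iso K T P. \<forall>h\<in>carrier S. \<forall>x\<in>carrier D. \<phi> (ptT h x) = Psi x h"
proof -
  note aT = nonassoc_algebraD[OF algebra_T] and aP = nonassoc_algebraD[OF algebra_P]
  interpret VT: vectorspace K T by (rule aT(1))
  interpret VP: vectorspace K P by (rule aP(1))
  obtain \<phi> where \<phi>: "\<phi> \<in> module_hom K T P" "\<forall>h\<in>carrier S. \<forall>x\<in>carrier D. \<phi> (ptT h x) = Psi x h"
    using TS.T_lift[OF aP(1) Psi_bilinear] unfolding TS_T by blast
  have \<phi>c: "\<And>u. u \<in> carrier T \<Longrightarrow> \<phi> u \<in> carrier P" using module_hom_closed[OF \<phi>(1)] by auto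
  note \<phi>add = module_hom_add[OF \<phi>(1)]
  have mult1: "\<phi> (ptT h x \<otimes>\<^bsub>T\<^esub> v) = \<phi> (ptT h x) \<otimes>\<^bsub>P\<^esub> \<phi> v" if h: "h \<in> carrier S" and x: "x \<in> carrier D" and v: "v \<in> carrier T" for h x v
    using v
  proof (induction v rule: T_induct)
    case (add u v)
    then show ?case using h x ptT_closed \<phi>c by (simp add: aT \<phi>add aP)
  next
    case (pt k y)
    then show ?case using h x Psi_mult_petit[OF h pt(1) x pt(2)] nonassoc_algebraD(2)[OF algebra_S h pt(1)] \<phi>(2) by (simp add: ptT_mult)
  qed
  have mult: "\<phi> (u \<otimes>\<^bsub>T\<^esub> v) = \<phi> u \<otimes>\<^bsub>P\<^esub> \<phi> v" if u: "u \<in> carrier T" and v: "v \<in> carrier T" for u v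
    using u by (induction u rule: T_induct) (use v in \<open>simp_all add: aT \<phi>add aP \<phi>c mult1\<close>)
  have one: "\<phi> \<one>\<^bsub>T\<^esub> = \<one>\<^bsub>P\<^esub>"
    using \<phi>(2) S_one_closed by (simp add: T_one, simp add: S_one Psi_mon P_simps DE_one)
  \<comment> \<open>One linear map \<open>DE -> T\<close> per degree, sending
    \<open>x \<otimes> a\<close> to \<open>(a t^i) \<otimes> x\<close>. The guard is needed because
    \<open>a t^i\<close> is a reduced polynomial only for \<open>i < p\<close>.\<close>
  have "\<forall>i. \<exists>\<Psi>. i < p \<longrightarrow> \<Psi> \<in> module_hom K DE T \<and> (\<forall>x\<in>carrier D. \<forall>a\<in>carrier E. \<Psi> (ptD x a) = ptT (SA.mon a i) x)"
  proof (intro allI)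
    fix i
    show "\<exists>\<Psi>. i < p \<longrightarrow> \<Psi> \<in> module_hom K DE T \<and> (\<forall>x\<in>carrier D. \<forall>a\<in>carrier E. \<Psi> (ptD x a) = ptT (SA.mon a i) x)"
    proof (cases "i < p")
      case True
      have m: "SA.mon a i \<in> carrier S" if "a \<in> carrier E" for a using SA.deg_below_mon[of a i p] that True by (simp add: S_carrier)
      have "bilinear_map K D EF T (\<lambda>x a. ptT (SA.mon a i) x)"
        unfolding bilinear_map_def
      proof (intro conjI ballI)
        show "ptT (SA.mon (a \<oplus>\<^bsub>EF\<^esub> b) i) x = ptT (SA.mon a i) x \<oplus>\<^bsub>T\<^esub> ptT (SA.mon b i) x"
          if "x \<in> carrier D" "a \<in> carrier EF" "b \<in> carrier EF" for x a b
          using ptT_simps(1)[OF m m] that SA.mon_add[of a b i] by (simp add: S_simps)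
        show "ptT (SA.mon (c \<odot>\<^bsub>EF\<^esub> a) i) x = c \<odot>\<^bsub>T\<^esub> ptT (SA.mon a i) x"
          if "c \<in> carrier K" "x \<in> carrier D" "a \<in> carrier EF" for c x a
        proof -
          have "SA.mon (c \<odot>\<^bsub>EF\<^esub> a) i = c \<odot>\<^bsub>S\<^esub> SA.mon a i"
            using that SA.mon_scale[of c a i] by (simp add: S_simps)
          then show ?thesis using ptT_simps(3)[OF that(1) m that(2), of a] that by simp
        qed
      qed (auto simp: m ptT_closed ptT_simps)
      then show ?thesis using TD.T_lift[OF aT(1)] unfolding DE_T by fastforce
    qed simp
  qed
  then obtain \<Psi> where "\<forall>i. i < p \<longrightarrow> \<Psi> i \<in> module_hom K DE T \<and> (\<forall>x\<in>carrier D. \<forall>a\<in>carrier E. \<Psi> i (ptD x a) = ptT (SA.mon a i) x)"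
    by (rule choice[THEN exE])
  then have \<Psi>: "\<And>i. i < p \<Longrightarrow> \<Psi> i \<in> module_hom K DE T" "\<And>i x a. i < p \<Longrightarrow> x \<in> carrier D \<Longrightarrow> a \<in> carrier E \<Longrightarrow> \<Psi> i (ptD x a) = ptT (SA.mon a i) x"
    by auto
  \<comment> \<open>The candidate left inverse: treat each coefficient separately and add up. It is
    evaluated on pure tensors by \<open>pt_sum\<close>.\<close>
  define \<psi> where "\<psi> u = (\<Oplus>\<^bsub>T\<^esub>i\<in>{..<p}. \<Psi> i (u i))" for u
  have \<psi>c: "\<Psi> i (u i) \<in> carrier T" if "i < p" "u \<in> carrier P" for i u
    using module_hom_closed[OF \<Psi>(1)[OF that(1)]] that by (auto simp: P_carrier)
  have \<psi>\<phi>: "\<psi> (\<phi> u) = u" if "u \<in> carrier T" for u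
    using that
  proof (induction u rule: T_induct)
    case (add u v)
    have "\<psi> (\<phi> (u \<oplus>\<^bsub>T\<^esub> v)) = (\<Oplus>\<^bsub>T\<^esub>i\<in>{..<p}. \<Psi> i (\<phi> u i) \<oplus>\<^bsub>T\<^esub> \<Psi> i (\<phi> v i))"
      unfolding \<psi>_def
    proof (rule VT.M.add.finprod_cong')
      fix i assume "i \<in> {..<p}"
      then show "\<Psi> i (\<phi> (u \<oplus>\<^bsub>T\<^esub> v) i) = \<Psi> i (\<phi> u i) \<oplus>\<^bsub>T\<^esub> \<Psi> i (\<phi> v i)"
        using \<phi>add[OF add(1,2)] module_hom_add[OF \<Psi>(1)] \<phi>c[OF add(1)] \<phi>c[OF add(2)] by (simp add: P_simps P_carrier)
    qed (use \<psi>c \<phi>c add in auto)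
    also have "\<dots> = \<psi> (\<phi> u) \<oplus>\<^bsub>T\<^esub> \<psi> (\<phi> v)"
      unfolding \<psi>_def using \<psi>c \<phi>c add by (intro VT.M.finsum_addf) auto
    finally show ?case using add by simp
  next
    case (pt h x)
    have hc: "h i \<in> carrier E" for i using pt up_EF_closed by (simp add: S_carrier)
    have "\<psi> (\<phi> (ptT h x)) = (\<Oplus>\<^bsub>T\<^esub>i\<in>{..<p}. ptT (SA.mon (h i) i) x)"
      unfolding \<psi>_def
    proof (rule VT.M.add.finprod_cong')
      show "\<Psi> i (\<phi> (ptT h x) i) = ptT (SA.mon (h i) i) x" if "i \<in> {..<p}" for i
        using that pt \<phi>(2) \<Psi>(2)[OF _ pt(2) hc] by (simp add: Psi_def)
      show "(\<lambda>i. ptT (SA.mon (h i) i) x) \<in> {..<p} \<rightarrow> carrier T"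
        using ptT_closed pt SA.deg_below_mon hc by (auto simp: S_carrier)
    qed simp
    also have "\<dots> = ptT h x" using pt_sum[OF pt(2) order_refl] pt by (simp add: S_carrier)
    finally show ?case .
  qed
  have inj: "inj_on \<phi> (carrier T)" by (rule inj_on_inverseI[of _ \<psi>]) (rule \<psi>\<phi>)
  \<comment> \<open>The image is closed under sums, so it suffices to reach coefficients that are
    pure tensors; these come from single monomials.\<close>
  have im_mon: "DD.mon v i \<in> \<phi> ` carrier T" if i: "i < p" and v: "v \<in> carrier DE" for v i
    using v
  proof (induction v rule: DE_induct)
    case (add v w)
    then obtain u u' where u: "u \<in> carrier T" "DD.mon v i = \<phi> u" "u' \<in> carrier T" "DD.mon w i = \<phi> u'" by blast
    have "DD.mon (v \<oplus>\<^bsub>DE\<^esub> w) i = \<phi> (u \<oplus>\<^bsub>T\<^esub> u')"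
      using add u(2,4) \<phi>add[OF u(1,3)] by (simp add: DD.mon_add P_simps)
    then show ?case using u by (intro image_eqI[of _ _ "u \<oplus>\<^bsub>T\<^esub> u'"]) auto
  next
    case (pt x a)
    have m: "SA.mon a i \<in> carrier S" using SA.deg_below_mon[of a i p] pt i by (simp add: S_carrier)
    have "DD.mon (ptD x a) i = \<phi> (ptT (SA.mon a i) x)" using \<phi>(2) m pt by (simp add: Psi_mon)
    then show ?case using ptT_closed[OF m pt(1)] by (rule image_eqI)
  qed
  have im: "n \<le> p \<Longrightarrow> DD.deg_below n u \<Longrightarrow> u \<in> \<phi> ` carrier T" for n u
  proof (induction n arbitrary: u)
    case 0
    then have "u = DD.mon \<zero>\<^bsub>DE\<^esub> 0" by (simp add: DD.deg_below_0)
    then show ?case using im_mon[of 0 "\<zero>\<^bsub>DE\<^esub>"] p_pos by simp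
  next
    case (Suc n)
    obtain g where g: "DD.deg_below n g" "u = (\<lambda>i. g i \<oplus>\<^bsub>DE\<^esub> DD.mon (u n) n i)" using DD.deg_below_split Suc.prems by blast
    obtain a where a: "a \<in> carrier T" "g = \<phi> a" using Suc.IH[OF _ g(1)] Suc.prems by auto
    obtain b where b: "b \<in> carrier T" "DD.mon (u n) n = \<phi> b" using im_mon[of n "u n"] Suc.prems by auto
    have "u = \<phi> (a \<oplus>\<^bsub>T\<^esub> b)" using g(2) a b \<phi>add[OF a(1) b(1)] by (simp add: P_simps)
    then show ?case using a b by (intro image_eqI[of _ _ "a \<oplus>\<^bsub>T\<^esub> b"]) auto
  qed
  have bij: "bij_betw \<phi> (carrier T) (carrier P)"
    unfolding bij_betw_def using inj im[OF order_refl] \<phi>c by (auto simp: P_carrier)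
  have "\<phi> \<in> algebra_iso K T P"
    unfolding algebra_iso_def ring_iso_def ring_hom_def
    using bij one mult \<phi>add \<phi>c module_hom_smult[OF \<phi>(1)] by auto
  then show ?thesis using \<phi>(2) by blast
qed

text \<open>Through the isomorphism a zero product in \<open>T\<close> becomes a product of nonzero
  reduced polynomials lying in the left ideal of \<open>fD\<close>.\<close>

lemma T_division_iff:
  "division_algebra K T \<longleftrightarrow> (\<forall>z\<in>carrier DE. dE \<noteq> V_pow DE \<delta>' p z \<ominus>\<^bsub>DE\<^esub> z)"
proof -
  obtain \<phi> where \<phi>: "\<phi> \<in> algebra_iso K T P" using phi_exists by blast
  have bij: "bij_betw \<phi> (carrier T) (carrier P)" and one: "\<phi> \<one>\<^bsub>T\<^esub> = \<one>\<^bsub>P\<^esub>"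
    and add: "\<And>u v. u \<in> carrier T \<Longrightarrow> v \<in> carrier T \<Longrightarrow> \<phi> (u \<oplus>\<^bsub>T\<^esub> v) = \<phi> u \<oplus>\<^bsub>P\<^esub> \<phi> v"
    and mult: "\<And>u v. u \<in> carrier T \<Longrightarrow> v \<in> carrier T \<Longrightarrow> \<phi> (u \<otimes>\<^bsub>T\<^esub> v) = \<phi> u \<otimes>\<^bsub>P\<^esub> \<phi> v"
    and sm: "\<And>c u. c \<in> carrier K \<Longrightarrow> u \<in> carrier T \<Longrightarrow> \<phi> (c \<odot>\<^bsub>T\<^esub> u) = c \<odot>\<^bsub>P\<^esub> \<phi> u"
    using \<phi> by (auto simp: algebra_iso_def ring_iso_def ring_hom_def)
  note aT = nonassoc_algebraD[OF algebra_T] and aP = nonassoc_algebraD[OF algebra_P]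
  interpret VT: vectorspace K T by (rule aT(1))
  interpret VP: vectorspace K P by (rule aP(1))
  have \<phi>c: "\<And>u. u \<in> carrier T \<Longrightarrow> \<phi> u \<in> carrier P" using bij by (auto simp: bij_betw_def)
  have z: "\<phi> \<zero>\<^bsub>T\<^esub> = \<zero>\<^bsub>P\<^esub>" using sm[of "\<zero>\<^bsub>K\<^esub>" "\<zero>\<^bsub>T\<^esub>"] \<phi>c[of "\<zero>\<^bsub>T\<^esub>"] by simp
  have z_iff: "\<phi> u = \<zero>\<^bsub>P\<^esub> \<longleftrightarrow> u = \<zero>\<^bsub>T\<^esub>" if "u \<in> carrier T" for u
    using bij that z by (metis VT.M.zero_closed bij_betw_inv_into_left)
  have "\<one>\<^bsub>P\<^esub> \<noteq> \<zero>\<^bsub>P\<^esub>" using DD.mon_nonzero[OF DD.nontriv, of 0] by (simp add: P_simps)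
  moreover have "\<one>\<^bsub>T\<^esub> \<in> carrier T" using ptT_closed S_one_closed by (simp add: T_one)
  ultimately have nz: "carrier T \<noteq> {\<zero>\<^bsub>T\<^esub>}" using one z by auto
  have "division_algebra K T \<longleftrightarrow> \<not> (\<exists>x\<in>carrier T. \<exists>y\<in>carrier T. x \<otimes>\<^bsub>T\<^esub> y = \<zero>\<^bsub>T\<^esub> \<and> x \<noteq> \<zero>\<^bsub>T\<^esub> \<and> y \<noteq> \<zero>\<^bsub>T\<^esub>)"
    unfolding division_algebra_iff_no_zero_divisors[OF algebra_T dim_T(1) nz] by blast
  also have "(\<exists>x\<in>carrier T. \<exists>y\<in>carrier T. x \<otimes>\<^bsub>T\<^esub> y = \<zero>\<^bsub>T\<^esub> \<and> x \<noteq> \<zero>\<^bsub>T\<^esub> \<and> y \<noteq> \<zero>\<^bsub>T\<^esub>)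
      \<longleftrightarrow> (\<exists>x\<in>carrier T. \<exists>y\<in>carrier T. \<phi> x \<otimes>\<^bsub>P\<^esub> \<phi> y = \<zero>\<^bsub>P\<^esub> \<and> \<phi> x \<noteq> \<zero>\<^bsub>P\<^esub> \<and> \<phi> y \<noteq> \<zero>\<^bsub>P\<^esub>)"
    using mult z_iff aT(2) by (metis (no_types, lifting))
  also have "\<dots> \<longleftrightarrow> (\<exists>h\<in>\<phi> ` carrier T. \<exists>k\<in>\<phi> ` carrier T. h \<otimes>\<^bsub>P\<^esub> k = \<zero>\<^bsub>P\<^esub> \<and> h \<noteq> \<zero>\<^bsub>P\<^esub> \<and> k \<noteq> \<zero>\<^bsub>P\<^esub>)"
    by (simp only: Bex_def image_iff) blast
  also have "\<phi> ` carrier T = carrier P" using bij by (simp add: bij_betw_def)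
  also have "(\<exists>h\<in>carrier P. \<exists>k\<in>carrier P. h \<otimes>\<^bsub>P\<^esub> k = \<zero>\<^bsub>P\<^esub> \<and> h \<noteq> \<zero>\<^bsub>P\<^esub> \<and> k \<noteq> \<zero>\<^bsub>P\<^esub>)
     \<longleftrightarrow> (\<exists>h k. DD.deg_below p h \<and> DD.deg_below p k \<and> h \<noteq> DD.zr \<and> k \<noteq> DD.zr \<and> h \<otimes>\<^bsub>DD.R\<^esub> k \<in> lmults DD.R fD)"
    using DA.rem_zero_iff[OF fD DD.mult_up[OF DD.deg_below_up DD.deg_below_up]] by (auto simp: P_carrier P_simps)
  also have "\<dots> \<longleftrightarrow> (\<exists>z\<in>carrier DE. dE = V_pow DE \<delta>' p z \<ominus>\<^bsub>DE\<^esub> z)"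
    by (rule DD.AS_poly_no_zero_divisors_iff[OF dE_closed])
  finally show ?thesis by blast
qed

text \<open>By the defining property of \<open>V_p\<close>, \<open>t^p - (t - z)^p\<close> is the
  constant \<open>V_p(z)\<close>, so both conditions compare the same constants.\<close>

lemma V_pow_const_iff:
  assumes z: "z \<in> carrier DE"
  shows "const_poly DE dE = t_var DE [^]\<^bsub>DD.R\<^esub> p \<ominus>\<^bsub>DD.R\<^esub> (t_var DE \<ominus>\<^bsub>DD.R\<^esub> const_poly DE z) [^]\<^bsub>DD.R\<^esub> p
               \<ominus>\<^bsub>DD.R\<^esub> const_poly DE z \<longleftrightarrow> dE = V_pow DE \<delta>' p z \<ominus>\<^bsub>DE\<^esub> z"
proof -
  let ?v = "V_pow DE \<delta>' p z"
  have v: "?v \<in> carrier DE" using z DD.V_pow_eq by simp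
  have e: "const_poly DE dE = DD.mon dE 0" "const_poly DE z = DD.mon z 0" "t_var DE = DD.mon \<one>\<^bsub>DE\<^esub> (Suc 0)"
    using DD.monomial_eq dE_closed z by auto
  have c: "DD.mon \<one>\<^bsub>DE\<^esub> p \<in> carrier DD.R" "DD.mon ?v 0 \<in> carrier DD.R" using v by (auto simp: DD.R_simps)
  have "DD.mon \<one>\<^bsub>DE\<^esub> p \<ominus>\<^bsub>DD.R\<^esub> (DD.mon \<one>\<^bsub>DE\<^esub> p \<ominus>\<^bsub>DD.R\<^esub> DD.mon ?v 0) = DD.mon ?v 0"
    using c by (simp add: DD.R.minus_eq DD.R.minus_add DD.R.minus_minus DD.R.r_neg2)
  then have "t_var DE [^]\<^bsub>DD.R\<^esub> p \<ominus>\<^bsub>DD.R\<^esub> (t_var DE \<ominus>\<^bsub>DD.R\<^esub> const_poly DE z) [^]\<^bsub>DD.R\<^esub> p \<ominus>\<^bsub>DD.R\<^esub> const_poly DE z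
      = DD.mon ?v 0 \<ominus>\<^bsub>DD.R\<^esub> DD.mon z 0"
    unfolding e DD.t_minus_def[symmetric] DD.t_pow DD.t_minus_pow_p[OF z] DD.V_pow_eq[OF z] by simp
  also have "\<dots> = DD.mon (?v \<ominus>\<^bsub>DE\<^esub> z) 0"
    using v z by (simp add: DD.R_minus) (rule ext, simp add: DD.mon_def DE.minus_eq)
  finally have "const_poly DE dE = t_var DE [^]\<^bsub>DD.R\<^esub> p \<ominus>\<^bsub>DD.R\<^esub> (t_var DE \<ominus>\<^bsub>DD.R\<^esub> const_poly DE z) [^]\<^bsub>DD.R\<^esub> p
               \<ominus>\<^bsub>DD.R\<^esub> const_poly DE z \<longleftrightarrow> DD.mon dE 0 = DD.mon (?v \<ominus>\<^bsub>DE\<^esub> z) 0"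
    using e(1) by simp
  also have "\<dots> \<longleftrightarrow> dE = ?v \<ominus>\<^bsub>DE\<^esub> z" by (auto simp: DD.mon_def dest: fun_cong[of _ _ 0])
  finally show ?thesis .
qed

section \<open>The automorphism of order p\<close>

lemma G_deg_below: "DD.deg_below n h \<Longrightarrow> DD.deg_below n (DD.G h)"
  by (rule DD.deg_below_subst_t_t_minus) simp_all

lemma G_pow_deg_below: "DD.deg_below n h \<Longrightarrow> DD.deg_below n ((DD.G ^^ k) h)"
  by (induction k) (auto intro: G_deg_below)

text \<open>The inverse is the iterate \<open>p - 1\<close> of \<open>G\<close>.\<close>

lemma G_P_bij: "bij_betw DD.G (carrier P) (carrier P)"
proof (rule bij_betw_byWitness[where f' = "DD.G ^^ (p - 1)"])
  have p: "p = Suc (p - 1)" using p_pos by simp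
  have "(DD.G ^^ p) h = (DD.G ^^ (p - 1)) (DD.G h)" "(DD.G ^^ p) h = DD.G ((DD.G ^^ (p - 1)) h)" for h
    by (subst p, simp only: funpow_Suc_right o_apply) (subst p, simp only: funpow.simps o_apply)
  then show "\<forall>a\<in>carrier P. (DD.G ^^ (p - 1)) (DD.G a) = a" "\<forall>a'\<in>carrier P. DD.G ((DD.G ^^ (p - 1)) a') = a'"
    using DD.G_pow_p by (auto simp: P_carrier simp del: funpow.simps)
  show "DD.G ` carrier P \<subseteq> carrier P" "(DD.G ^^ (p - 1)) ` carrier P \<subseteq> carrier P"
    using G_deg_below G_pow_deg_below by (auto simp: P_carrier)
qed

text \<open>Applying \<open>G\<close> to \<open>h k = q f + r\<close> gives another division by
  \<open>f\<close>: the substitution is multiplicative, fixes \<open>f\<close> and does not raise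
  the degree of \<open>r\<close>.\<close>

lemma G_P_mult:
  assumes h: "h \<in> carrier P" and k: "k \<in> carrier P"
  shows "DD.G (h \<otimes>\<^bsub>P\<^esub> k) = DD.G h \<otimes>\<^bsub>P\<^esub> DD.G k"
proof -
  have hu: "h \<in> up DE" "k \<in> up DE" and fu: "fD \<in> up DE" using h k fD by (auto simp: P_carrier)
  obtain q r where qr: "q \<in> up DE" "DD.deg_below p r" "h \<otimes>\<^bsub>DD.R\<^esub> k = (\<lambda>n. (q \<otimes>\<^bsub>DD.R\<^esub> fD) n \<oplus>\<^bsub>DE\<^esub> r n)"
     "right_mod DE \<delta>' (h \<otimes>\<^bsub>DD.R\<^esub> k) fD = r"
    using DA.rem_obtain[OF fD DD.mult_up[OF hu]] .
  note Gm = DD.subst_t_mult[OF _ _ DD.var_like_t_minus_1]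
  have "DD.G h \<otimes>\<^bsub>DD.R\<^esub> DD.G k = DD.G (h \<otimes>\<^bsub>DD.R\<^esub> k)" using Gm[OF hu] by simp
  also have "\<dots> = (\<lambda>n. (DD.G q \<otimes>\<^bsub>DD.R\<^esub> fD) n \<oplus>\<^bsub>DE\<^esub> DD.G r n)"
    unfolding qr(3) using qr(1,2) fu DD.subst_t_add[of "q \<otimes>\<^bsub>DD.R\<^esub> fD" r "DD.t_minus \<one>\<^bsub>DE\<^esub>"] Gm[OF qr(1) fu] DD.G_AS_poly[OF dE_closed] by simp
  finally have "right_mod DE \<delta>' (DD.G h \<otimes>\<^bsub>DD.R\<^esub> DD.G k) fD = DD.G r"
    by (rule DD.right_mod_eq[OF fD DD.nontriv DD.G_up[OF qr(1)] G_deg_below[OF qr(2)]])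
  then show ?thesis by (simp add: P_simps qr(4))
qed

text \<open>\<open>G\<close> is the translation on \<open>P\<close> conjugated by
  \<open>\<phi>\<close>; equations in \<open>T\<close> are verified after applying
  \<open>\<phi>\<close>, where they are properties of the substitution.\<close>

lemma automorphism:
  assumes \<phi>: "\<phi> \<in> algebra_iso K T P" and \<phi>pt: "\<And>h x. h \<in> carrier S \<Longrightarrow> x \<in> carrier D \<Longrightarrow> \<phi> (ptT h x) = Psi x h"
    and G_def: "G = (\<lambda>u\<in>carrier T. inv_into (carrier T) \<phi> (G_id_minus_one DE \<delta>' (\<phi> u)))"
  shows "G \<in> carrier (algebra_Aut K T)"
    "subgroup (carrier (subgroup_generated (algebra_Aut K T) {G})) (algebra_Aut K T)"
    "cyclic_group (subgroup_generated (algebra_Aut K T) {G})"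
    "Coset.order (subgroup_generated (algebra_Aut K T) {G}) = p"
    "\<And>x. x \<in> carrier D \<Longrightarrow> G (ptT \<one>\<^bsub>S\<^esub> x) = ptT \<one>\<^bsub>S\<^esub> x"
proof -
  let ?A = "algebra_Aut K T"
  have bij: "bij_betw \<phi> (carrier T) (carrier P)" and one: "\<phi> \<one>\<^bsub>T\<^esub> = \<one>\<^bsub>P\<^esub>"
    and add: "\<And>u v. u \<in> carrier T \<Longrightarrow> v \<in> carrier T \<Longrightarrow> \<phi> (u \<oplus>\<^bsub>T\<^esub> v) = \<phi> u \<oplus>\<^bsub>P\<^esub> \<phi> v"
    and mult: "\<And>u v. u \<in> carrier T \<Longrightarrow> v \<in> carrier T \<Longrightarrow> \<phi> (u \<otimes>\<^bsub>T\<^esub> v) = \<phi> u \<otimes>\<^bsub>P\<^esub> \<phi> v"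
    and sm: "\<And>c u. c \<in> carrier K \<Longrightarrow> u \<in> carrier T \<Longrightarrow> \<phi> (c \<odot>\<^bsub>T\<^esub> u) = c \<odot>\<^bsub>P\<^esub> \<phi> u"
    using \<phi> by (auto simp: algebra_iso_def ring_iso_def ring_hom_def)
  note aT = nonassoc_algebraD[OF algebra_T] and aP = nonassoc_algebraD[OF algebra_P]
  interpret VT: vectorspace K T by (rule aT(1))
  have oneT: "\<one>\<^bsub>T\<^esub> \<in> carrier T" using ptT_closed S_one_closed by (simp add: T_one)
  have \<phi>c: "\<And>u. u \<in> carrier T \<Longrightarrow> \<phi> u \<in> carrier P" using bij by (auto simp: bij_betw_def)
  define \<theta> where "\<theta> = inv_into (carrier T) \<phi>"
  have \<theta>bij: "bij_betw \<theta> (carrier P) (carrier T)" unfolding \<theta>_def using bij by (rule bij_betw_inv_into)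
  have \<theta>c: "\<And>w. w \<in> carrier P \<Longrightarrow> \<theta> w \<in> carrier T" using \<theta>bij by (auto simp: bij_betw_def)
  have \<phi>\<theta>: "\<And>w. w \<in> carrier P \<Longrightarrow> \<phi> (\<theta> w) = w" unfolding \<theta>_def using bij by (rule bij_betw_inv_into_right)
  have \<theta>\<phi>: "\<And>u. u \<in> carrier T \<Longrightarrow> \<theta> (\<phi> u) = u" unfolding \<theta>_def using bij by (rule bij_betw_inv_into_left)
  have GP: "\<And>w. w \<in> carrier P \<Longrightarrow> DD.G w \<in> carrier P" using G_deg_below by (simp add: P_carrier)
  have G: "G u = \<theta> (DD.G (\<phi> u))" if "u \<in> carrier T" for u
    unfolding G_def \<theta>_def using that \<phi>c[OF that] DD.G_id_minus_one_eq by (simp add: P_carrier)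
  have Gc: "G u \<in> carrier T" if "u \<in> carrier T" for u using that by (simp add: G \<theta>c GP \<phi>c)
  have \<phi>G: "\<phi> (G u) = DD.G (\<phi> u)" if "u \<in> carrier T" for u using that by (simp add: G \<phi>\<theta> GP \<phi>c)
  have eqI: "u = v" if "u \<in> carrier T" "v \<in> carrier T" "\<phi> u = \<phi> v" for u v using that \<theta>\<phi> by metis
  have "bij_betw (\<theta> \<circ> (DD.G \<circ> \<phi>)) (carrier T) (carrier T)"
    using bij_betw_trans[OF bij_betw_trans[OF bij G_P_bij] \<theta>bij] by simp
  then have Gbij: "bij_betw G (carrier T) (carrier T)"
    by (rule bij_betw_cong[THEN iffD1, rotated]) (simp add: G)
  have Pu: "\<And>w. w \<in> carrier P \<Longrightarrow> w \<in> up DE" by (simp add: P_carrier)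
  have "G (x \<otimes>\<^bsub>T\<^esub> y) = G x \<otimes>\<^bsub>T\<^esub> G y" if "x \<in> carrier T" "y \<in> carrier T" for x y
    using that by (intro eqI) (auto simp: Gc aT \<phi>G mult G_P_mult \<phi>c)
  moreover have "G (x \<oplus>\<^bsub>T\<^esub> y) = G x \<oplus>\<^bsub>T\<^esub> G y" if "x \<in> carrier T" "y \<in> carrier T" for x y
    using that DD.subst_t_add[OF Pu[OF \<phi>c[OF that(1)]] Pu[OF \<phi>c[OF that(2)]]]
    by (intro eqI) (auto simp: Gc \<phi>G add P_simps)
  moreover have "G (c \<odot>\<^bsub>T\<^esub> x) = c \<odot>\<^bsub>T\<^esub> G x" if "c \<in> carrier K" "x \<in> carrier T" for c x
    using that DA.subst_t_scale[OF Pu[OF \<phi>c[OF that(2)]] that(1)]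
    by (intro eqI) (auto simp: Gc \<phi>G sm P_simps)
  moreover have "G \<one>\<^bsub>T\<^esub> = \<one>\<^bsub>T\<^esub>"
    using oneT DD.subst_t_const[of "\<one>\<^bsub>DE\<^esub>" "DD.t_minus \<one>\<^bsub>DE\<^esub>"] by (intro eqI) (auto simp: Gc \<phi>G one P_simps)
  ultimately have Giso: "G \<in> algebra_iso K T T" unfolding algebra_iso_self_iff using Gbij by blast
  \<comment> \<open>Members of \<open>Bij\<close> are extensional, which is why \<open>G\<close> is
    defined as a restricted function.\<close>
  have GB: "G \<in> Bij (carrier T)" unfolding Bij_def using Gbij by (simp add: G_def)
  have A_simps: "carrier ?A = algebra_iso K T T \<inter> Bij (carrier T)" "\<one>\<^bsub>?A\<^esub> = (\<lambda>x\<in>carrier T. x)"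
    "monoid.mult ?A = (\<lambda>g\<in>Bij (carrier T). \<lambda>f\<in>Bij (carrier T). compose (carrier T) g f)"
    by (simp_all add: algebra_Aut_def BijGroup_def)
  show GA: "G \<in> carrier ?A" using Giso GB by (simp add: A_simps)
  interpret A: group ?A using algebra_T oneT by (rule group_algebra_Aut)
  show "subgroup (carrier (subgroup_generated ?A {G})) ?A" by (rule A.subgroup_subgroup_generated)
  show "cyclic_group (subgroup_generated ?A {G})" by (rule A.cyclic_group_generated)
  have pow: "(G [^]\<^bsub>?A\<^esub> n) u = \<theta> ((DD.G ^^ n) (\<phi> u))" if "u \<in> carrier T" for n :: nat and u
    using that
  proof (induction n arbitrary: u)
    case 0
    then show ?case by (simp add: A_simps \<theta>\<phi>)
  next
    case (Suc n)
    have "G [^]\<^bsub>?A\<^esub> n \<in> Bij (carrier T)" using A.nat_pow_closed[OF GA, of n] by (simp add: A_simps)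
    then have "(G [^]\<^bsub>?A\<^esub> Suc n) u = (G [^]\<^bsub>?A\<^esub> n) (G u)" using GB Suc.prems by (simp add: A_simps compose_def)
    also have "\<dots> = \<theta> ((DD.G ^^ n) (DD.G (\<phi> u)))" using Suc.IH[OF Gc[OF Suc.prems]] \<phi>G[OF Suc.prems] by simp
    also have "\<dots> = \<theta> ((DD.G ^^ Suc n) (\<phi> u))" by (simp add: funpow_swap1)
    finally show ?case .
  qed
  have "G [^]\<^bsub>?A\<^esub> p = \<one>\<^bsub>?A\<^esub>"
  proof (rule extensionalityI[of _ "carrier T"])
    show "G [^]\<^bsub>?A\<^esub> p \<in> extensional (carrier T)" using A.nat_pow_closed[OF GA, of p] by (simp add: A_simps Bij_def)
    show "\<one>\<^bsub>?A\<^esub> \<in> extensional (carrier T)" by (simp add: A_simps)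
    show "(G [^]\<^bsub>?A\<^esub> p) u = \<one>\<^bsub>?A\<^esub> u" if "u \<in> carrier T" for u
      unfolding pow[OF that] using that DD.G_pow_p[OF Pu[OF \<phi>c[OF that]]] \<theta>\<phi> by (simp add: A_simps)
  qed
  then have "A.ord G dvd p" using A.pow_eq_id[OF GA] by simp
  \<comment> \<open>The order divides the prime \<open>p\<close>, so it only remains to see that
    \<open>G\<close> moves something: it moves \<open>t\<close>, which is a reduced polynomial
    because \<open>p \<ge> 2\<close>.\<close>
  moreover have "A.ord G \<noteq> 1"
  proof
    assume "A.ord G = 1"
    then have "G = \<one>\<^bsub>?A\<^esub>" using A.ord_eq_1[OF GA] by simp
    let ?t = "DD.mon \<one>\<^bsub>DE\<^esub> (Suc 0)"
    have t: "?t \<in> carrier P" using DD.deg_below_mon[of "\<one>\<^bsub>DE\<^esub>" "Suc 0" p] E.p_ge_2 by (simp add: P_carrier)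
    have "G (\<theta> ?t) = \<theta> ?t" using \<open>G = \<one>\<^bsub>?A\<^esub>\<close> \<theta>c[OF t] by (simp add: A_simps)
    then have "DD.G ?t = ?t" using \<phi>G[OF \<theta>c[OF t]] \<phi>\<theta>[OF t] by simp
    then have "DD.G ?t 0 = ?t 0" by simp
    moreover have "?t 0 = \<zero>\<^bsub>DE\<^esub>" by (simp add: DD.mon_def)
    moreover have "DD.G ?t 0 = \<ominus>\<^bsub>DE\<^esub> \<one>\<^bsub>DE\<^esub>" using DD.G_pow_t[of 1] by simp
    ultimately have "\<ominus>\<^bsub>DE\<^esub> \<one>\<^bsub>DE\<^esub> = \<zero>\<^bsub>DE\<^esub>" by simp
    then have "\<one>\<^bsub>DE\<^esub> = \<zero>\<^bsub>DE\<^esub>" using DE.minus_minus[of "\<one>\<^bsub>DE\<^esub>"] by simp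
    then show False using DD.nontriv by simp
  qed
  ultimately have "A.ord G = p" using E.prime_p by (auto simp: prime_nat_iff)
  then show "Coset.order (subgroup_generated ?A {G}) = p" using A.cyclic_order_is_ord[OF GA] by simp
  \<comment> \<open>\<open>1 \<otimes> x\<close> corresponds to a constant polynomial, and
    substitution fixes constants.\<close>
  show "G (ptT \<one>\<^bsub>S\<^esub> x) = ptT \<one>\<^bsub>S\<^esub> x" if x: "x \<in> carrier D" for x
  proof (rule eqI)
    have c: "ptT \<one>\<^bsub>S\<^esub> x \<in> carrier T" using ptT_closed[OF S_one_closed x] .
    show "G (ptT \<one>\<^bsub>S\<^esub> x) \<in> carrier T" "ptT \<one>\<^bsub>S\<^esub> x \<in> carrier T" using c Gc by auto
    have "\<phi> (ptT \<one>\<^bsub>S\<^esub> x) = DD.mon (ptD x \<one>\<^bsub>E\<^esub>) 0" using \<phi>pt[OF S_one_closed x] x by (simp add: S_one Psi_mon)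
    then show "\<phi> (G (ptT \<one>\<^bsub>S\<^esub> x)) = \<phi> (ptT \<one>\<^bsub>S\<^esub> x)" using \<phi>G[OF c] DD.subst_t_const[of "ptD x \<one>\<^bsub>E\<^esub>"] ptD_closed[OF x] by simp
  qed
qed

end

text \<open>Only the coefficients of the minimum polynomial at \<open>p\<close> and 1 survive in its
  value at \<delta>; these indices are distinct since \<open>p \<ge> 2\<close>.\<close>

lemma derivation_pow_of_minimum_polynomial:
  fixes E :: "'e ring"
  assumes field_E: "field E" and subfield_F: "subfield F E"
    and K_def: "K = E\<lparr>carrier := F\<rparr>" and EF_def: "EF = self_algebra E"
    and p: "p \<ge> 2" and der: "derivation E \<delta>"
    and minpoly: "is_minimum_polynomial K EF \<delta> (monomial K \<one>\<^bsub>K\<^esub> p \<ominus>\<^bsub>UP K\<^esub> monomial K \<one>\<^bsub>K\<^esub> 1)"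
    and x: "x \<in> carrier E"
  shows "(\<delta> ^^ p) x = \<delta> x"
proof -
  interpret E: field E by fact
  have "nonassoc_algebra K EF" unfolding K_def EF_def using field_E subfield_F by (rule nonassoc_self_algebra)
  then interpret V: vectorspace K EF by (simp add: nonassoc_algebra_def)
  interpret U: UP_ring K "UP K" by unfold_locales simp
  have sim: "carrier EF = carrier E" by (simp add: EF_def)
  let ?g = "monomial K \<one>\<^bsub>K\<^esub> p \<ominus>\<^bsub>UP K\<^esub> monomial K \<one>\<^bsub>K\<^esub> 1"
  have mc: "monomial K \<one>\<^bsub>K\<^esub> i \<in> carrier (UP K)" for i by (rule U.monom_closed) simp
  have gc: "?g \<in> carrier (UP K)" using mc by simp
  have co: "up_ring.coeff (UP K) ?g i = (if i = p then \<one>\<^bsub>K\<^esub> else \<zero>\<^bsub>K\<^esub>) \<ominus>\<^bsub>K\<^esub> (if i = 1 then \<one>\<^bsub>K\<^esub> else \<zero>\<^bsub>K\<^esub>)" for i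
    using U.coeff_minus[OF mc mc, of p 1 i] by (auto simp: U.coeff_monom)
  have cp: "up_ring.coeff (UP K) ?g p = \<one>\<^bsub>K\<^esub>" and c1: "up_ring.coeff (UP K) ?g 1 = \<ominus>\<^bsub>K\<^esub> \<one>\<^bsub>K\<^esub>"
    and c0: "\<And>i. i \<noteq> p \<Longrightarrow> i \<noteq> 1 \<Longrightarrow> up_ring.coeff (UP K) ?g i = \<zero>\<^bsub>K\<^esub>"
    unfolding co using p by (auto simp: V.R.minus_eq)
  have pd: "p \<le> deg K ?g"
  proof (rule U.deg_belowI)
    show "up_ring.coeff (UP K) ?g p \<noteq> \<zero>\<^bsub>K\<^esub>" unfolding cp by (rule V.one_not_zero)
  qed (rule gc)
  have dc: "(\<delta> ^^ i) x \<in> carrier EF" for i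
    by (induction i) (use x der in \<open>auto simp: sim derivation_def\<close>)
  have "\<zero>\<^bsub>EF\<^esub> = eval_at_map K EF \<delta> ?g x" using minpoly x by (simp add: is_minimum_polynomial_def sim)
  also have "\<dots> = (\<Oplus>\<^bsub>EF\<^esub>i\<in>{p, 1}. up_ring.coeff (UP K) ?g i \<odot>\<^bsub>EF\<^esub> (\<delta> ^^ i) x)"
    unfolding eval_at_map_def using pd p dc gc c0 U.coeff_closed[OF gc]
    by (intro V.M.add.finprod_mono_neutral_cong_right) (auto simp: V.R.minus_eq)
  also have "\<dots> = \<one>\<^bsub>K\<^esub> \<odot>\<^bsub>EF\<^esub> (\<delta> ^^ p) x \<oplus>\<^bsub>EF\<^esub> (\<ominus>\<^bsub>K\<^esub> \<one>\<^bsub>K\<^esub>) \<odot>\<^bsub>EF\<^esub> (\<delta> ^^ 1) x"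
    using p dc[of p] dc[of 1] cp c1 by (subst V.M.finsum_insert) auto
  also have "\<dots> = (\<delta> ^^ p) x \<ominus>\<^bsub>EF\<^esub> \<delta> x" using dc[of p] dc[of 1] by (simp add: V.smult_minus_1 V.M.minus_eq)
  finally show ?thesis using dc[of p] dc[of 1] by (simp add: V.M.minus_eq) (metis V.M.minus_equality V.M.minus_minus V.M.a_inv_closed)
qed

text \<open>The values on pure tensors determine the isomorphism, so \<open>G\<close> is the
  translation of the polynomial description carried over to the tensor product. In (c) the elements
  \<open>d\<close> and \<open>z\<close> appear as constant polynomials because that equation lives
  in the polynomial ring.\<close>

theorem theorem25:
  fixes E :: "'e ring" and F :: "'e set" and p :: nat and \<delta> :: "'e \<Rightarrow> 'e"
    and D :: "('e, 'd) module" and d :: 'e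
    and \<delta>' :: "('d \<times> 'e \<Rightarrow> 'e) set \<Rightarrow> ('d \<times> 'e \<Rightarrow> 'e) set"
    and K :: "'e ring" and EF :: "('e, 'e) module"
    and DE :: "('e, ('d \<times> 'e \<Rightarrow> 'e) set) module"
    and S :: "('e, nat \<Rightarrow> 'e) module"
    and T :: "('e, ((nat \<Rightarrow> 'e) \<times> 'd \<Rightarrow> 'e) set) module"
    and P :: "('e, nat \<Rightarrow> ('d \<times> 'e \<Rightarrow> 'e) set) module"
    and R :: "(nat \<Rightarrow> ('d \<times> 'e \<Rightarrow> 'e) set) ring"
    and dE :: "('d \<times> 'e \<Rightarrow> 'e) set"
  assumes field_E: "field E" and subfield_F: "subfield F E"
    and K_def: "K = E\<lparr>carrier := F\<rparr>" and EF_def: "EF = self_algebra E"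
    and char_E: "has_characteristic E p" and p_pos: "p > 0"
    and fin_dim_E: "vectorspace.fin_dim K EF"
    and insep: "purely_inseparable E F p" and exponent_one: "has_exponent E F p 1"
    and der: "derivation E \<delta>" and F_def: "F = {a \<in> carrier E. \<delta> a = \<zero>\<^bsub>E\<^esub>}"
    and cda: "central_division_algebra K D"
    and DE_def: "DE = tensor_algebra K D EF"
    and DE_division: "division_algebra K DE"
    and der': "derivation DE \<delta>'"
    and ext_E: "\<And>a. a \<in> carrier E \<Longrightarrow>
      \<delta>' (pure_tensor K D EF \<one>\<^bsub>D\<^esub> a) = pure_tensor K D EF \<one>\<^bsub>D\<^esub> (\<delta> a)"
    and ext_D: "\<And>x. x \<in> carrier D \<Longrightarrow> \<delta>' (pure_tensor K D EF x \<one>\<^bsub>E\<^esub>) = \<zero>\<^bsub>DE\<^esub>"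
    and minpoly: "is_minimum_polynomial K EF \<delta> (monomial K \<one>\<^bsub>K\<^esub> p \<ominus>\<^bsub>UP K\<^esub> monomial K \<one>\<^bsub>K\<^esub> 1)"
    and d: "d \<in> carrier E"
    and S_def: "S = petit_algebra EF \<delta> (AS_poly EF \<delta> p d)"
    and T_def: "T = tensor_algebra K S D"
    and dE_def: "dE = pure_tensor K D EF \<one>\<^bsub>D\<^esub> d"
    and R_def: "R = diff_poly_ring DE \<delta>'"
    and P_def: "P = petit_algebra DE \<delta>' (AS_poly DE \<delta>' p dE)"
  shows
    "(division_algebra K T \<and> vectorspace.fin_dim K T \<and>
        vectorspace.dim K T = p\<^sup>2 * vectorspace.dim K D
      \<longleftrightarrow> (\<forall>z\<in>carrier DE. dE \<noteq> V_pow DE \<delta>' p z \<ominus>\<^bsub>DE\<^esub> z)) \<and>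
     ((\<forall>z\<in>carrier DE. dE \<noteq> V_pow DE \<delta>' p z \<ominus>\<^bsub>DE\<^esub> z)
      \<longleftrightarrow> (\<forall>z\<in>carrier DE. const_poly DE dE \<noteq>
             t_var DE [^]\<^bsub>R\<^esub> p \<ominus>\<^bsub>R\<^esub> (t_var DE \<ominus>\<^bsub>R\<^esub> const_poly DE z) [^]\<^bsub>R\<^esub> p
               \<ominus>\<^bsub>R\<^esub> const_poly DE z)) \<and>
     (\<exists>\<phi> \<in> algebra_iso K T P.
        (\<forall>h\<in>carrier S. \<forall>x\<in>carrier D.
           \<phi> (pure_tensor K S D h x) = (\<lambda>i. pure_tensor K D EF x (h i))) \<and>
        (let G = (\<lambda>u\<in>carrier T. inv_into (carrier T) \<phi> (G_id_minus_one DE \<delta>' (\<phi> u)));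
             A = algebra_Aut K T
         in G \<in> carrier A \<and>
            subgroup (carrier (subgroup_generated A {G})) A \<and>
            cyclic_group (subgroup_generated A {G}) \<and>
            order (subgroup_generated A {G}) = p \<and>
            (\<forall>x\<in>carrier D. G (pure_tensor K S D \<one>\<^bsub>S\<^esub> x) = pure_tensor K S D \<one>\<^bsub>S\<^esub> x)))"
  proof -
  interpret E: field E by (rule field_E)
  have prime: "Factorial_Ring.prime p" using char_E p_pos by (rule E.characteristic_prime)
  have p2: "p \<ge> 2" using prime prime_ge_2_nat by blast
  have AS: "AS_field E \<delta> p"
  proof (intro AS_field.intro diff_ring_p.intro diff_ring.intro diff_ring_axioms.intro
      diff_ring_p_axioms.intro AS_field_axioms.intro)
    show "field E" by (rule field_E)
    show "ring E" by (rule E.ring_axioms)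
    show "derivation E \<delta>" by (rule der)
    show "Factorial_Ring.prime p" by (rule prime)
    show "\<one>\<^bsub>E\<^esub> \<noteq> \<zero>\<^bsub>E\<^esub>" by (rule E.one_not_zero)
    fix x assume x: "x \<in> carrier E"
    have "[p] \<cdot>\<^bsub>E\<^esub> \<one>\<^bsub>E\<^esub> = \<zero>\<^bsub>E\<^esub>" using char_E by (simp add: has_characteristic_def)
    then have "([p] \<cdot>\<^bsub>E\<^esub> \<one>\<^bsub>E\<^esub>) \<otimes>\<^bsub>E\<^esub> x = \<zero>\<^bsub>E\<^esub>" using x by simp
    then show "[p] \<cdot>\<^bsub>E\<^esub> x = \<zero>\<^bsub>E\<^esub>" using x by (simp add: E.add_pow_ldistr)
    show "(\<delta> ^^ p) x = \<delta> x"
      by (rule derivation_pow_of_minimum_polynomial[OF field_E subfield_F K_def EF_def p2 der minpoly x])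
  next
    \<comment> \<open>Minimality of the exponent at \<open>e' = 0\<close>, where
      \<open>p ^ 0 = 1\<close>, supplies an element outside \<open>F\<close>, that is, one not
      killed by \<delta>.\<close>
    obtain x where x: "x \<in> carrier E" "x [^]\<^bsub>E\<^esub> (p ^ 0) \<notin> F" using exponent_one unfolding has_exponent_def by blast
    then have "x \<notin> F" by (simp add: E.nat_pow_eone)
    then show "\<exists>x\<in>carrier E. \<delta> x \<noteq> \<zero>\<^bsub>E\<^esub>" using x F_def by blast
  qed
  interpret AS_tensor E F p \<delta> D d \<delta>' K EF DE S T P dE
    by (rule AS_tensor.intro[OF AS subfield_F F_def K_def EF_def _ _ _ DE_def DE_division der' ext_E ext_D d S_def T_def dE_def P_def])
       (use cda in \<open>simp_all add: central_division_algebra_def division_algebra_def\<close>)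
  obtain \<phi> where \<phi>: "\<phi> \<in> algebra_iso K T P" "\<And>h x. h \<in> carrier S \<Longrightarrow> x \<in> carrier D \<Longrightarrow> \<phi> (ptT h x) = Psi x h"
    using phi_exists by blast
  have "division_algebra K T \<and> vectorspace.fin_dim K T \<and> vectorspace.dim K T = p\<^sup>2 * vectorspace.dim K D
      \<longleftrightarrow> (\<forall>z\<in>carrier DE. dE \<noteq> V_pow DE \<delta>' p z \<ominus>\<^bsub>DE\<^esub> z)"
    using T_division_iff dim_T by blast
  moreover have "(\<forall>z\<in>carrier DE. dE \<noteq> V_pow DE \<delta>' p z \<ominus>\<^bsub>DE\<^esub> z)
      \<longleftrightarrow> (\<forall>z\<in>carrier DE. const_poly DE dE \<noteq>
             t_var DE [^]\<^bsub>R\<^esub> p \<ominus>\<^bsub>R\<^esub> (t_var DE \<ominus>\<^bsub>R\<^esub> const_poly DE z) [^]\<^bsub>R\<^esub> p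
               \<ominus>\<^bsub>R\<^esub> const_poly DE z)"
    unfolding R_def using V_pow_const_iff by blast
  moreover have "\<forall>h\<in>carrier S. \<forall>x\<in>carrier D. \<phi> (ptT h x) = (\<lambda>i. ptD x (h i))"
    using \<phi>(2) by (simp add: Psi_def)
  moreover note automorphism[OF \<phi> refl]
  ultimately show ?thesis unfolding Let_def using \<phi>(1) by (intro conjI bexI[of _ \<phi>] ballI) simp_all
qed

end
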